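(* Let $\Pi$ be a prior supported in $L^2([0,1])$, and suppose the weak Bernstein--von Mises phenomenon holds true in $\mathcal M_0(w)$ for some admissible sequence $w=(w_l)$ such that $\sum_lw_l2^{-l/2}<\infty$, with centring $T_n$ either equal to $\mathbb X^{(n)}$ or such that $T_n\in L^2$. For $f\sim\Pi(\cdot\mid X)$ (conditional on $X$) define the posterior cumulative distribution function $F(t)=\int_0^tf(x)\,dx$, $t\in[0,1]$, and let $\mathbb T_n(t)=\int_0^tT_n(x)\,dx$ (respectively, $\mathbb T_n(t)=\int_0^tdX^{(n)}(x)$ if $T_n=\mathbb X^{(n)}$). Let $G=(G(t):t\in[0,1])$ be a Brownian motion in the white noise model, or a $P_0$-Brownian bridge $G=G_{P_0}$, $dP_0(x)=f_0(x)dx$, $f_0\in L^\infty$, in the sampling model. If $X\sim P_{f_0}$ for some fixed $f_0$, then, as $n\to\infty$, $$\beta_{C([0,1])}\big(\mathcal L(\sqrt n(F-\mathbb T_n)\mid X),\mathcal L(G)\big)\to0\quad\text{in }P_{f_0}\text{-probability},$$ $$\beta_{\mathbb R}\big(\mathcal L(\sqrt n\|F-\mathbb T_n\|_\infty\mid X),\mathcal L(\|G\|_\infty)\big)\to0\quad\text{in }P_{f_0}\text{-probability}.$$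
   Context: Fix a wavelet basis $\{\psi_{lk}: l\ge J_0-1,\ k=0,\ldots,2^l-1\}$ of $L^2([0,1])$, which is $S$-regular, $S\ge0$: either the Haar basis ($S=J_0=0$), a periodised wavelet basis ($J_0=0$, $S>0$), or a boundary corrected (Cohen--Daubechies--Vial) wavelet basis ($S>0$, $J_0=J_0(S)$ large enough); by convention the scaling function is denoted as the first wavelet $\psi_{(J_0-1)0}$. Functions $f\in L^2$ are identified with their coefficient sequences $\{\langle f,\psi_{lk}\rangle\}\in\ell_2$. For a monotone increasing sequence $w=(w_l)_{l\ge J_0-1}$ with $w_l\ge1$, let $\mathcal M(w)$ be the Banach space of double-indexed sequences $x=\{x_{lk}\}$ with $\|x\|_{\mathcal M(w)}=\sup_l w_l^{-1}\max_k|x_{lk}|<\infty$, and $\mathcal M_0(w)$ its closed separable subspace of $x$ with $\lim_{l\to\infty}w_l^{-1}\max_k|x_{lk}|=0$. The sequence $w$ is admissible if $w_l/\sqrt l\uparrow\infty$ as $l\to\infty$. Models. White noise model: $X=\mathbb X^{(n)}=f+n^{-1/2}\mathbb W$, $\mathbb W=(g_{lk})$ with $g_{lk}$ i.i.d. $N(0,1)$ (equivalently $dX^{(n)}(t)=f(t)dt+n^{-1/2}dW(t)$ on $[0,1]$), $f\in L^2$; $P_{f_0}$ is the law of $\mathbb X^{(n)}$ under $f_0$. Sampling model: $X=(X_1,\ldots,X_n)$ i.i.d. from a bounded density $f$ on $[0,1]$; $P_{f_0}$ is the law $P_0^{\mathbb N}$ of $(X_1,X_2,\ldots)$ under $dP_0=f_0dx$.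 $\Pi(\cdot\mid X)$ is the posterior distribution for the prior $\Pi$. Weak Bernstein--von Mises phenomenon: let $w$ be admissible, $T_n=T_n(X)$ an estimator of $f$ in $\mathcal M_0(w)$, and $\tilde\Pi_n$ the image of $\Pi(\cdot\mid X)$ under $f\mapsto\sqrt n(f-T_n)$. $\Pi$ satisfies the weak Bernstein--von Mises phenomenon in $\mathcal M_0(w)$ with centring $T_n$ if, for $X\sim P_{f_0}$ and fixed $f_0$, $\beta_{\mathcal M_0(w)}(\tilde\Pi_n,\mathcal N)\to0$ in $P_{f_0}$-probability as $n\to\infty$, where $\mathcal N$ is the law in $\mathcal M_0(w)$ of $\mathbb W$ (white noise model) or of $\mathbb G_{P_0}$, $f_0\in L^\infty$ (sampling model). Here $\mathbb G_P$ is the centred Gaussian process indexed by $L^2(P)$ with covariance $\int(g-Pg)(h-Ph)dP$, identified with the sequence $(\mathbb G_P(\psi_{lk}))$. For probability measures $\mu,\nu$ on a metric space $(S,d)$, $\beta_S(\mu,\nu)=\sup_{\|F\|_{BL}\le1}|\int F\,d(\mu-\nu)|$, where $\|F\|_{BL}=\sup_x|F(x)|+\sup_{x\ne y}|F(x)-F(y)|/d(x,y)$. $C([0,1])$ carries the supremum norm $\|\cdot\|_\infty$. A $P_0$-Brownian bridge is a centred Gaussian process on $[0,1]$ with continuous paths and covariance $F_0(s\wedge t)-F_0(s)F_0(t)$, $F_0(t)=\int_0^tf_0$. *)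

theory Defs
  imports "HOL-Probability.Probability"
begin

section \<open>Square-integrable functions and orthonormal bases\<close>

definition leb01 :: "real measure" where
  "leb01 = restrict_space lborel {0..1}"

definition half_line :: "real measure" where
  "half_line = restrict_space lborel {0..}"

definition L2 :: "real measure \<Rightarrow> (real \<Rightarrow> real) set" where
  "L2 M = {f \<in> borel_measurable M. integrable M (\<lambda>x. (f x)\<^sup>2)}"

definition ip :: "real measure \<Rightarrow> (real \<Rightarrow> real) \<Rightarrow> (real \<Rightarrow> real) \<Rightarrow> real" where
  "ip M f g = (\<integral>x. f x * g x \<partial>M)"

definition orthonormal :: "real measure \<Rightarrow> 'i set \<Rightarrow> ('i \<Rightarrow> real \<Rightarrow> real) \<Rightarrow> bool" where
  "orthonormal M I e \<longleftrightarrow> (\<forall>i\<in>I. e i \<in> L2 M) \<and>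
     (\<forall>i\<in>I. \<forall>j\<in>I. ip M (e i) (e j) = (if i = j then 1 else 0))"

text \<open>Completeness is the density of the finite linear combinations in $L^2$.\<close>

definition orthonormal_basis :: "real measure \<Rightarrow> 'i set \<Rightarrow> ('i \<Rightarrow> real \<Rightarrow> real) \<Rightarrow> bool" where
  "orthonormal_basis M I e \<longleftrightarrow> orthonormal M I e \<and>
     (\<forall>f\<in>L2 M. \<forall>\<epsilon>>0. \<exists>J c. finite J \<and> J \<subseteq> I \<and>
        (\<integral>x. (f x - (\<Sum>i\<in>J. c i * e i x))\<^sup>2 \<partial>M) < \<epsilon>)"


section \<open>Wavelets on the real line\<close>

definition dilate :: "(real \<Rightarrow> real) \<Rightarrow> nat \<Rightarrow> int \<Rightarrow> real \<Rightarrow> real" where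
  "dilate g l k x = 2 powr (real l / 2) * g (2 ^ l * x - of_int k)"

text \<open>
  Meyer-type regularity of real order \<open>S\<close>: with \<open>r\<close> the integer part of \<open>S\<close>, the function is
  \<open>r\<close> times continuously differentiable, its derivatives up to order \<open>r\<close> decay faster than any
  power, and the \<open>r\<close>-th one is Hoelder continuous of order \<open>S - r\<close>. For integer \<open>S\<close> the last
  requirement is implied by boundedness.
\<close>

definition regular_decaying :: "real \<Rightarrow> (real \<Rightarrow> real) \<Rightarrow> bool" where
  "regular_decaying S g \<longleftrightarrow> (let r = nat \<lfloor>S\<rfloor> in
     (\<forall>j<r. \<forall>x. (deriv ^^ j) g field_differentiable at x) \<and>
     continuous_on UNIV ((deriv ^^ r) g) \<and>
     (\<forall>j\<le>r. \<forall>m. \<exists>C. \<forall>x. (1 + \<bar>x\<bar>) ^ m * \<bar>(deriv ^^ j) g x\<bar> \<le> C) \<and>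
     (\<exists>C. \<forall>x y. \<bar>(deriv ^^ r) g x - (deriv ^^ r) g y\<bar> \<le> C * \<bar>x - y\<bar> powr (S - real r)))"

text \<open>
  Index \<open>(0, k)\<close> stands for the translate \<open>\<phi>(x - k)\<close> and \<open>(Suc l, k)\<close> for the wavelet
  \<open>2\<^sup>l\<^sup>/\<^sup>2 \<eta>(2\<^sup>l x - k)\<close>. That these functions form an orthonormal basis already forces the spaces
  spanned by the \<open>\<phi>(2\<^sup>l x - k)\<close> to be a multiresolution analysis.
\<close>

definition line_wavelet :: "(real \<Rightarrow> real) \<Rightarrow> (real \<Rightarrow> real) \<Rightarrow> nat \<times> int \<Rightarrow> real \<Rightarrow> real" where
  "line_wavelet \<phi> \<eta> = (\<lambda>(j, k). case j of 0 \<Rightarrow> dilate \<phi> 0 k | Suc l \<Rightarrow> dilate \<eta> l k)"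

definition regular_wavelet_pair :: "real \<Rightarrow> (real \<Rightarrow> real) \<Rightarrow> (real \<Rightarrow> real) \<Rightarrow> bool" where
  "regular_wavelet_pair S \<phi> \<eta> \<longleftrightarrow>
     orthonormal_basis lborel UNIV (line_wavelet \<phi> \<eta>) \<and>
     regular_decaying S \<phi> \<and> regular_decaying S \<eta> \<and>
     (\<integral>x. \<phi> x \<partial>lborel) = 1 \<and>
     (\<forall>j::nat. real j < S \<longrightarrow> (\<integral>x. x ^ j * \<eta> x \<partial>lborel) = 0)"


section \<open>Wavelet bases of the unit interval\<close>

text \<open>
  Level \<open>J0 - 1\<close> carries the scaling functions of resolution \<open>J0\<close>, of which there are \<open>2 ^ J0\<close>
  (just one if \<open>J0 = 0\<close>); every level \<open>l \<ge> J0\<close> carries \<open>2 ^ l\<close> wavelets.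
\<close>

definition level_size :: "nat \<Rightarrow> int \<Rightarrow> nat" where
  "level_size J0 l = (if l < int J0 then 2 ^ J0 else 2 ^ nat l)"

definition index_set :: "nat \<Rightarrow> (int \<times> nat) set" where
  "index_set J0 = {(l, k). int J0 - 1 \<le> l \<and> k < level_size J0 l}"

definition haar_mother :: "real \<Rightarrow> real" where
  "haar_mother x = (if 0 \<le> x \<and> x < 1/2 then 1 else if 1/2 \<le> x \<and> x < 1 then - 1 else 0)"

definition haar :: "int \<Rightarrow> nat \<Rightarrow> real \<Rightarrow> real" where
  "haar l k x = (if l < 0 then 1 else dilate haar_mother (nat l) (int k) x)"

definition periodised ::
    "(real \<Rightarrow> real) \<Rightarrow> (real \<Rightarrow> real) \<Rightarrow> int \<Rightarrow> nat \<Rightarrow> real \<Rightarrow> real" where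
  "periodised \<phi> \<eta> l k x =
     (if l < 0 then (\<Sum>\<^sub>\<infinity>m::int. dilate \<phi> 0 0 (x + of_int m))
      else (\<Sum>\<^sub>\<infinity>m::int. dilate \<eta> (nat l) (int k) (x + of_int m)))"

text \<open>
  Cohen--Daubechies--Vial construction for a pair \<open>\<phi>, \<eta>\<close> with \<open>N\<close> vanishing moments and supports
  in \<open>[1 - N, N]\<close>. On the half line, the translates \<open>\<phi>(x - m)\<close> with \<open>m < N\<close> are replaced by \<open>N\<close>
  edge functions restoring the polynomials of degree less than \<open>N\<close>. Orthonormalising
  \<open>cdv_raw N \<phi> (N - 1), \<dots>, cdv_raw N \<phi> 0\<close> in this order gives edge scaling functions \<open>\<phi>e k\<close>
  supported in \<open>[0, N + k]\<close>; the edge wavelets \<open>\<eta>e k\<close>, also supported in \<open>[0, N + k]\<close>, complete the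
  interior wavelets to an orthonormal basis of the orthogonal complement of the space of
  resolution 0 in that of resolution 1.
\<close>

definition cdv_raw :: "nat \<Rightarrow> (real \<Rightarrow> real) \<Rightarrow> nat \<Rightarrow> real \<Rightarrow> real" where
  "cdv_raw N \<phi> i x = (\<Sum>n = i..2 * N - 2. real (n choose i) * \<phi> (x + real n - real N + 1))"

definition cdv_edge_scaling ::
    "nat \<Rightarrow> (real \<Rightarrow> real) \<Rightarrow> (nat \<Rightarrow> real \<Rightarrow> real) \<Rightarrow> bool" where
  "cdv_edge_scaling N \<phi> \<phi>e \<longleftrightarrow>
     (\<forall>k<N. \<exists>c. \<forall>x\<ge>0. \<phi>e k x = (\<Sum>i = N - 1 - k..<N. c i * cdv_raw N \<phi> i x)) \<and>
     orthonormal half_line {..<N} \<phi>e"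

definition cdv_edge_wavelet ::
    "nat \<Rightarrow> (real \<Rightarrow> real) \<Rightarrow> (real \<Rightarrow> real) \<Rightarrow> (nat \<Rightarrow> real \<Rightarrow> real) \<Rightarrow> (nat \<Rightarrow> real \<Rightarrow> real) \<Rightarrow> bool" where
  "cdv_edge_wavelet N \<phi> \<eta> \<phi>e \<eta>e \<longleftrightarrow>
     (\<forall>k<N. \<exists>a b. \<forall>x\<ge>0. \<eta>e k x = (\<Sum>i<N. a i * dilate (\<phi>e i) 1 0 x) +
        (\<Sum>m = N..N + 2 * k. b m * dilate \<phi> 1 (int m) x)) \<and>
     orthonormal half_line {..<N} \<eta>e \<and>
     (\<forall>k<N. (\<forall>i<N. ip half_line (\<eta>e k) (\<phi>e i) = 0) \<and>
        (\<forall>m\<ge>N. ip half_line (\<eta>e k) (dilate \<phi> 0 (int m)) = 0 \<and>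
                 ip half_line (\<eta>e k) (dilate \<eta> 0 (int m)) = 0))"

text \<open>
  The functions of resolution \<open>l\<close>: \<open>N\<close> left edge functions, \<open>2 ^ l - 2 * N\<close> interior ones, \<open>N\<close>
  right edge functions. The latter are built on the half line from the reflections \<open>\<phi>(1 - x)\<close>,
  \<open>\<eta>(1 - x)\<close> and then reflected at 1.
\<close>

definition interval_family ::
    "nat \<Rightarrow> (nat \<Rightarrow> real \<Rightarrow> real) \<Rightarrow> (real \<Rightarrow> real) \<Rightarrow> (nat \<Rightarrow> real \<Rightarrow> real)
     \<Rightarrow> nat \<Rightarrow> nat \<Rightarrow> real \<Rightarrow> real" where
  "interval_family N left g right l k x =
     (if k < N then dilate (left k) l 0 x
      else if k + N < 2 ^ l then dilate g l (int k) x
      else dilate (right (2 ^ l - 1 - k)) l 0 (1 - x))"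

definition cdv_basis :: "real \<Rightarrow> nat \<Rightarrow> (int \<Rightarrow> nat \<Rightarrow> real \<Rightarrow> real) \<Rightarrow> bool" where
  "cdv_basis S J0 \<psi> \<longleftrightarrow>
     (\<exists>N \<phi> \<eta> \<phi>L \<eta>L \<phi>R \<eta>R. 1 \<le> N \<and> 2 * N \<le> 2 ^ J0 \<and>
        regular_wavelet_pair S \<phi> \<eta> \<and>
        (\<forall>x. x \<notin> {1 - real N..real N} \<longrightarrow> \<phi> x = 0 \<and> \<eta> x = 0) \<and>
        (\<forall>j<N. (\<integral>x. x ^ j * \<eta> x \<partial>lborel) = 0) \<and>
        cdv_edge_scaling N \<phi> \<phi>L \<and> cdv_edge_wavelet N \<phi> \<eta> \<phi>L \<eta>L \<and>
        cdv_edge_scaling N (\<lambda>x. \<phi> (1 - x)) \<phi>R \<and>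
        cdv_edge_wavelet N (\<lambda>x. \<phi> (1 - x)) (\<lambda>x. \<eta> (1 - x)) \<phi>R \<eta>R \<and>
        (\<forall>(l, k)\<in>index_set J0. AE x in leb01.
           \<psi> l k x = (if l < int J0 then interval_family N \<phi>L \<phi> \<phi>R J0 k x
                      else interval_family N \<eta>L \<eta> \<eta>R (nat l) k x)))"

definition wavelet_basis :: "real \<Rightarrow> nat \<Rightarrow> (int \<Rightarrow> nat \<Rightarrow> real \<Rightarrow> real) \<Rightarrow> bool" where
  "wavelet_basis S J0 \<psi> \<longleftrightarrow>
     orthonormal_basis leb01 (index_set J0) (\<lambda>(l, k). \<psi> l k) \<and>
     ((S = 0 \<and> J0 = 0 \<and> (\<forall>(l, k)\<in>index_set J0. AE x in leb01. \<psi> l k x = haar l k x)) \<or>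
      (S > 0 \<and> J0 = 0 \<and> (\<exists>\<phi> \<eta>. regular_wavelet_pair S \<phi> \<eta> \<and>
          (\<forall>(l, k)\<in>index_set J0. AE x in leb01. \<psi> l k x = periodised \<phi> \<eta> l k x))) \<or>
      (S > 0 \<and> cdv_basis S J0 \<psi>))"

definition wavelet_coeffs ::
    "(int \<Rightarrow> nat \<Rightarrow> real \<Rightarrow> real) \<Rightarrow> nat \<Rightarrow> (real \<Rightarrow> real) \<Rightarrow> int \<times> nat \<Rightarrow> real" where
  "wavelet_coeffs \<psi> J0 f = (\<lambda>(l, k)\<in>index_set J0. ip leb01 f (\<psi> l k))"


section \<open>The multiscale spaces\<close>

definition level_max :: "nat \<Rightarrow> (int \<times> nat \<Rightarrow> real) \<Rightarrow> int \<Rightarrow> real" where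
  "level_max J0 x l = Max ((\<lambda>k. \<bar>x (l, k)\<bar>) ` {..<level_size J0 l})"

definition M_norm :: "nat \<Rightarrow> (int \<Rightarrow> real) \<Rightarrow> (int \<times> nat \<Rightarrow> real) \<Rightarrow> real" where
  "M_norm J0 w x = (SUP l\<in>{int J0 - 1..}. level_max J0 x l / w l)"

text \<open>Double-indexed sequences are functions that are undefined off the index set.\<close>

definition M_carrier :: "nat \<Rightarrow> (int \<Rightarrow> real) \<Rightarrow> (int \<times> nat \<Rightarrow> real) set" where
  "M_carrier J0 w = {x \<in> extensional (index_set J0).
     bdd_above ((\<lambda>l. level_max J0 x l / w l) ` {int J0 - 1..})}"

definition M_space :: "nat \<Rightarrow> (int \<Rightarrow> real) \<Rightarrow> (int \<times> nat \<Rightarrow> real) metric" where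
  "M_space J0 w = metric (M_carrier J0 w,
     \<lambda>x y. if x \<in> M_carrier J0 w \<and> y \<in> M_carrier J0 w then M_norm J0 w (\<lambda>i. x i - y i) else 0)"

definition M0_space :: "nat \<Rightarrow> (int \<Rightarrow> real) \<Rightarrow> (int \<times> nat \<Rightarrow> real) metric" where
  "M0_space J0 w = submetric (M_space J0 w) {x. ((\<lambda>l. level_max J0 x l / w l) \<longlongrightarrow> 0) at_top}"

definition weight :: "nat \<Rightarrow> (int \<Rightarrow> real) \<Rightarrow> bool" where
  "weight J0 w \<longleftrightarrow> mono_on {int J0 - 1..} w \<and> (\<forall>l\<ge>int J0 - 1. 1 \<le> w l)"

definition admissible :: "nat \<Rightarrow> (int \<Rightarrow> real) \<Rightarrow> bool" where
  "admissible J0 w \<longleftrightarrow> weight J0 w \<and>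
     mono_on {max 1 (int J0 - 1)..} (\<lambda>l. w l / sqrt (of_int l)) \<and>
     filterlim (\<lambda>l. w l / sqrt (of_int l)) at_top at_top"

lemma level_size_pos: "0 < level_size J0 l"
  by (simp add: level_size_def)

lemma level_max_ge: "k < level_size J0 l \<Longrightarrow> \<bar>x (l, k)\<bar> \<le> level_max J0 x l"
  unfolding level_max_def by (rule Max_ge) auto

lemma level_max_le: "(\<And>k. k < level_size J0 l \<Longrightarrow> \<bar>x (l, k)\<bar> \<le> c) \<Longrightarrow> level_max J0 x l \<le> c"
  unfolding level_max_def using level_size_pos[of J0 l] by (subst Max_le_iff) auto

lemma level_max_nonneg: "0 \<le> level_max J0 x l"
  using level_max_ge[OF level_size_pos, of x l J0] abs_ge_zero order_trans by blast

lemma level_max_triangle: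
  "level_max J0 (\<lambda>i. x i - z i) l \<le> level_max J0 (\<lambda>i. x i - y i) l + level_max J0 (\<lambda>i. y i - z i) l"
proof (rule level_max_le)
  fix k assume "k < level_size J0 l"
  then show "\<bar>x (l, k) - z (l, k)\<bar>
      \<le> level_max J0 (\<lambda>i. x i - y i) l + level_max J0 (\<lambda>i. y i - z i) l"
    using level_max_ge[of k J0 l "\<lambda>i. x i - y i"] level_max_ge[of k J0 l "\<lambda>i. y i - z i"] by simp
qed

lemma level_max_diff: "level_max J0 (\<lambda>i. x i - y i) l \<le> level_max J0 x l + level_max J0 y l"
proof (rule level_max_le)
  fix k assume "k < level_size J0 l"
  then show "\<bar>x (l, k) - y (l, k)\<bar> \<le> level_max J0 x l + level_max J0 y l"
    using level_max_ge[of k J0 l x] level_max_ge[of k J0 l y] by simp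
qed

lemma M_carrier_diff_bdd:
  assumes w: "weight J0 w" and x: "x \<in> M_carrier J0 w" and y: "y \<in> M_carrier J0 w"
  shows "bdd_above ((\<lambda>l. level_max J0 (\<lambda>i. x i - y i) l / w l) ` {int J0 - 1..})"
proof -
  obtain a b where a: "\<And>l. l \<ge> int J0 - 1 \<Longrightarrow> level_max J0 x l / w l \<le> a"
    and b: "\<And>l. l \<ge> int J0 - 1 \<Longrightarrow> level_max J0 y l / w l \<le> b"
    using x y unfolding M_carrier_def bdd_above_def by auto
  show ?thesis
  proof (rule bdd_aboveI2)
    fix l assume l: "l \<in> {int J0 - 1..}"
    then have "0 < w l" using w unfolding weight_def by force
    then have "level_max J0 (\<lambda>i. x i - y i) l / w l \<le> (level_max J0 x l + level_max J0 y l) / w l"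
      by (intro divide_right_mono level_max_diff) simp
    also have "\<dots> \<le> a + b" using a b l by (simp add: add_divide_distrib add_mono)
    finally show "level_max J0 (\<lambda>i. x i - y i) l / w l \<le> a + b" .
  qed
qed

lemma Metric_space_M:
  assumes w: "weight J0 w"
  shows "Metric_space (M_carrier J0 w)
    (\<lambda>x y. if x \<in> M_carrier J0 w \<and> y \<in> M_carrier J0 w then M_norm J0 w (\<lambda>i. x i - y i) else 0)"
proof -
  have wpos: "0 < w l" if "l \<ge> int J0 - 1" for l using w that unfolding weight_def by force
  have upper: "level_max J0 (\<lambda>i. x i - y i) l / w l \<le> M_norm J0 w (\<lambda>i. x i - y i)"
    if "x \<in> M_carrier J0 w" "y \<in> M_carrier J0 w" "l \<ge> int J0 - 1" for x y l
    unfolding M_norm_def using M_carrier_diff_bdd[OF w that(1,2)] that(3)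
    by (intro cSUP_upper) auto
  have nonneg: "0 \<le> M_norm J0 w (\<lambda>i. x i - y i)"
    if "x \<in> M_carrier J0 w" "y \<in> M_carrier J0 w" for x y
    using upper[OF that, of "int J0 - 1"] wpos[of "int J0 - 1"] level_max_nonneg
    by (smt (verit) divide_nonneg_pos)
  show ?thesis
  proof (unfold_locales, goal_cases)
    case (1 x y)
    then show ?case using nonneg by auto
  next
    case (2 x y)
    then show ?case by (simp add: M_norm_def level_max_def abs_minus_commute)
  next
    case (3 x y)
    have "x = y" if 0: "M_norm J0 w (\<lambda>i. x i - y i) = 0"
    proof (rule extensionalityI)
      show "x \<in> extensional (index_set J0)" "y \<in> extensional (index_set J0)"
        using 3 by (auto simp: M_carrier_def)
      fix i assume "i \<in> index_set J0"
      then obtain l k where i: "i = (l, k)" "l \<ge> int J0 - 1" "k < level_size J0 l"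
        by (auto simp: index_set_def)
      have "level_max J0 (\<lambda>i. x i - y i) l \<le> 0"
        using upper[OF 3 i(2)] wpos[OF i(2)] 0 by (simp add: divide_le_0_iff)
      then show "x i = y i" using level_max_ge[OF i(3), of "\<lambda>i. x i - y i"] i(1) by simp
    qed
    moreover have "M_norm J0 w (\<lambda>i. x i - y i) = 0" if "x = y"
    proof -
      have "level_max J0 (\<lambda>i. 0) l = 0" for l
        using level_max_le[of J0 l "\<lambda>i. 0" 0] level_max_nonneg[of J0 "\<lambda>i. 0" l] by simp
      then show ?thesis using that by (simp add: M_norm_def)
    qed
    ultimately show ?case using 3 by auto
  next
    case (4 x y z)
    have "M_norm J0 w (\<lambda>i. x i - z i) \<le> M_norm J0 w (\<lambda>i. x i - y i) + M_norm J0 w (\<lambda>i. y i - z i)"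
      unfolding M_norm_def[of J0 w "\<lambda>i. x i - z i"]
    proof (rule cSUP_least)
      fix l assume l: "l \<in> {int J0 - 1..}"
      have "level_max J0 (\<lambda>i. x i - z i) l / w l
          \<le> (level_max J0 (\<lambda>i. x i - y i) l + level_max J0 (\<lambda>i. y i - z i) l) / w l"
        using l wpos[of l] by (intro divide_right_mono level_max_triangle) auto
      also have "\<dots> \<le> M_norm J0 w (\<lambda>i. x i - y i) + M_norm J0 w (\<lambda>i. y i - z i)"
        using upper[OF 4(1,2), of l] upper[OF 4(2,3), of l] l by (simp add: add_divide_distrib)
      finally show "level_max J0 (\<lambda>i. x i - z i) l / w l
          \<le> M_norm J0 w (\<lambda>i. x i - y i) + M_norm J0 w (\<lambda>i. y i - z i)" .
    qed simp
    then show ?case using 4 by simp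
  qed
qed

lemma mspace_M0_space:
  "weight J0 w \<Longrightarrow> mspace (M0_space J0 w) =
     {x \<in> M_carrier J0 w. ((\<lambda>l. level_max J0 x l / w l) \<longlongrightarrow> 0) at_top}"
  by (auto simp: M0_space_def M_space_def Metric_space.mspace_metric[OF Metric_space_M])

lemma mdist_M0_space:
  "weight J0 w \<Longrightarrow> x \<in> mspace (M0_space J0 w) \<Longrightarrow> y \<in> mspace (M0_space J0 w) \<Longrightarrow>
     mdist (M0_space J0 w) x y = M_norm J0 w (\<lambda>i. x i - y i)"
  by (simp add: mspace_M0_space)
    (simp add: M0_space_def M_space_def Metric_space.mdist_metric[OF Metric_space_M])


section \<open>Weak convergence\<close>

definition metric_borel :: "'a metric \<Rightarrow> 'a measure" where
  "metric_borel m = sigma (mspace m) {U. openin (mtopology_of m) U}"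

definition bl_norm :: "'a metric \<Rightarrow> ('a \<Rightarrow> real) \<Rightarrow> ennreal" where
  "bl_norm m F = (SUP x\<in>mspace m. ennreal \<bar>F x\<bar>) +
     (SUP (x, y)\<in>{(x, y). x \<in> mspace m \<and> y \<in> mspace m \<and> x \<noteq> y}. ennreal (\<bar>F x - F y\<bar> / mdist m x y))"

definition bl_dist :: "'a metric \<Rightarrow> 'a measure \<Rightarrow> 'a measure \<Rightarrow> real" where
  "bl_dist m \<mu> \<nu> = (SUP F\<in>{F. bl_norm m F \<le> 1}. \<bar>(\<integral>x. F x \<partial>\<mu>) - (\<integral>x. F x \<partial>\<nu>)\<bar>)"

text \<open>
  Convergence to 0 in probability, via measurable covers, so that nothing needs to be known
  about the measurability of \<open>Z n\<close>.
\<close>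

definition tendsto_0_in_prob :: "(nat \<Rightarrow> 'x measure) \<Rightarrow> (nat \<Rightarrow> 'x \<Rightarrow> real) \<Rightarrow> bool" where
  "tendsto_0_in_prob P Z \<longleftrightarrow>
     (\<forall>\<epsilon>>0. \<exists>A. (\<forall>n. A n \<in> sets (P n) \<and> {x \<in> space (P n). \<bar>Z n x\<bar> > \<epsilon>} \<subseteq> A n) \<and>
        (\<lambda>n. measure (P n) (A n)) \<longlonglongrightarrow> 0)"

abbreviation C01 :: "(real \<Rightarrow> real) metric" where
  "C01 \<equiv> cfunspace (top_of_set {0..1}) euclidean_metric"

definition sup_norm01 :: "(real \<Rightarrow> real) \<Rightarrow> real" where
  "sup_norm01 g = (SUP t\<in>{0..1}. \<bar>g t\<bar>)"


section \<open>Gaussian processes\<close>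

definition normal_law :: "real \<Rightarrow> real \<Rightarrow> real measure" where
  "normal_law m v =
     (if v = 0 then return borel m else density lborel (\<lambda>x. ennreal (normal_density m (sqrt v) x)))"

definition centred_gaussian_process ::
    "'q measure \<Rightarrow> 't set \<Rightarrow> ('t \<Rightarrow> 'q \<Rightarrow> real) \<Rightarrow> ('t \<Rightarrow> 't \<Rightarrow> real) \<Rightarrow> bool" where
  "centred_gaussian_process Q T G K \<longleftrightarrow> prob_space Q \<and>
     (\<forall>t\<in>T. G t \<in> borel_measurable Q) \<and>
     (\<forall>J a. finite J \<and> J \<subseteq> T \<longrightarrow>
        distr Q borel (\<lambda>\<omega>. \<Sum>t\<in>J. a t * G t \<omega>) =
        normal_law 0 (\<Sum>s\<in>J. \<Sum>t\<in>J. a s * a t * K s t))"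

definition distr_fun :: "(real \<Rightarrow> real) \<Rightarrow> real \<Rightarrow> real" where
  "distr_fun f t = set_lebesgue_integral lborel {0..t} f"

definition brownian_motion :: "'q measure \<Rightarrow> (real \<Rightarrow> 'q \<Rightarrow> real) \<Rightarrow> bool" where
  "brownian_motion Q G \<longleftrightarrow> centred_gaussian_process Q {0..1} G (\<lambda>s t. min s t) \<and>
     (\<forall>\<omega>\<in>space Q. continuous_on {0..1} (\<lambda>t. G t \<omega>))"

definition brownian_bridge :: "(real \<Rightarrow> real) \<Rightarrow> 'q measure \<Rightarrow> (real \<Rightarrow> 'q \<Rightarrow> real) \<Rightarrow> bool" where
  "brownian_bridge f0 Q G \<longleftrightarrow>
     centred_gaussian_process Q {0..1} G (\<lambda>s t. distr_fun f0 (min s t) - distr_fun f0 s * distr_fun f0 t) \<and>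
     (\<forall>\<omega>\<in>space Q. continuous_on {0..1} (\<lambda>t. G t \<omega>))"

text \<open>The laws in \<open>M0_space J0 w\<close> of white noise and of the process \<open>G_P\<close>, as measures whose coordinate
  process has the prescribed finite-dimensional distributions.\<close>

definition white_noise_limit :: "nat \<Rightarrow> (int \<Rightarrow> real) \<Rightarrow> (int \<times> nat \<Rightarrow> real) measure \<Rightarrow> bool" where
  "white_noise_limit J0 w N \<longleftrightarrow> prob_space N \<and> sets N = sets (metric_borel (M0_space J0 w)) \<and>
     prob_space.indep_vars N (\<lambda>_. borel) (\<lambda>i x. x i) (index_set J0) \<and>
     (\<forall>i\<in>index_set J0. distributed N lborel (\<lambda>x. x i) (\<lambda>u. ennreal (std_normal_density u)))"

definition covariance :: "real measure \<Rightarrow> (real \<Rightarrow> real) \<Rightarrow> (real \<Rightarrow> real) \<Rightarrow> real" where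
  "covariance P g h = (\<integral>x. (g x - (\<integral>y. g y \<partial>P)) * (h x - (\<integral>y. h y \<partial>P)) \<partial>P)"

definition P_bridge_limit ::
    "(int \<Rightarrow> nat \<Rightarrow> real \<Rightarrow> real) \<Rightarrow> nat \<Rightarrow> (int \<Rightarrow> real) \<Rightarrow> real measure
     \<Rightarrow> (int \<times> nat \<Rightarrow> real) measure \<Rightarrow> bool" where
  "P_bridge_limit \<psi> J0 w P N \<longleftrightarrow> sets N = sets (metric_borel (M0_space J0 w)) \<and>
     centred_gaussian_process N (index_set J0) (\<lambda>i x. x i)
       (\<lambda>(l, k) (l', k'). covariance P (\<psi> l k) (\<psi> l' k'))"


section \<open>Priors and posteriors\<close>

text \<open>
  A prior lives on honest functions, with a jointly measurable evaluation map; this makes the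
  likelihoods, the wavelet coefficients and the distribution functions measurable in the parameter.
\<close>

definition prior_on_L2 :: "(real \<Rightarrow> real) measure \<Rightarrow> bool" where
  "prior_on_L2 prior \<longleftrightarrow> prob_space prior \<and> space prior \<subseteq> L2 leb01 \<and>
     (\<lambda>(f, x). f x) \<in> borel_measurable (prior \<Otimes>\<^sub>M leb01)"

text \<open>Bayes' formula; where the evidence is 0 or infinite it yields the null measure.\<close>

definition posterior ::
    "(real \<Rightarrow> real) measure \<Rightarrow> ((real \<Rightarrow> real) \<Rightarrow> real) \<Rightarrow> (real \<Rightarrow> real) measure" where
  "posterior prior lik = density prior (\<lambda>f. ennreal (lik f) / (\<integral>\<^sup>+ g. ennreal (lik g) \<partial>prior))"


subsection \<open>Gaussian white noise\<close>

definition white_noise_law ::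
    "(int \<Rightarrow> nat \<Rightarrow> real \<Rightarrow> real) \<Rightarrow> nat \<Rightarrow> (real \<Rightarrow> real) \<Rightarrow> nat \<Rightarrow> (int \<times> nat \<Rightarrow> real) measure" where
  "white_noise_law \<psi> J0 f0 n =
     distr (\<Pi>\<^sub>M i\<in>index_set J0. density lborel (\<lambda>u. ennreal (std_normal_density u)))
       (\<Pi>\<^sub>M i\<in>index_set J0. borel)
       (\<lambda>g. \<lambda>i\<in>index_set J0. wavelet_coeffs \<psi> J0 f0 i + g i / sqrt (real n))"

text \<open>
  The stochastic integral of \<open>g\<close> against the observation \<open>dX\<close>, for the observation given by its
  wavelet coefficients. For fixed \<open>g\<close> in $L^2$ the series over the levels converges almost surely.
\<close>

definition wn_integral ::
    "(int \<Rightarrow> nat \<Rightarrow> real \<Rightarrow> real) \<Rightarrow> nat \<Rightarrow> (int \<times> nat \<Rightarrow> real) \<Rightarrow> (real \<Rightarrow> real) \<Rightarrow> real" where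
  "wn_integral \<psi> J0 X g =
     (\<Sum>j. let l = int J0 - 1 + int j in \<Sum>k<level_size J0 l. wavelet_coeffs \<psi> J0 g (l, k) * X (l, k))"

text \<open>The density of the law under \<open>f\<close> with respect to the law under 0 (Cameron--Martin).\<close>

definition wn_likelihood ::
    "(int \<Rightarrow> nat \<Rightarrow> real \<Rightarrow> real) \<Rightarrow> nat \<Rightarrow> nat \<Rightarrow> (int \<times> nat \<Rightarrow> real) \<Rightarrow> (real \<Rightarrow> real) \<Rightarrow> real" where
  "wn_likelihood \<psi> J0 n X f =
     exp (real n * wn_integral \<psi> J0 X f - real n / 2 * ip leb01 f f)"

text \<open>The centring is the observation itself or an estimator with values in $L^2$.\<close>

datatype wn_centring =
  Observation
| Estimator "nat \<Rightarrow> (int \<times> nat \<Rightarrow> real) \<Rightarrow> real \<Rightarrow> real"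

fun wn_centring_ok :: "(int \<Rightarrow> nat \<Rightarrow> real \<Rightarrow> real) \<Rightarrow> nat \<Rightarrow> wn_centring \<Rightarrow> bool" where
  "wn_centring_ok \<psi> J0 Observation \<longleftrightarrow> True"
| "wn_centring_ok \<psi> J0 (Estimator T) \<longleftrightarrow>
     (\<forall>n. (\<forall>X\<in>space (\<Pi>\<^sub>M i\<in>index_set J0. (borel::real measure)). T n X \<in> L2 leb01) \<and>
          (\<forall>i\<in>index_set J0. (\<lambda>X. wavelet_coeffs \<psi> J0 (T n X) i) \<in>
              borel_measurable (\<Pi>\<^sub>M i\<in>index_set J0. borel)))"

fun wn_centring_coeffs ::
    "(int \<Rightarrow> nat \<Rightarrow> real \<Rightarrow> real) \<Rightarrow> nat \<Rightarrow> wn_centring \<Rightarrow> nat \<Rightarrow> (int \<times> nat \<Rightarrow> real) \<Rightarrow> int \<times> nat \<Rightarrow> real" where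
  "wn_centring_coeffs \<psi> J0 Observation n X = X"
| "wn_centring_coeffs \<psi> J0 (Estimator T) n X = wavelet_coeffs \<psi> J0 (T n X)"

fun wn_centring_cdf ::
    "(int \<Rightarrow> nat \<Rightarrow> real \<Rightarrow> real) \<Rightarrow> nat \<Rightarrow> wn_centring \<Rightarrow> nat \<Rightarrow> (int \<times> nat \<Rightarrow> real) \<Rightarrow> real \<Rightarrow> real" where
  "wn_centring_cdf \<psi> J0 Observation n X t = wn_integral \<psi> J0 X (indicat_real {0..t})"
| "wn_centring_cdf \<psi> J0 (Estimator T) n X t = distr_fun (T n X) t"


subsection \<open>Sampling from a density\<close>

definition probability_density :: "(real \<Rightarrow> real) \<Rightarrow> bool" where
  "probability_density f \<longleftrightarrow> f \<in> borel_measurable leb01 \<and> (AE x in leb01. 0 \<le> f x) \<and>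
     integrable leb01 f \<and> (\<integral>x. f x \<partial>leb01) = 1"

definition bounded_density :: "(real \<Rightarrow> real) \<Rightarrow> bool" where
  "bounded_density f \<longleftrightarrow> probability_density f \<and> (\<exists>C. AE x in leb01. f x \<le> C)"

definition density_measure :: "(real \<Rightarrow> real) \<Rightarrow> real measure" where
  "density_measure f = density leb01 (\<lambda>x. ennreal (f x))"

text \<open>The observations are numbered from 0.\<close>

definition sampling_law :: "(real \<Rightarrow> real) \<Rightarrow> (nat \<Rightarrow> real) measure" where
  "sampling_law f0 = (\<Pi>\<^sub>M i\<in>UNIV. density_measure f0)"

definition sampling_likelihood :: "nat \<Rightarrow> (nat \<Rightarrow> real) \<Rightarrow> (real \<Rightarrow> real) \<Rightarrow> real" where
  "sampling_likelihood n X f = (\<Prod>i<n. f (X i))"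

definition sampling_estimator ::
    "(int \<Rightarrow> nat \<Rightarrow> real \<Rightarrow> real) \<Rightarrow> nat \<Rightarrow> (nat \<Rightarrow> (nat \<Rightarrow> real) \<Rightarrow> real \<Rightarrow> real) \<Rightarrow> bool" where
  "sampling_estimator \<psi> J0 T \<longleftrightarrow>
     (\<forall>n. (\<forall>X\<in>space (\<Pi>\<^sub>M i\<in>{..<n}. leb01). T n X \<in> L2 leb01) \<and>
          (\<forall>i\<in>index_set J0. (\<lambda>X. wavelet_coeffs \<psi> J0 (T n X) i) \<in>
              borel_measurable (\<Pi>\<^sub>M i\<in>{..<n}. leb01)))"


section \<open>Bernstein--von Mises phenomena\<close>

text \<open>
  In the following definitions \<open>P n\<close> is the law of the data at stage \<open>n\<close>, \<open>post n X\<close> the posterior,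
  \<open>c n X\<close> the coefficient sequence of the centring and \<open>C n X\<close> its distribution function.
\<close>

definition weak_BvM ::
    "(int \<Rightarrow> nat \<Rightarrow> real \<Rightarrow> real) \<Rightarrow> nat \<Rightarrow> (int \<Rightarrow> real) \<Rightarrow> (nat \<Rightarrow> 'x measure)
     \<Rightarrow> (nat \<Rightarrow> 'x \<Rightarrow> (real \<Rightarrow> real) measure) \<Rightarrow> (nat \<Rightarrow> 'x \<Rightarrow> int \<times> nat \<Rightarrow> real)
     \<Rightarrow> (int \<times> nat \<Rightarrow> real) measure \<Rightarrow> bool" where
  "weak_BvM \<psi> J0 w P post c N \<longleftrightarrow> tendsto_0_in_prob P (\<lambda>n X.
     bl_dist (M0_space J0 w)
       (distr (post n X) (metric_borel (M0_space J0 w))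
          (\<lambda>f. \<lambda>i\<in>index_set J0. sqrt (real n) * (wavelet_coeffs \<psi> J0 f i - c n X i)))
       N)"

definition BvM_cdf ::
    "(nat \<Rightarrow> 'x measure) \<Rightarrow> (nat \<Rightarrow> 'x \<Rightarrow> (real \<Rightarrow> real) measure) \<Rightarrow> (nat \<Rightarrow> 'x \<Rightarrow> real \<Rightarrow> real)
     \<Rightarrow> 'q measure \<Rightarrow> (real \<Rightarrow> 'q \<Rightarrow> real) \<Rightarrow> bool" where
  "BvM_cdf P post C Q G \<longleftrightarrow> tendsto_0_in_prob P (\<lambda>n X.
     bl_dist C01
       (distr (post n X) (metric_borel C01) (\<lambda>f. \<lambda>t\<in>{0..1}. sqrt (real n) * (distr_fun f t - C n X t)))
       (distr Q (metric_borel C01) (\<lambda>\<omega>. \<lambda>t\<in>{0..1}. G t \<omega>)))"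

definition BvM_cdf_norm ::
    "(nat \<Rightarrow> 'x measure) \<Rightarrow> (nat \<Rightarrow> 'x \<Rightarrow> (real \<Rightarrow> real) measure) \<Rightarrow> (nat \<Rightarrow> 'x \<Rightarrow> real \<Rightarrow> real)
     \<Rightarrow> 'q measure \<Rightarrow> (real \<Rightarrow> 'q \<Rightarrow> real) \<Rightarrow> bool" where
  "BvM_cdf_norm P post C Q G \<longleftrightarrow> tendsto_0_in_prob P (\<lambda>n X.
     bl_dist euclidean_metric
       (distr (post n X) borel (\<lambda>f. sqrt (real n) * sup_norm01 (\<lambda>t. distr_fun f t - C n X t)))
       (distr Q borel (\<lambda>\<omega>. sup_norm01 (\<lambda>t. G t \<omega>))))"

end

theory Submission
  imports Defs
begin

text \<open>
  Integration maps a coefficient sequence \<open>x\<close> to the function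
  \<open>t \<mapsto> \<Sum>l. \<Sum>k. x (l, k) * \<integral>\<^sub>0\<^sup>t \<psi> l k\<close>. At every \<open>t\<close> the primitives of the wavelets of level \<open>l\<close> add up to at
  most a constant times \<open>2\<^sup>-\<^sup>l\<^sup>/\<^sup>2\<close>, so that the summability of \<open>w l * 2\<^sup>-\<^sup>l\<^sup>/\<^sup>2\<close> makes this a bounded linear map
  from the multiscale space to \<open>C[0,1]\<close>, under which bounded-Lipschitz distances grow at most by a constant
  factor. It takes the rescaled posterior of \<open>f\<close> to that of the distribution function \<open>F\<close> by Parseval's
  identity, and the Gaussian limit to a Gaussian process with continuous paths. The covariance of the latter is
  that of \<open>G\<close>, again by Parseval's identity, whence both have the same law on \<open>C[0,1]\<close>. The second claim
  follows because the supremum norm is a Lipschitz function on \<open>C[0,1]\<close>.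
\<close>

section \<open>Uniqueness of finite-dimensional distributions\<close>

text \<open>The multiscale norm sees only the largest coefficient of a level. Hence the primitives
  of a level must be bounded by their absolute sum at one \<open>t\<close> at a time; a separate
  bound for each of the \<open>2 ^ l\<close> primitives would not decay after summation.
  Cancellation makes the sum small, because only wavelets near \<open>t\<close> or near the origin
  keep a sizeable primitive. Both models are instead described by the variance \<open>V g\<close>
  that the limit assigns to a test function \<open>g\<close>: the squared norm, or the variance
  under the sampling density. It is continuous in mean square, and step functions are mean-square
  limits of their wavelet expansions, which turns characteristic functions of coordinates into those
  of path values. The hypothesis does not place the centring in the multiscale space for all data.
  Data for which it falls outside are caught by the total mass: the law in the hypothesis is then
  null, and its distance from a probability measure cannot be small.\<close>

lemma integrable_bounded_finite:
  fixes f :: "'a \<Rightarrow> 'b::{banach, second_countable_topology}"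
  assumes "finite_measure M" "f \<in> borel_measurable M" "\<And>x. x \<in> space M \<Longrightarrow> norm (f x) \<le> B"
  shows "integrable M f"
  using finite_measure.integrable_const_bound[OF assms(1) _ assms(2), of B] assms(3) by auto

text \<open>Dividing the measures with density \<open>h\<close> by their common total mass makes
  their images under \<open>X\<close> probability measures with equal characteristic functions, so
  Levy's theorem applies. The weight lets the other coordinates enter a one-dimensional
  argument.\<close>

lemma weighted_char_unique:
  fixes h X :: "'a \<Rightarrow> real"
  assumes fin: "finite_measure M" "finite_measure N" and sets: "sets N = sets M"
    and X: "X \<in> borel_measurable M" and h: "h \<in> borel_measurable M"
    and hb: "\<And>x. x \<in> space M \<Longrightarrow> 0 \<le> h x \<and> h x \<le> C"
    and eq: "\<And>b. (CLINT x|M. h x * iexp (b * X x)) = (CLINT x|N. h x * iexp (b * X x))"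
    and B[measurable]: "B \<in> sets borel"
  shows "(\<integral>x. h x * indicator B (X x) \<partial>M) = (\<integral>x. h x * indicator B (X x) \<partial>N)"
proof -
  have sp: "space N = space M" using sets by (rule sets_eq_imp_space_eq)
  have XN: "X \<in> borel_measurable N" and hN: "h \<in> borel_measurable N"
    using X h sets by (simp_all cong: measurable_cong_sets)
  have ih: "integrable M h" "integrable N h"
    using hb sp h hN by (auto intro!: integrable_bounded_finite[where B=C] fin)
  define c where "c = (\<integral>x. h x \<partial>M)"
  \<comment> \<open>The frequency \<open>b = 0\<close> in the hypothesis compares the total
    masses.\<close>
  have "complex_of_real c = complex_of_real (\<integral>x. h x \<partial>N)"
    using eq[of 0] by (simp add: c_def flip: integral_complex_of_real)
  then have c': "c = (\<integral>x. h x \<partial>N)" by simp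
  have c0: "c \<ge> 0" unfolding c_def using hb by (auto intro!: integral_nonneg_AE)
  show ?thesis
  proof (cases "c = 0")
    case True
    have "AE x in M. h x = 0" "AE x in N. h x = 0"
      using integral_nonneg_eq_0_iff_AE[OF ih(1)] integral_nonneg_eq_0_iff_AE[OF ih(2)] hb sp True
      by (auto simp: c_def c'[unfolded c_def])
    then have "(\<integral>x. h x * indicator B (X x) \<partial>M) = 0" "(\<integral>x. h x * indicator B (X x) \<partial>N) = 0"
      by (auto intro!: integral_eq_zero_AE)
    then show ?thesis by simp
  next
    case False
    with c0 have c: "c > 0" by simp
    define D where "D P = distr (density P (\<lambda>x. ennreal (h x / c))) borel X" for P
    have D: "real_distribution (D P)" "char (D P) b = (CLINT x|P. h x * iexp (b * X x)) / c"
        "measure (D P) B = (\<integral>x. h x * indicator B (X x) \<partial>P) / c"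
      if [measurable]: "h \<in> borel_measurable P" "X \<in> borel_measurable P" and ih: "integrable P h"
        and hb: "\<And>x. x \<in> space P \<Longrightarrow> 0 \<le> h x" and c1: "c = (\<integral>x. h x \<partial>P)" for P b
    proof -
      have "emeasure (density P (\<lambda>x. ennreal (h x / c))) (space P) = (\<integral>\<^sup>+x. ennreal (h x / c) \<partial>P)"
        by (subst emeasure_density) (auto intro!: nn_integral_cong)
      also have "\<dots> = ennreal (\<integral>x. h x / c \<partial>P)"
        using ih hb c by (intro nn_integral_eq_integral) auto
      also have "\<dots> = 1" using c c1 by simp
      finally interpret D: prob_space "density P (\<lambda>x. ennreal (h x / c))" by (intro prob_spaceI) simp
      show "real_distribution (D P)" unfolding D_def by (rule D.real_distribution_distr) simp
      have "char (D P) b = (CLINT x|P. (h x / c) *\<^sub>R iexp (b * X x))"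
        unfolding char_def D_def using hb c
        by (subst integral_distr, simp, simp, subst integral_density) auto
      also have "\<dots> = (CLINT x|P. (h x * iexp (b * X x)) / c)"
        by (simp add: scaleR_conv_of_real)
      finally show "char (D P) b = (CLINT x|P. h x * iexp (b * X x)) / c" by simp
      have "measure (D P) B = (\<integral>x. indicator B (X x) \<partial>density P (\<lambda>x. ennreal (h x / c)))"
        unfolding D_def by (subst integral_distr[of X _ borel "indicator B :: real \<Rightarrow> real", symmetric]) auto
      also have "\<dots> = (\<integral>x. (h x / c) *\<^sub>R indicator B (X x) \<partial>P)"
        using hb c by (subst integral_density) auto
      finally show "measure (D P) B = (\<integral>x. h x * indicator B (X x) \<partial>P) / c" by simp
    qed
    note DM = D[OF h X ih(1) _ c_def] and DN = D[OF hN XN ih(2) _ c']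
    have "D M = D N" using DM DN hb sp eq by (intro Levy_uniqueness) auto
    then have "(\<integral>x. h x * indicator B (X x) \<partial>M) / c = (\<integral>x. h x * indicator B (X x) \<partial>N) / c"
      using DM(3) DN(3) hb sp by metis
    then show ?thesis using c by simp
  qed
qed

text \<open>Induction on the dimension: for fixed \<open>a\<close> the weights \<open>1\<close>, \<open>1 + cos Z\<close> and \<open>1 + sin Z\<close>, with
  \<open>Z\<close> the linear combination of the remaining coordinates, turn the last coordinate into a
  one-dimensional problem for positive measures, to which Levy's theorem applies.\<close>

lemma char_unique_rectangles:
  fixes X :: "'i \<Rightarrow> 'a \<Rightarrow> real"
  assumes "finite J" "finite_measure M" "finite_measure N" "sets N = sets M"
    "\<And>j. j \<in> J \<Longrightarrow> X j \<in> borel_measurable M"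
    "\<And>a. (CLINT x|M. iexp (\<Sum>j\<in>J. a j * X j x)) = (CLINT x|N. iexp (\<Sum>j\<in>J. a j * X j x))"
    "\<And>j. j \<in> J \<Longrightarrow> B j \<in> sets borel"
  shows "measure M {x \<in> space M. \<forall>j\<in>J. X j x \<in> B j} = measure N {x \<in> space N. \<forall>j\<in>J. X j x \<in> B j}"
  using assms
proof (induction J arbitrary: M N rule: finite_induct)
  case empty
  have "complex_of_real (measure M (space M)) = complex_of_real (measure N (space N))"
    using empty(5) by simp
  then show ?case by simp
next
  case (insert j J)
  note fin = insert.prems(1,2) and sets = insert.prems(3)
  have sp: "space N = space M" using sets by (rule sets_eq_imp_space_eq)
  have B[measurable]: "B j \<in> sets borel" using insert.prems by auto
  have Xm: "X i \<in> borel_measurable P" if "sets P = sets M" "i \<in> insert j J" for P i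
    using insert.prems(4)[OF that(2)] that(1) by (simp cong: measurable_cong_sets)
  have E: "(CLINT x|M. iexp (b * X j x + (\<Sum>i\<in>J. a i * X i x))) = (CLINT x|N. iexp (b * X j x + (\<Sum>i\<in>J. a i * X i x)))" for a b
  proof -
    have "(\<Sum>i\<in>J. (a(j := b)) i * X i x) = (\<Sum>i\<in>J. a i * X i x)" for x
      using insert.hyps by (auto intro!: sum.cong)
    then show ?thesis using insert.prems(5)[of "a(j := b)"] insert.hyps by simp
  qed
  define S where "S = {x \<in> space M. X j x \<in> B j}"
  have S[measurable]: "S \<in> sets P" if "sets P = sets M" for P
    using measurable_sets[OF Xm[OF that], of j "B j"] sets_eq_imp_space_eq[OF that] B
    by (simp add: S_def vimage_def Int_def conj_commute)
  \<comment> \<open>With the last coordinate confined to \<open>B j\<close>, the induction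
    hypothesis is applied to the restricted measures; this supplies their characteristic functions
    in the remaining coordinates.\<close>
  have C: "(CLINT x|density M (indicator S). iexp (\<Sum>i\<in>J. a i * X i x)) = (CLINT x|density N (indicator S). iexp (\<Sum>i\<in>J. a i * X i x))" for a
  proof -
    define U where "U x = (\<Sum>i\<in>J. a i * X i x)" for x
    have Um: "U \<in> borel_measurable P" if "sets P = sets M" for P
      unfolding U_def[abs_def] using Xm[OF that] by (intro borel_measurable_sum borel_measurable_times) auto
    have Ep: "(CLINT x|M. iexp (b * X j x + s * U x)) = (CLINT x|N. iexp (b * X j x + s * U x))" for b s
      using E[of b "\<lambda>i. s * a i"] by (simp add: U_def sum_distrib_left mult.assoc)
    have int: "integrable P (\<lambda>x. iexp (b * X j x + s * U x))" if "finite_measure P" "sets P = sets M" for P b s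
    proof -
      have [measurable]: "U \<in> borel_measurable P" "X j \<in> borel_measurable P" using Um Xm that by auto
      show ?thesis using that by (intro integrable_bounded_finite[where B=1]) (auto simp: norm_exp_eq_Re)
    qed
    note ints = int[OF fin(1) refl] int[OF fin(2) sets]
    have ex: "iexp (b * x + s * u) = iexp (b * x) * iexp (s * u)" for b x s u :: real
      by (simp add: distrib_left exp_add)
    \<comment> \<open>The weighted transforms are combinations of unweighted ones at the frequencies
      0, 1 and -1 of \<open>u\<close>, which agree by hypothesis.\<close>
    have cosE: "complex_of_real (1 + cos u) * iexp (b * x) =
        iexp (b * x + 0 * u) + (1/2) * iexp (b * x + 1 * u) + (1/2) * iexp (b * x + (-1) * u)"
      and sinE: "complex_of_real (1 + sin u) * iexp (b * x) =
        iexp (b * x + 0 * u) + (-\<i>/2) * iexp (b * x + 1 * u) + (\<i>/2) * iexp (b * x + (-1) * u)" for u b x :: real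
      unfolding ex by (simp_all add: complex_eq_iff Re_exp Im_exp field_simps)
    have lin: "(CLINT x|M. iexp (b * X j x + 0 * U x) + p * iexp (b * X j x + 1 * U x) + q * iexp (b * X j x + (-1) * U x))
       = (CLINT x|N. iexp (b * X j x + 0 * U x) + p * iexp (b * X j x + 1 * U x) + q * iexp (b * X j x + (-1) * U x))" for p q b
      by (simp only: Bochner_Integration.integral_add Bochner_Integration.integrable_add
          Bochner_Integration.integrable_mult_right integral_mult_right_zero ints Ep)
    have W: "(\<integral>x. f x * indicator (B j) (X j x) \<partial>M) = (\<integral>x. f x * indicator (B j) (X j x) \<partial>N)"
      if "f \<in> borel_measurable M" "\<And>x. 0 \<le> f x \<and> f x \<le> 2"
        "\<And>b. (CLINT x|M. complex_of_real (f x) * iexp (b * X j x)) = (CLINT x|N. complex_of_real (f x) * iexp (b * X j x))" for f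
      using that by (intro weighted_char_unique[where C=2] fin sets Xm B) auto
    have "-1 \<le> cos u" "-1 \<le> sin u" for u :: real by simp_all
    note ge = this[THEN add_left_mono, of 1]
    have W0: "(\<integral>x. 1 * indicat_real (B j) (X j x) \<partial>M) = (\<integral>x. 1 * indicat_real (B j) (X j x) \<partial>N)"
      using Ep[of _ 0] by (intro W) auto
    have Wc: "(\<integral>x. (1 + cos (U x)) * indicator (B j) (X j x) \<partial>M) = (\<integral>x. (1 + cos (U x)) * indicator (B j) (X j x) \<partial>N)"
      using Um[OF refl] ge(1) unfolding cosE by (intro W) (auto simp only: cosE intro!: lin, auto)
    have Ws: "(\<integral>x. (1 + sin (U x)) * indicator (B j) (X j x) \<partial>M) = (\<integral>x. (1 + sin (U x)) * indicator (B j) (X j x) \<partial>N)"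
      using Um[OF refl] ge(2) by (intro W) (auto simp only: sinE intro!: lin, auto)
    have ii: "integrable P (\<lambda>x. f (U x) * indicator (B j) (X j x))"
      if "finite_measure P" "sets P = sets M" and [measurable]: "f \<in> borel_measurable borel" and f1: "\<And>x. \<bar>f x\<bar> \<le> 1"
      for P and f :: "real \<Rightarrow> real"
    proof -
      have [measurable]: "U \<in> borel_measurable P" "X j \<in> borel_measurable P" using Um Xm that by auto
      show ?thesis using that(1) f1
        by (intro integrable_bounded_finite[where B=1]) (auto simp: abs_mult split: split_indicator)
    qed
    note iis = ii[OF fin(1) refl] ii[OF fin(2) sets]
    \<comment> \<open>Subtracting the case of weight 1 leaves the real and imaginary parts of the
      restricted characteristic function.\<close>
    have c: "(\<integral>x. cos (U x) * indicator (B j) (X j x) \<partial>M) = (\<integral>x. cos (U x) * indicator (B j) (X j x) \<partial>N)"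
      and s: "(\<integral>x. sin (U x) * indicator (B j) (X j x) \<partial>M) = (\<integral>x. sin (U x) * indicator (B j) (X j x) \<partial>N)"
      using W0 Wc Ws iis[of cos] iis[of sin] iis[of "\<lambda>_. 1"] by (simp_all add: distrib_right)
    have D: "(CLINT x|density P (indicator S). iexp (U x)) =
        complex_of_real (\<integral>x. cos (U x) * indicator (B j) (X j x) \<partial>P) + \<i> * complex_of_real (\<integral>x. sin (U x) * indicator (B j) (X j x) \<partial>P)"
      if P: "finite_measure P" "sets P = sets M" for P
    proof -
      have [measurable]: "U \<in> borel_measurable P" "S \<in> sets P" using Um S P by auto
      have "(CLINT x|density P (indicator S). iexp (U x)) = (CLINT x|density P (\<lambda>x. ennreal (indicator S x)). iexp (U x))"
        by (simp add: ennreal_indicator)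
      also have "\<dots> = (CLINT x|P. indicator S x *\<^sub>R iexp (U x))"
        by (subst integral_density) auto
      also have "\<dots> = (CLINT x|P. complex_of_real (cos (U x) * indicator (B j) (X j x)) + \<i> * complex_of_real (sin (U x) * indicator (B j) (X j x)))"
        using sets_eq_imp_space_eq[OF P(2)]
        by (intro Bochner_Integration.integral_cong) (auto simp: complex_eq_iff Re_exp Im_exp S_def split: split_indicator)
      finally show ?thesis using ii[OF P, of cos] ii[OF P, of sin] by (simp del: of_real_mult)
    qed
    show ?thesis using D[OF fin(1) refl] D[OF fin(2) sets] c s by (simp add: U_def)
  qed
  have "measure (density M (indicator S)) {x \<in> space (density M (indicator S)). \<forall>i\<in>J. X i x \<in> B i}
      = measure (density N (indicator S)) {x \<in> space (density N (indicator S)). \<forall>i\<in>J. X i x \<in> B i}"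
    using insert.prems S by (intro insert.IH C finite_measure.finite_measure_restricted) auto
  moreover have "measure (density P (indicator S)) {x \<in> space (density P (indicator S)). \<forall>i\<in>J. X i x \<in> B i}
      = measure P {x \<in> space P. \<forall>i\<in>insert j J. X i x \<in> B i}" if P: "sets P = sets M" for P
  proof -
    have "{x \<in> space P. \<forall>i\<in>J. X i x \<in> B i} \<in> sets P"
    proof (rule sets.sets_Collect_finite_All[OF _ insert.hyps(1)])
      fix i assume "i \<in> J"
      then show "{x \<in> space P. X i x \<in> B i} \<in> sets P"
        using measurable_sets_Collect[OF Xm[OF P], of i "\<lambda>y. y \<in> B i"] insert.prems(6)[of i] by simp
    qed
    then have "measure (density P (indicator S)) {x \<in> space P. \<forall>i\<in>J. X i x \<in> B i} = measure P (S \<inter> {x \<in> space P. \<forall>i\<in>J. X i x \<in> B i})"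
      using S[OF P] by (simp add: measure_restricted)
    also have "S \<inter> {x \<in> space P. \<forall>i\<in>J. X i x \<in> B i} = {x \<in> space P. \<forall>i\<in>insert j J. X i x \<in> B i}"
      using sets_eq_imp_space_eq[OF P] by (auto simp: S_def)
    finally show ?thesis by simp
  qed
  ultimately show ?case using sets by simp
qed

section \<open>Borel sets and bounded-Lipschitz distances of metric spaces\<close>

lemma openin_mtopology_of_Pow: "{U. openin (mtopology_of m) U} \<subseteq> Pow (mspace m)"
  using openin_subset by fastforce

lemma space_metric_borel [simp]: "space (metric_borel m) = mspace m"
  and sets_metric_borel: "sets (metric_borel m) = sigma_sets (mspace m) {U. openin (mtopology_of m) U}"
proof -
  note openin_mtopology_of_Pow[of m]
  then show "space (metric_borel m) = mspace m" 
    "sets (metric_borel m) = sigma_sets (mspace m) {U. openin (mtopology_of m) U}"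
    unfolding metric_borel_def by (simp_all add: sets_measure_of space_measure_of)
qed

lemma metric_borel_euclidean: "metric_borel (euclidean_metric :: 'a::metric_space metric) = borel"
  unfolding metric_borel_def borel_def by (simp flip: open_openin)

lemma measurable_metric_borel_continuous:
  assumes f: "continuous_map (mtopology_of m1) (mtopology_of m2) f"
  shows "f \<in> measurable (metric_borel m1) (metric_borel m2)"
proof (rule measurable_sigma_sets[OF sets_metric_borel])
  show "f \<in> space (metric_borel m1) \<rightarrow> mspace m2"
    using f by (auto simp: continuous_map_def)
  show "{U. openin (mtopology_of m2) U} \<subseteq> Pow (mspace m2)" by (rule openin_mtopology_of_Pow)
  fix U assume "U \<in> {U. openin (mtopology_of m2) U}"
  then have "openin (mtopology_of m1) {x \<in> mspace m1. f x \<in> U}"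
    using f by (auto simp: continuous_map_def)
  moreover have "f -` U \<inter> space (metric_borel m1) = {x \<in> mspace m1. f x \<in> U}" by auto
  ultimately show "f -` U \<inter> space (metric_borel m1) \<in> sets (metric_borel m1)"
    by (simp add: sets_metric_borel sigma_sets.Basic)
qed

lemma Lipschitz_continuous_map_intro:
  assumes "\<And>x. x \<in> mspace m1 \<Longrightarrow> f x \<in> mspace m2"
    and "\<And>x y. x \<in> mspace m1 \<Longrightarrow> y \<in> mspace m1 \<Longrightarrow> mdist m2 (f x) (f y) \<le> K * mdist m1 x y"
  shows "continuous_map (mtopology_of m1) (mtopology_of m2) f"
  using assms by (intro Lipschitz_continuous_imp_continuous_map) (auto simp: Lipschitz_continuous_map_def)

text \<open>The Borel sets of such a separable space are generated by its coordinates.\<close>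

locale coordinate_metric =
  fixes m :: "'a metric" and D :: "'a set" and T :: "'t set" and X :: "'t \<Rightarrow> 'a \<Rightarrow> real"
  assumes countable_D: "countable D" and D_sub: "D \<subseteq> mspace m"
    and dense: "\<And>x e. x \<in> mspace m \<Longrightarrow> 0 < e \<Longrightarrow> \<exists>d\<in>D. mdist m d x \<le> e"
    and countable_T: "countable T"
    and ball: "\<And>d r. d \<in> D \<Longrightarrow> \<exists>B. (\<forall>t\<in>T. B t \<in> sets borel) \<and>
      {x \<in> mspace m. mdist m d x \<le> r} = {x \<in> mspace m. \<forall>t\<in>T. X t x \<in> B t}"
begin

text \<open>An open set is a countable union of closed balls with centres in \<open>D\<close> and
  rational radii, and by \<open>ball\<close> each such ball is cut out by countably many conditions
  on single coordinates.\<close>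

lemma measurable_coordinates:
  assumes g: "\<And>\<omega>. \<omega> \<in> space M \<Longrightarrow> g \<omega> \<in> mspace m"
    and X: "\<And>t. t \<in> T \<Longrightarrow> (\<lambda>\<omega>. X t (g \<omega>)) \<in> borel_measurable M"
  shows "g \<in> measurable M (metric_borel m)"
proof (rule measurable_sigma_sets[OF sets_metric_borel])
  interpret Metric_space "mspace m" "mdist m" by simp
  show "g \<in> space M \<rightarrow> mspace m" using g by auto
  show "{U. openin (mtopology_of m) U} \<subseteq> Pow (mspace m)" by (rule openin_mtopology_of_Pow)
  have cb: "{\<omega> \<in> space M. mdist m d (g \<omega>) \<le> r} \<in> sets M" if d: "d \<in> D" for d r
  proof -
    obtain B where B: "\<And>t. t \<in> T \<Longrightarrow> B t \<in> sets borel"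
      and eq: "{x \<in> mspace m. mdist m d x \<le> r} = {x \<in> mspace m. \<forall>t\<in>T. X t x \<in> B t}"
      using ball[OF d, of r] by (elim exE conjE) (rule that, auto)
    have "{\<omega> \<in> space M. \<forall>t\<in>T. X t (g \<omega>) \<in> B t} \<in> sets M"
    proof (rule sets.sets_Collect_countable_All'[OF _ countable_T])
      fix t assume "t \<in> T"
      then show "{\<omega> \<in> space M. X t (g \<omega>) \<in> B t} \<in> sets M"
        using measurable_sets_Collect[OF X, of t "\<lambda>y. y \<in> B t"] B by simp
    qed
    also have "{\<omega> \<in> space M. \<forall>t\<in>T. X t (g \<omega>) \<in> B t} = {\<omega> \<in> space M. mdist m d (g \<omega>) \<le> r}"
    proof (rule Collect_cong, rule conj_cong[OF refl])
      fix \<omega> assume "\<omega> \<in> space M"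
      then have "g \<omega> \<in> mspace m" by (rule g)
      then show "(\<forall>t\<in>T. X t (g \<omega>) \<in> B t) = (mdist m d (g \<omega>) \<le> r)"
        using eq[THEN eq_refl, THEN subsetD, of "g \<omega>"] eq[THEN equalityD2, THEN subsetD, of "g \<omega>"] by auto
    qed
    finally show ?thesis .
  qed
  fix U assume "U \<in> {U. openin (mtopology_of m) U}"
  then have U: "openin mtopology U" by (simp add: mtopology_of_def)
  define P where "P = {(d, q). d \<in> D \<and> q \<in> \<rat> \<and> {x \<in> mspace m. mdist m d x \<le> q} \<subseteq> U}"
  have "countable P"
    by (rule countable_subset[of _ "D \<times> \<rat>"]) (auto simp: P_def countable_D countable_rat)
  then have "(\<Union>(d, q)\<in>P. {\<omega> \<in> space M. mdist m d (g \<omega>) \<le> q}) \<in> sets M"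
    using cb by (intro sets.countable_UN') (auto simp: P_def)
  moreover have "g -` U \<inter> space M = (\<Union>(d, q)\<in>P. {\<omega> \<in> space M. mdist m d (g \<omega>) \<le> q})"
  proof (intro equalityI subsetI)
    fix \<omega> assume \<omega>: "\<omega> \<in> g -` U \<inter> space M"
    then obtain r where r: "r > 0" "mball (g \<omega>) r \<subseteq> U" using U by (auto simp: openin_mtopology)
    \<comment> \<open>With \<open>q < r / 2\<close>, the ball of radius \<open>q\<close> about a
      centre within \<open>q\<close> of \<open>g \<omega>\<close> stays inside the ball of radius
      \<open>r\<close> about \<open>g \<omega>\<close>.\<close>
    obtain q where q: "q \<in> \<rat>" "0 < q" "q < r / 2" using Rats_dense_in_real[of 0 "r/2"] r by auto
    obtain d where d: "d \<in> D" "mdist m d (g \<omega>) \<le> q" using dense[OF g q(2)] \<omega> by auto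
    have "{x \<in> mspace m. mdist m d x \<le> q} \<subseteq> U"
    proof
      fix x assume x: "x \<in> {x \<in> mspace m. mdist m d x \<le> q}"
      have "mdist m (g \<omega>) x \<le> mdist m d (g \<omega>) + mdist m d x"
        using triangle[of "g \<omega>" d x] commute[of d "g \<omega>"] d D_sub g \<omega> x by auto
      then have "mdist m (g \<omega>) x < r" using d x q by auto
      then show "x \<in> U" using r x g \<omega> by auto
    qed
    then show "\<omega> \<in> (\<Union>(d, q)\<in>P. {\<omega> \<in> space M. mdist m d (g \<omega>) \<le> q})"
      using d q \<omega> by (auto simp: P_def)
  qed (use g in \<open>auto simp: P_def\<close>)
  ultimately show "g -` U \<inter> space M \<in> sets M" by simp
qed

text \<open>The coordinates embed the space in a countable product, where agreement on finite
  rectangles determines a measure. Nothing is lost in passing to the product, since every Borel set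
  is a preimage from it.\<close>

lemma measure_eqI_coordinates:
  assumes \<mu>: "finite_measure \<mu>" "sets \<mu> = sets (metric_borel m)"
    and \<nu>: "finite_measure \<nu>" "sets \<nu> = sets (metric_borel m)"
    and X: "\<And>t. t \<in> T \<Longrightarrow> X t \<in> borel_measurable (metric_borel m)"
    and eq: "\<And>J B. finite J \<Longrightarrow> J \<subseteq> T \<Longrightarrow> (\<And>t. t \<in> J \<Longrightarrow> B t \<in> sets borel) \<Longrightarrow>
      measure \<mu> {x \<in> mspace m. \<forall>t\<in>J. X t x \<in> B t} = measure \<nu> {x \<in> mspace m. \<forall>t\<in>J. X t x \<in> B t}"
  shows "\<mu> = \<nu>"
proof -
  interpret \<mu>: finite_measure \<mu> by fact
  interpret \<nu>: finite_measure \<nu> by fact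
  let ?P = "Pi\<^sub>M T (\<lambda>_. borel :: real measure)"
  define e where "e x = (\<lambda>t\<in>T. X t x)" for x
  have em: "e \<in> measurable M ?P" if "sets M = sets (metric_borel m)" for M
    unfolding e_def[abs_def] using X that by (intro measurable_restrict) (simp cong: measurable_cong_sets)
  have sp: "space \<mu> = mspace m" "space \<nu> = mspace m"
    using \<mu>(2) \<nu>(2) by (auto dest: sets_eq_imp_space_eq)
  have distr_eq: "distr \<mu> ?P e = distr \<nu> ?P e"
  proof (rule measure_eqI_PiM_infinite)
    fix A J assume J: "finite J" "J \<subseteq> T" and A: "\<And>t. t \<in> J \<Longrightarrow> A t \<in> sets (borel :: real measure)"
    have S: "prod_emb T (\<lambda>_. borel) J (Pi\<^sub>E J A) \<in> sets ?P" using J A by (intro sets_PiM_I) auto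
    have "e -` prod_emb T (\<lambda>_. borel) J (Pi\<^sub>E J A) \<inter> mspace m = {x \<in> mspace m. \<forall>t\<in>J. X t x \<in> A t}"
    proof -
      have r: "restrict (e x) J = (\<lambda>t\<in>J. X t x)" "e x \<in> extensional T" for x
        using J by (auto simp: e_def fun_eq_iff)
      show ?thesis by (auto simp: prod_emb_def r PiE_iff)
    qed
    then show "emeasure (distr \<mu> ?P e) (prod_emb T (\<lambda>_. borel) J (Pi\<^sub>E J A)) = emeasure (distr \<nu> ?P e) (prod_emb T (\<lambda>_. borel) J (Pi\<^sub>E J A))"
      using eq[OF J A] by (simp add: emeasure_distr[OF em S] \<mu> \<nu> sp \<mu>.emeasure_eq_measure \<nu>.emeasure_eq_measure)
  qed (simp_all add: \<mu>.finite_measure_distr em \<mu>)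
  \<comment> \<open>Measurability of the identity from the pulled-back product algebra says exactly
    that every Borel set is a preimage under \<open>e\<close>.\<close>
  have "(\<lambda>x. x) \<in> measurable (vimage_algebra (mspace m) e ?P) (metric_borel m)"
  proof (rule measurable_coordinates)
    fix t assume t: "t \<in> T"
    have "(\<lambda>x. e x t) \<in> borel_measurable (vimage_algebra (mspace m) e ?P)"
      using t by (intro measurable_compose[OF measurable_vimage_algebra1 measurable_component_singleton])
        (auto simp: e_def space_PiM)
    then show "X t \<in> borel_measurable (vimage_algebra (mspace m) e ?P)" using t by (simp add: e_def)
  qed simp
  note idm = this
  show ?thesis
  proof (rule measure_eqI)
    fix A assume "A \<in> sets \<mu>"
    then have A: "A \<in> sets (metric_borel m)" by (simp add: \<mu>)
    have "A \<in> sets (vimage_algebra (mspace m) e ?P)"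
      using measurable_sets[OF idm A] sets.sets_into_space[OF A] by (simp add: Int_absorb2)
    then obtain A' where A': "A' \<in> sets ?P" "A = e -` A' \<inter> mspace m"
      by (subst (asm) sets_vimage_algebra2) (auto simp: e_def space_PiM)
    have "emeasure \<mu> A = emeasure (distr \<mu> ?P e) A'" using A' sp by (simp add: emeasure_distr em \<mu>)
    also have "\<dots> = emeasure \<nu> A" using A' sp by (simp add: distr_eq emeasure_distr em \<nu>)
    finally show "emeasure \<mu> A = emeasure \<nu> A" .
  qed (simp add: \<mu> \<nu>)
qed

end

section \<open>Test functions of bounded-Lipschitz norm at most 1\<close>

lemma bl_norm_leD:
  assumes F: "bl_norm m F \<le> 1" and x: "x \<in> mspace m"
  shows "\<bar>F x\<bar> \<le> 1" and "y \<in> mspace m \<Longrightarrow> \<bar>F x - F y\<bar> \<le> mdist m x y"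
proof -
  have "ennreal \<bar>F x\<bar> \<le> bl_norm m F"
    unfolding bl_norm_def using x by (intro add_increasing2) (auto intro: SUP_upper)
  also note F
  finally show "\<bar>F x\<bar> \<le> 1" by (simp add: ennreal_le_1)
  show "\<bar>F x - F y\<bar> \<le> mdist m x y" if y: "y \<in> mspace m"
  proof (cases "x = y")
    case False
    interpret Metric_space "mspace m" "mdist m" by simp
    have "ennreal (\<bar>F x - F y\<bar> / mdist m x y) \<le> bl_norm m F"
      unfolding bl_norm_def using x y False by (intro add_increasing) (auto intro!: SUP_upper2[of "(x, y)"])
    also note F
    finally have "\<bar>F x - F y\<bar> / mdist m x y \<le> 1" by (simp add: ennreal_le_1)
    moreover have "mdist m x y > 0" using x y False by simp
    ultimately show ?thesis by (simp add: divide_le_eq)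
  qed (simp add: x)
qed

lemma bl_norm_measurable:
  assumes F: "bl_norm m F \<le> 1" shows "F \<in> borel_measurable (metric_borel m)"
  unfolding metric_borel_euclidean[symmetric]
  by (intro measurable_metric_borel_continuous Lipschitz_continuous_map_intro[where K=1])
     (use bl_norm_leD[OF F] in \<open>auto simp: dist_real_def\<close>)

text \<open>Division by \<open>K\<close> absorbs the Lipschitz factor of \<open>L\<close>; as
  \<open>K\<close> is at least 1, it does not enlarge the supremum either.\<close>

lemma bl_norm_pullback:
  assumes L: "\<And>x. x \<in> mspace m1 \<Longrightarrow> L x \<in> mspace m2" and K: "1 \<le> K"
    and lip: "\<And>x y. x \<in> mspace m1 \<Longrightarrow> y \<in> mspace m1 \<Longrightarrow> mdist m2 (L x) (L y) \<le> K * mdist m1 x y"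
  shows "bl_norm m1 (\<lambda>x. F (L x) / K) \<le> bl_norm m2 F"
  unfolding bl_norm_def
proof (intro add_mono SUP_least)
  fix x assume x: "x \<in> mspace m1"
  have "\<bar>F (L x) / K\<bar> \<le> \<bar>F (L x)\<bar>" using K by (simp add: abs_divide divide_le_eq mult_ge1_I mult_le_cancel_left1)
  then show "ennreal \<bar>F (L x) / K\<bar> \<le> (SUP x\<in>mspace m2. ennreal \<bar>F x\<bar>)"
    using L[OF x] by (intro SUP_upper2[of "L x"]) (auto intro: ennreal_leI)
next
  interpret m1: Metric_space "mspace m1" "mdist m1" by simp
  interpret m2: Metric_space "mspace m2" "mdist m2" by simp
  fix p assume "p \<in> {(x, y). x \<in> mspace m1 \<and> y \<in> mspace m1 \<and> x \<noteq> y}"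
  then obtain x y where p: "p = (x, y)" "x \<in> mspace m1" "y \<in> mspace m1" "x \<noteq> y" by auto
  show "(case p of (x, y) \<Rightarrow> ennreal (\<bar>F (L x) / K - F (L y) / K\<bar> / mdist m1 x y))
      \<le> (SUP (x, y)\<in>{(x, y). x \<in> mspace m2 \<and> y \<in> mspace m2 \<and> x \<noteq> y}. ennreal (\<bar>F x - F y\<bar> / mdist m2 x y))"
  \<comment> \<open>\<open>L\<close> need not be injective: a pair with equal images does not occur
    in the supremum on the right, but its quotient on the left is 0.\<close>
  proof (cases "L x = L y")
    case False
    have d: "mdist m2 (L x) (L y) > 0" "mdist m1 x y > 0" using p L False by auto
    have "\<bar>F (L x) / K - F (L y) / K\<bar> / mdist m1 x y = \<bar>F (L x) - F (L y)\<bar> / (K * mdist m1 x y)"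
      using K by (simp add: abs_divide flip: diff_divide_distrib)
    also have "\<dots> \<le> \<bar>F (L x) - F (L y)\<bar> / mdist m2 (L x) (L y)"
      using lip[of x y] p d by (intro divide_left_mono) auto
    finally show ?thesis
      using p L False by (intro SUP_upper2[of "(L x, L y)"]) (auto intro: ennreal_leI)
  qed (simp add: p)
qed

text \<open>Mass at most 1 is assumed rather than 1, since a posterior is the null measure for
  degenerate evidence. If \<open>F\<close> is not integrable, its integral is 0 by
  convention.\<close>

lemma abs_integral_le_1:
  assumes \<mu>: "emeasure \<mu> (space \<mu>) \<le> 1" and F: "\<And>x. x \<in> space \<mu> \<Longrightarrow> \<bar>F x\<bar> \<le> (1::real)"
  shows "\<bar>\<integral>x. F x \<partial>\<mu>\<bar> \<le> 1"
proof (cases "integrable \<mu> F")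
  case True
  interpret finite_measure \<mu> using \<mu> by (intro finite_measureI) (auto simp: top_unique)
  have "\<bar>\<integral>x. F x \<partial>\<mu>\<bar> \<le> (\<integral>x. \<bar>F x\<bar> \<partial>\<mu>)" by (rule integral_abs_bound)
  also have "\<dots> \<le> (\<integral>x. 1 \<partial>\<mu>)" using True F by (intro integral_mono) auto
  also have "\<dots> \<le> 1" using \<mu> by (simp add: emeasure_eq_measure)
  finally show ?thesis .
qed (simp add: not_integrable_integral_eq)

text \<open>\<open>bl_dist\<close> is a supremum of reals and bounds its members only once the
  family is known to be bounded; the masses give the bound 2.\<close>

lemma bl_dist_upper:
  assumes \<mu>: "emeasure \<mu> (space \<mu>) \<le> 1" "space \<mu> = mspace m"
    and \<nu>: "emeasure \<nu> (space \<nu>) \<le> 1" "space \<nu> = mspace m" and F: "bl_norm m F \<le> 1"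
  shows "\<bar>(\<integral>x. F x \<partial>\<mu>) - (\<integral>x. F x \<partial>\<nu>)\<bar> \<le> bl_dist m \<mu> \<nu>"
  unfolding bl_dist_def
proof (rule cSUP_upper)
  show "F \<in> {F. bl_norm m F \<le> 1}" using F by simp
  show "bdd_above ((\<lambda>F. \<bar>(\<integral>x. F x \<partial>\<mu>) - (\<integral>x. F x \<partial>\<nu>)\<bar>) ` {F. bl_norm m F \<le> 1})"
  proof (rule bdd_aboveI2)
    fix F assume "F \<in> {F. bl_norm m F \<le> 1}"
    then have F: "\<And>x. x \<in> mspace m \<Longrightarrow> \<bar>F x\<bar> \<le> 1" using bl_norm_leD(1)[of m F] by simp
    then have "\<bar>\<integral>x. F x \<partial>\<mu>\<bar> \<le> 1" "\<bar>\<integral>x. F x \<partial>\<nu>\<bar> \<le> 1"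
      using \<mu> \<nu> by (auto intro!: abs_integral_le_1)
    then show "\<bar>(\<integral>x. F x \<partial>\<mu>) - (\<integral>x. F x \<partial>\<nu>)\<bar> \<le> 2" by linarith
  qed
qed

lemma bl_norm_zero: "bl_norm m (\<lambda>_. 0) \<le> 1"
  by (simp add: bl_norm_def case_prod_beta SUP_constant bot_ennreal)

text \<open>The constant 1 compares total masses; as a test function it tells the null measure from
  a probability measure.\<close>

lemma bl_norm_one: "bl_norm m (\<lambda>_. 1) \<le> 1"
  by (simp add: bl_norm_def case_prod_beta SUP_constant bot_ennreal)

text \<open>Each test function \<open>F\<close> on the target pulls back to the admissible test
  function \<open>F (L x) / K\<close> on the source.\<close>

lemma bl_dist_pushforward:
  assumes \<mu>: "emeasure \<mu> (space \<mu>) \<le> 1" "sets \<mu> = sets (metric_borel m1)"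
    and \<nu>: "emeasure \<nu> (space \<nu>) \<le> 1" "sets \<nu> = sets (metric_borel m1)"
    and L: "\<And>x. x \<in> mspace m1 \<Longrightarrow> L x \<in> mspace m2" and K: "1 \<le> K"
    and lip: "\<And>x y. x \<in> mspace m1 \<Longrightarrow> y \<in> mspace m1 \<Longrightarrow> mdist m2 (L x) (L y) \<le> K * mdist m1 x y"
  shows "bl_dist m2 (distr \<mu> (metric_borel m2) L) (distr \<nu> (metric_borel m2) L) \<le> K * bl_dist m1 \<mu> \<nu>"
  unfolding bl_dist_def[of m2]
proof (rule cSUP_least)
  show "{F. bl_norm m2 F \<le> 1} \<noteq> {}" using bl_norm_zero[of m2] by blast
  have sp: "space \<mu> = mspace m1" "space \<nu> = mspace m1"
    using sets_eq_imp_space_eq[OF \<mu>(2)] sets_eq_imp_space_eq[OF \<nu>(2)] by auto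
  have "L \<in> measurable (metric_borel m1) (metric_borel m2)"
    using L lip by (intro measurable_metric_borel_continuous Lipschitz_continuous_map_intro[where K=K])
  then have Lm: "L \<in> measurable \<mu> (metric_borel m2)" "L \<in> measurable \<nu> (metric_borel m2)"
    using \<mu>(2) \<nu>(2) by (auto cong: measurable_cong_sets)
  fix F assume "F \<in> {F. bl_norm m2 F \<le> 1}"
  then have F: "bl_norm m2 F \<le> 1" by simp
  note Fm = bl_norm_measurable[OF F]
  have "bl_norm m1 (\<lambda>x. F (L x) / K) \<le> 1"
    using bl_norm_pullback[where F=F, OF L K lip] F by (rule order_trans)
  then have "\<bar>(\<integral>x. F (L x) / K \<partial>\<mu>) - (\<integral>x. F (L x) / K \<partial>\<nu>)\<bar> \<le> bl_dist m1 \<mu> \<nu>"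
    by (intro bl_dist_upper \<mu> \<nu> sp)
  moreover have "\<bar>(\<integral>x. F (L x) / K \<partial>\<mu>) - (\<integral>x. F (L x) / K \<partial>\<nu>)\<bar> = \<bar>(\<integral>x. F (L x) \<partial>\<mu>) - (\<integral>x. F (L x) \<partial>\<nu>)\<bar> / K"
    using K by (simp add: abs_divide flip: diff_divide_distrib)
  ultimately have "\<bar>(\<integral>x. F (L x) \<partial>\<mu>) - (\<integral>x. F (L x) \<partial>\<nu>)\<bar> \<le> K * bl_dist m1 \<mu> \<nu>"
    using K by (simp add: divide_le_eq mult.commute)
  then show "\<bar>(\<integral>x. F x \<partial>distr \<mu> (metric_borel m2) L) - (\<integral>x. F x \<partial>distr \<nu> (metric_borel m2) L)\<bar> \<le> K * bl_dist m1 \<mu> \<nu>"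
    by (simp add: integral_distr[OF Lm(1) Fm] integral_distr[OF Lm(2) Fm])
qed

section \<open>Continuous functions and multiscale sequences\<close>

lemma mspace_C01: "mspace C01 = {f \<in> extensional {0..1}. continuous_on {0..1} f}"
  by (subst compactin_mspace_cfunspace) (auto simp flip: continuous_map_iff_continuous)

declare mspace_cfunspace [simp del]

lemma mdist_C01_le:
  assumes "f \<in> mspace C01" "g \<in> mspace C01"
  shows "mdist C01 f g \<le> a \<longleftrightarrow> (\<forall>t\<in>{0..1}. \<bar>f t - g t\<bar> \<le> a)"
  using cfunspace_mdist_le[OF assms] by (simp add: dist_real_def)

section \<open>Separability of the space of continuous functions\<close>

lemma rat_approx:
  assumes "0 < e" shows "\<exists>q\<in>\<rat>. \<bar>q - x\<bar> \<le> (e::real)"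
proof -
  obtain q where "q \<in> \<rat>" "x - e < q" "q < x + e" using Rats_dense_in_real[of "x - e" "x + e"] assms by auto
  then show ?thesis by (intro bexI[of _ q]) auto
qed

text \<open>A countable dense set by the theorem of Weierstrass in Bernstein's form. The
  coefficients are extensional on \<open>{..n}\<close>, so that for each \<open>n\<close> there are
  only countably many of them.\<close>

definition rat_Bernstein :: "(real \<Rightarrow> real) set" where
  "rat_Bernstein = (\<Union>n. (\<lambda>q. \<lambda>t\<in>{0..1}. \<Sum>k\<le>n. q k * Bernstein n k t) ` ({..n} \<rightarrow>\<^sub>E \<rat>))"

interpretation C01: coordinate_metric C01 rat_Bernstein "\<rat> \<inter> {0..1}" "\<lambda>t f. f t"
proof
  interpret Metric_space "mspace C01" "mdist C01" by (rule Metric_space_mspace_mdist)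
  show "countable rat_Bernstein"
    unfolding rat_Bernstein_def by (intro countable_UN countable_image countable_PiE) (auto simp: countable_rat)
  have DC: "continuous_on {0..1} (\<lambda>t\<in>{0..1}. \<Sum>k\<le>n. q k * Bernstein n k t)" for q :: "nat \<Rightarrow> real" and n
  proof -
    have "continuous_on {0..1} (\<lambda>t. \<Sum>k\<le>n. q k * Bernstein n k t)"
      unfolding Bernstein_def by (intro continuous_intros)
    then show ?thesis by (rule continuous_on_eq) simp
  qed
  then show D: "rat_Bernstein \<subseteq> mspace C01"
    by (auto simp: rat_Bernstein_def mspace_C01)
  show "countable (\<rat> \<inter> {0..1::real})" by (simp add: countable_rat countable_Int1)
  show "\<exists>d\<in>rat_Bernstein. mdist C01 d f \<le> e" if f: "f \<in> mspace C01" and e: "0 < e" for f e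
  proof -
    have "continuous_on {0..1} f" using f by (simp add: mspace_C01)
    then obtain n where n: "\<And>x. x \<in> {0..1} \<Longrightarrow> \<bar>f x - (\<Sum>k\<le>n. f (k/n) * Bernstein n k x)\<bar> < e / 2"
      using Bernstein_Weierstrass[of f "e/2"] e by (meson half_gt_zero order_refl)
    \<comment> \<open>Rounding every sampled value by at most \<open>e / 2\<close> moves the
      polynomial by at most \<open>e / 2\<close>, because Bernstein polynomials are nonnegative and
      add up to 1; the other half of \<open>e\<close> pays for the approximation of
      \<open>f\<close>.\<close>
    have "\<exists>q\<in>\<rat>. \<bar>q - f (k/n)\<bar> \<le> e / 2" for k :: nat
      using e by (intro rat_approx) simp
    then obtain q :: "nat \<Rightarrow> real" where q: "\<And>k. q k \<in> \<rat>" "\<And>k. \<bar>q k - f (k/n)\<bar> \<le> e / 2" by metis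
    define d where "d = (\<lambda>t\<in>{0..1}. \<Sum>k\<le>n. restrict q {..n} k * Bernstein n k t)"
    have dD: "d \<in> rat_Bernstein"
      unfolding rat_Bernstein_def d_def using q(1) by (intro UN_I[of n] imageI) (auto simp: PiE_iff extensional_def)
    have "mdist C01 d f \<le> e"
      unfolding mdist_C01_le[OF subsetD[OF D dD] f]
    proof
      fix t :: real assume t: "t \<in> {0..1}"
      have "d t - (\<Sum>k\<le>n. f (k/n) * Bernstein n k t) = (\<Sum>k\<le>n. (q k - f (k/n)) * Bernstein n k t)"
        using t by (simp add: d_def sum_subtractf left_diff_distrib)
      also have "\<bar>\<dots>\<bar> \<le> (\<Sum>k\<le>n. (e/2) * Bernstein n k t)"
      proof (rule order_trans[OF sum_abs sum_mono])
        fix k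
        have "0 \<le> Bernstein n k t" using t by (intro Bernstein_nonneg) auto
        then show "\<bar>(q k - f (k/n)) * Bernstein n k t\<bar> \<le> e/2 * Bernstein n k t"
          using mult_right_mono[OF q(2)[of k], of "Bernstein n k t"] by (simp add: abs_mult)
      qed
      also have "\<dots> = e / 2" by (simp only: sum_distrib_left[symmetric] sum_Bernstein mult_1_right)
      finally show "\<bar>d t - f t\<bar> \<le> e" using n[OF t] by linarith
    qed
    then show ?thesis using dD by blast
  qed
  show "\<exists>B. (\<forall>t\<in>\<rat> \<inter> {0..1}. B t \<in> sets borel) \<and>
      {f \<in> mspace C01. mdist C01 d f \<le> r} = {f \<in> mspace C01. \<forall>t\<in>\<rat> \<inter> {0..1}. f t \<in> B t}"
    if d: "d \<in> rat_Bernstein" for d r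
  proof (intro exI[of _ "\<lambda>t. {d t - r .. d t + r}"] conjI)
    have "(mdist C01 d f \<le> r) = (\<forall>t\<in>\<rat> \<inter> {0..1}. f t \<in> {d t - r..d t + r})" if f: "f \<in> mspace C01" for f
      unfolding mdist_C01_le[OF subsetD[OF D d] f]
    proof (intro iffI ballI)
      fix t :: real assume *: "\<forall>t\<in>{0..1}. \<bar>d t - f t\<bar> \<le> r" and t: "t \<in> \<rat> \<inter> {0..1}"
      then have "\<bar>d t - f t\<bar> \<le> r" by blast
      then show "f t \<in> {d t - r..d t + r}" by (simp add: abs_le_iff)
    next
      fix t :: real assume *: "\<forall>t\<in>\<rat> \<inter> {0..1}. f t \<in> {d t - r..d t + r}" and t: "t \<in> {0..1}"
      have c: "continuous_on {0..1} (\<lambda>t. \<bar>d t - f t\<bar>)"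
        using f D d by (intro continuous_intros) (auto simp: mspace_C01)
      \<comment> \<open>By continuity a bound at rational times extends to their closure. Density is
        obtained in the open interval, whose closure brings in the end points.\<close>
      have "closure (\<rat> \<inter> {0..1::real}) = {0..1}"
      proof
        show "closure (\<rat> \<inter> {0..1::real}) \<subseteq> {0..1}" by (intro closure_minimal) auto
        have "{0<..<1::real} \<subseteq> closure (\<rat> \<inter> {0<..<1})"
          using open_Int_closure_subset[of "{0<..<1::real}" \<rat>] by (simp add: Rats_closure_real Int_commute)
        also have "\<dots> \<subseteq> closure (\<rat> \<inter> {0..1})" by (intro closure_mono) auto
        finally have "closure {0<..<1::real} \<subseteq> closure (\<rat> \<inter> {0..1})" by (rule closure_minimal) simp
        then show "{0..1} \<subseteq> closure (\<rat> \<inter> {0..1::real})" by simp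
      qed
      note cl = this
      show "\<bar>d t - f t\<bar> \<le> r"
      proof (rule continuous_le_on_closure[of "\<rat> \<inter> {0..1}" "\<lambda>t. \<bar>d t - f t\<bar>"])
        fix s :: real assume "s \<in> \<rat> \<inter> {0..1}"
        with * have "f s \<in> {d s - r..d s + r}" by blast
        then show "\<bar>d s - f s\<bar> \<le> r" by (simp add: abs_le_iff)
      qed (use cl c t in simp_all)
    qed
    then show "{f \<in> mspace C01. mdist C01 d f \<le> r} = {f \<in> mspace C01. \<forall>t\<in>\<rat> \<inter> {0..1}. f t \<in> {d t - r..d t + r}}"
      by (intro Collect_cong conj_cong refl)
  qed auto
qed

lemma borel_measurable_C01_eval:
  assumes t: "t \<in> {0..1}" shows "(\<lambda>f. f t) \<in> borel_measurable (metric_borel C01)"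
  unfolding metric_borel_euclidean[symmetric]
proof (intro measurable_metric_borel_continuous Lipschitz_continuous_map_intro[where K=1])
  fix f g assume "f \<in> mspace C01" "g \<in> mspace C01"
  then show "mdist euclidean_metric (f t) (g t) \<le> 1 * mdist C01 f g"
    using mdist_C01_le[of f g "mdist C01 f g"] t by (simp add: dist_real_def)
qed simp

lemma C01_bounded:
  fixes f :: "real \<Rightarrow> real"
  assumes "continuous_on {0..1} f" shows "bdd_above ((\<lambda>t. \<bar>f t\<bar>) ` {0..1::real})"
proof -
  have "continuous_on {0..1} (\<lambda>t. \<bar>f t\<bar>)" using assms by (intro continuous_intros)
  then show ?thesis
    by (intro bounded_imp_bdd_above compact_imp_bounded compact_continuous_image) auto
qed

lemma sup_norm01_Lipschitz:
  assumes f: "f \<in> mspace C01" and g: "g \<in> mspace C01"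
  shows "\<bar>sup_norm01 f - sup_norm01 g\<bar> \<le> mdist C01 f g"
proof -
  have "sup_norm01 f \<le> sup_norm01 g + mdist C01 f g" if f: "f \<in> mspace C01" and g: "g \<in> mspace C01" for f g
    unfolding sup_norm01_def[of f]
  proof (rule cSUP_least)
    fix t :: real assume t: "t \<in> {0..1}"
    have "\<bar>f t\<bar> \<le> \<bar>g t\<bar> + \<bar>f t - g t\<bar>" by linarith
    also have "\<bar>g t\<bar> \<le> sup_norm01 g"
      unfolding sup_norm01_def using g t by (intro cSUP_upper C01_bounded) (auto simp: mspace_C01)
    also have "\<bar>f t - g t\<bar> \<le> mdist C01 f g" using mdist_C01_le[OF f g, of "mdist C01 f g"] t by simp
    finally show "\<bar>f t\<bar> \<le> sup_norm01 g + mdist C01 f g" by simp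
  qed simp
  from this[OF f g] this[OF g f] show ?thesis
    using Metric_space.commute[OF Metric_space_mspace_mdist, of C01 f g] by linarith
qed

lemma sup_norm01_scale:
  assumes c: "0 \<le> c" and g: "continuous_on {0..1} g"
  shows "sup_norm01 (\<lambda>t. c * g t) = c * sup_norm01 g"
proof -
  have "c * Sup ((\<lambda>t. \<bar>g t\<bar>) ` {0..1}) = (SUP s\<in>(\<lambda>t. \<bar>g t\<bar>) ` {0..1}. c * s)"
    using c by (intro continuous_at_Sup_mono C01_bounded[OF g]) (auto intro!: monoI mult_left_mono continuous_intros)
  then show ?thesis using c by (simp add: sup_norm01_def abs_mult image_image)
qed

lemma sup_norm01_cong: "(\<And>t. t \<in> {0..1} \<Longrightarrow> f t = g t) \<Longrightarrow> sup_norm01 f = sup_norm01 g"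
  unfolding sup_norm01_def by (intro SUP_cong) auto

section \<open>Finite blocks of levels\<close>

definition level_block :: "nat \<Rightarrow> nat \<Rightarrow> (int \<times> nat) set" where
  "level_block J0 m = {(l, k) \<in> index_set J0. l < int J0 - 1 + int m}"

lemma level_block_subset: "level_block J0 m \<subseteq> index_set J0"
  by (auto simp: level_block_def)

lemma level_block_Sigma:
  "level_block J0 m = (\<lambda>(j, k). (int J0 - 1 + int j, k)) ` (SIGMA j:{..<m}. {..<level_size J0 (int J0 - 1 + int j)})"
  (is "_ = ?f ` ?S")
proof (intro equalityI subsetI)
  fix i assume "i \<in> level_block J0 m"
  then obtain l k where i: "i = (l, k)" "int J0 - 1 \<le> l" "k < level_size J0 l" "l < int J0 - 1 + int m"
    by (auto simp: level_block_def index_set_def)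
  then have "i = ?f (nat (l - (int J0 - 1)), k)" "(nat (l - (int J0 - 1)), k) \<in> ?S" by auto
  then show "i \<in> ?f ` ?S" by blast
qed (auto simp: level_block_def index_set_def)

lemma finite_level_block: "finite (level_block J0 m)"
  by (simp add: level_block_Sigma)

lemma sum_level_block:
  "(\<Sum>i\<in>level_block J0 m. f i) = (\<Sum>j<m. let l = int J0 - 1 + int j in \<Sum>k<level_size J0 l. f (l, k))"
  unfolding level_block_Sigma Let_def
  by (subst sum.reindex) (auto simp: inj_on_def sum.Sigma intro!: sum.cong)

lemma level_block_exhausts:
  assumes "finite F" "F \<subseteq> index_set J0" shows "\<exists>m0. \<forall>m\<ge>m0. F \<subseteq> level_block J0 m"
proof -
  have "\<forall>i\<in>F. nat (fst i - (int J0 - 1)) < Suc (Max ((\<lambda>i. nat (fst i - (int J0 - 1))) ` F))"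
    using assms(1) by (auto simp: less_Suc_eq_le)
  then show ?thesis
    using assms(2) by (intro exI[of _ "Suc (Max ((\<lambda>i. nat (fst i - (int J0 - 1))) ` F))"])
       (force simp: level_block_def)
qed

text \<open>Unconditional sums such as Parseval's thereby become limits along blocks, which is the
  order of summation in \<open>wn_integral\<close>.\<close>

lemma filterlim_level_block: "filterlim (level_block J0) (finite_subsets_at_top (index_set J0)) sequentially"
  unfolding filterlim_finite_subsets_at_top
  using level_block_exhausts finite_level_block level_block_subset by (auto simp: eventually_sequentially)

section \<open>Balls and separability of the multiscale space\<close>

context
  fixes J0 :: nat and w :: "int \<Rightarrow> real"
  assumes w: "weight J0 w"
begin

lemma weight_ge_1: "int J0 - 1 \<le> l \<Longrightarrow> 1 \<le> w l"
  using w by (auto simp: weight_def)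

text \<open>The limit alone implies boundedness: the ratios are eventually below 1, and only
  finitely many levels precede.\<close>

lemma mspace_M0I:
  assumes x: "x \<in> extensional (index_set J0)" and lim: "((\<lambda>l. level_max J0 x l / w l) \<longlongrightarrow> 0) at_top"
  shows "x \<in> mspace (M0_space J0 w)"
proof -
  obtain l0 where l0: "\<And>l. l \<ge> l0 \<Longrightarrow> \<bar>level_max J0 x l / w l\<bar> < 1"
    using tendstoD[OF lim, of 1] by (auto simp: eventually_at_top_linorder dist_real_def)
  have "bdd_above ((\<lambda>l. level_max J0 x l / w l) ` ({int J0 - 1..l0} \<union> {l0..}))"
    unfolding image_Un
  proof (intro bdd_above_Un[THEN iffD2] conjI)
    show "bdd_above ((\<lambda>l. level_max J0 x l / w l) ` {l0..})"
    proof (rule bdd_aboveI2[where M=1])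
      fix l assume "l \<in> {l0..}"
      then show "level_max J0 x l / w l \<le> 1" using l0[of l] by (meson abs_ge_self atLeast_iff less_imp_le order_trans)
    qed
  qed (intro bdd_above_finite finite_imageI finite_atLeastAtMost_int)
  then have "bdd_above ((\<lambda>l. level_max J0 x l / w l) ` {int J0 - 1..})"
    by (rule bdd_above_mono) (rule image_mono, auto)
  then show ?thesis using x lim by (simp add: mspace_M0_space[OF w] M_carrier_def)
qed

lemma M0_small_tail:
  assumes x: "x \<in> mspace (M0_space J0 w)" and e: "e > 0"
  shows "\<exists>m. \<forall>(l, k)\<in>index_set J0 - level_block J0 m. \<bar>x (l, k)\<bar> \<le> e * w l"
proof -
  obtain l0 where l0: "\<And>l. l \<ge> l0 \<Longrightarrow> \<bar>level_max J0 x l / w l\<bar> < e"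
    using x tendstoD[of "\<lambda>l. level_max J0 x l / w l" 0 at_top e] e
    by (auto simp: mspace_M0_space[OF w] eventually_at_top_linorder dist_real_def)
  have "\<bar>x (l, k)\<bar> \<le> e * w l" if i: "(l, k) \<in> index_set J0 - level_block J0 (nat (l0 - (int J0 - 1)))" for l k
  proof -
    have l: "int J0 - 1 \<le> l" "k < level_size J0 l" "l0 \<le> l"
      using i by (auto simp: index_set_def level_block_def split: if_splits)
    have "\<bar>x (l, k)\<bar> \<le> level_max J0 x l" using l by (intro level_max_ge)
    also have "\<dots> \<le> e * w l" using l0[OF l(3)] weight_ge_1[OF l(1)] by (simp add: abs_less_iff divide_less_eq)
    finally show ?thesis .
  qed
  then show ?thesis by blast
qed

lemma M0_I:
  assumes x: "x \<in> extensional (index_set J0)"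
    and tail: "\<And>e. e > 0 \<Longrightarrow> \<exists>m. \<forall>(l, k)\<in>index_set J0 - level_block J0 m. \<bar>x (l, k)\<bar> \<le> e * w l"
  shows "x \<in> mspace (M0_space J0 w)"
proof (rule mspace_M0I[OF x], rule tendstoI)
  fix e :: real assume e: "e > 0"
  \<comment> \<open>Half of \<open>e\<close>, because the limit asks for a strict
    inequality.\<close>
  then obtain m where m: "\<And>l k. (l, k) \<in> index_set J0 - level_block J0 m \<Longrightarrow> \<bar>x (l, k)\<bar> \<le> e/2 * w l"
    using tail[of "e/2"] by auto
  have "\<bar>level_max J0 x l / w l\<bar> < e" if l: "l \<ge> int J0 - 1 + int m" for l
  proof -
    have "level_max J0 x l \<le> e/2 * w l"
      using l by (intro level_max_le m) (auto simp: index_set_def level_block_def)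
    moreover have "1 \<le> w l" using l by (intro weight_ge_1) auto
    ultimately have "level_max J0 x l / w l \<le> e/2" by (simp add: divide_le_eq)
    moreover have "0 \<le> level_max J0 x l / w l"
      using level_max_nonneg \<open>1 \<le> w l\<close> by (intro divide_nonneg_nonneg) auto
    ultimately show ?thesis using e by linarith
  qed
  then show "\<forall>\<^sub>F l in at_top. dist (level_max J0 x l / w l) 0 < e"
    unfolding eventually_at_top_linorder by (intro exI[of _ "int J0 - 1 + int m"]) (auto simp: dist_real_def)
qed

text \<open>Closed balls are boxes whose half-width grows with the weight of the level. This makes
  each coordinate Lipschitz and lets the coordinates generate the Borel sets.\<close>

lemma mdist_M0_le:
  assumes x: "x \<in> mspace (M0_space J0 w)" and y: "y \<in> mspace (M0_space J0 w)"
  shows "mdist (M0_space J0 w) x y \<le> r \<longleftrightarrow> (\<forall>(l, k)\<in>index_set J0. \<bar>x (l, k) - y (l, k)\<bar> \<le> r * w l)"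
proof -
  have "mdist (M0_space J0 w) x y \<le> r \<longleftrightarrow> (\<forall>l\<in>{int J0 - 1..}. level_max J0 (\<lambda>i. x i - y i) l / w l \<le> r)"
    unfolding mdist_M0_space[OF w x y] M_norm_def using x y
    by (intro cSUP_le_iff M_carrier_diff_bdd[OF w]) (auto simp: mspace_M0_space[OF w])
  also have "\<dots> \<longleftrightarrow> (\<forall>l\<in>{int J0 - 1..}. level_max J0 (\<lambda>i. x i - y i) l \<le> r * w l)"
    using weight_ge_1 by (intro ball_cong refl) (force simp: divide_le_eq)
  also have "\<dots> \<longleftrightarrow> (\<forall>l\<in>{int J0 - 1..}. \<forall>k<level_size J0 l. \<bar>x (l, k) - y (l, k)\<bar> \<le> r * w l)"
    using level_max_ge[of _ J0 _ "\<lambda>i. x i - y i"] level_max_le[of J0 _ "\<lambda>i. x i - y i"]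
    by (intro ball_cong refl iffI) (force intro: order_trans)+
  also have "\<dots> \<longleftrightarrow> (\<forall>(l, k)\<in>index_set J0. \<bar>x (l, k) - y (l, k)\<bar> \<le> r * w l)"
    by (auto simp: index_set_def)
  finally show ?thesis .
qed

text \<open>Finitely supported rational sequences are dense because elements of the space become
  small against the weight beyond some block; mere boundedness against the weight would not
  suffice.\<close>

definition rat_finite :: "(int \<times> nat \<Rightarrow> real) set" where
  "rat_finite = (\<Union>m. (\<lambda>q. \<lambda>i\<in>index_set J0. if i \<in> level_block J0 m then q i else 0) ` (level_block J0 m \<rightarrow>\<^sub>E \<rat>))"

lemma coordinate_metric_M0: "coordinate_metric (M0_space J0 w) rat_finite (index_set J0) (\<lambda>i x. x i)"
proof
  interpret Metric_space "mspace (M0_space J0 w)" "mdist (M0_space J0 w)" by simp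
  show "countable rat_finite"
    unfolding rat_finite_def using finite_level_block
    by (intro countable_UN countable_image countable_PiE) (auto simp: countable_rat)
  show "countable (index_set J0)" by (rule countableI_type)
  show D: "rat_finite \<subseteq> mspace (M0_space J0 w)"
  proof
    fix x assume "x \<in> rat_finite"
    then obtain m q where x: "x = (\<lambda>i\<in>index_set J0. if i \<in> level_block J0 m then q i else 0)"
      unfolding rat_finite_def by blast
    show "x \<in> mspace (M0_space J0 w)"
    proof (rule M0_I)
      fix e :: real assume "e > 0"
      then show "\<exists>m. \<forall>(l, k)\<in>index_set J0 - level_block J0 m. \<bar>x (l, k)\<bar> \<le> e * w l"
        using weight_ge_1 by (intro exI[of _ m]) (force simp: x index_set_def)
    qed (simp add: x)
  qed
  show "\<exists>d\<in>rat_finite. mdist (M0_space J0 w) d x \<le> e" if x: "x \<in> mspace (M0_space J0 w)" and e: "0 < e" for x e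
  proof -
    obtain m where m: "\<And>l k. (l, k) \<in> index_set J0 - level_block J0 m \<Longrightarrow> \<bar>x (l, k)\<bar> \<le> e * w l"
      using M0_small_tail[OF x e] by auto
    have "\<exists>q\<in>\<rat>. \<bar>q - x i\<bar> \<le> e" for i
      using e by (intro rat_approx)
    then obtain q where q: "\<And>i. q i \<in> \<rat>" "\<And>i. \<bar>q i - x i\<bar> \<le> e" by metis
    define d where "d = (\<lambda>i\<in>index_set J0. if i \<in> level_block J0 m then restrict q (level_block J0 m) i else 0)"
    have dD: "d \<in> rat_finite"
      unfolding rat_finite_def d_def using q(1) by (intro UN_I[of m] imageI) (auto simp: PiE_iff extensional_def)
    have "mdist (M0_space J0 w) d x \<le> e"
      unfolding mdist_M0_le[OF subsetD[OF D dD] x]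
    proof safe
      fix l k assume i: "(l, k) \<in> index_set J0"
      then have "e \<le> e * w l" using weight_ge_1[of l] e by (simp add: index_set_def)
      then show "\<bar>d (l, k) - x (l, k)\<bar> \<le> e * w l"
        using i m[of l k] q(2)[of "(l, k)"] by (auto simp: d_def)
    qed
    then show ?thesis using dD by blast
  qed
  show "\<exists>B. (\<forall>i\<in>index_set J0. B i \<in> sets borel) \<and>
      {x \<in> mspace (M0_space J0 w). mdist (M0_space J0 w) d x \<le> r} = {x \<in> mspace (M0_space J0 w). \<forall>i\<in>index_set J0. x i \<in> B i}"
    if d: "d \<in> rat_finite" for d r
  proof (intro exI[of _ "\<lambda>i. {d i - r * w (fst i) .. d i + r * w (fst i)}"] conjI)
    have "(mdist (M0_space J0 w) d x \<le> r) = (\<forall>i\<in>index_set J0. x i \<in> {d i - r * w (fst i) .. d i + r * w (fst i)})"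
      if x: "x \<in> mspace (M0_space J0 w)" for x
      unfolding mdist_M0_le[OF subsetD[OF D d] x] by (intro ball_cong refl) (auto simp: abs_le_iff)
    then show "{x \<in> mspace (M0_space J0 w). mdist (M0_space J0 w) d x \<le> r}
       = {x \<in> mspace (M0_space J0 w). \<forall>i\<in>index_set J0. x i \<in> {d i - r * w (fst i) .. d i + r * w (fst i)}}"
      by (intro Collect_cong conj_cong refl)
  qed auto
qed

end

section \<open>Orthonormal expansions\<close>

lemma L2_mult_integrable:
  assumes "f \<in> L2 M" "g \<in> L2 M" shows "integrable M (\<lambda>x. f x * g x)"
proof (rule Bochner_Integration.integrable_bound)
  show "integrable M (\<lambda>x. (f x)\<^sup>2 + (g x)\<^sup>2)" using assms by (auto simp: L2_def)
  show "(\<lambda>x. f x * g x) \<in> borel_measurable M" using assms by (auto simp: L2_def)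
  have "\<bar>a * b\<bar> \<le> a\<^sup>2 + b\<^sup>2" for a b :: real
    using sum_squares_bound[of "\<bar>a\<bar>" "\<bar>b\<bar>"] mult_nonneg_nonneg[of "\<bar>a\<bar>" "\<bar>b\<bar>"]
    unfolding abs_mult power2_abs by linarith
  then show "AE x in M. norm (f x * g x) \<le> norm ((f x)\<^sup>2 + (g x)\<^sup>2)" by auto
qed

lemma L2_add: assumes "f \<in> L2 M" "g \<in> L2 M" shows "(\<lambda>x. f x + g x) \<in> L2 M"
  using L2_mult_integrable[OF assms] assms by (auto simp: L2_def power2_sum mult.assoc)

lemma L2_scale: "f \<in> L2 M \<Longrightarrow> (\<lambda>x. c * f x) \<in> L2 M"
  by (auto simp: L2_def power_mult_distrib)

lemma L2_zero: "(\<lambda>x. 0) \<in> L2 M"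
  by (auto simp: L2_def)

lemma L2_sum: "(\<And>i. i \<in> J \<Longrightarrow> f i \<in> L2 M) \<Longrightarrow> (\<lambda>x. \<Sum>i\<in>J. c i * f i x) \<in> L2 M"
  by (induction J rule: infinite_finite_induct) (auto intro!: L2_zero L2_add L2_scale)

lemma L2_diff: assumes "f \<in> L2 M" "g \<in> L2 M" shows "(\<lambda>x. f x - g x) \<in> L2 M"
  using L2_add[OF assms(1) L2_scale[OF assms(2), of "-1"]] by simp

lemma ip_commute: "ip M f g = ip M g f"
  by (simp add: ip_def mult.commute)

lemma ip_add_left: "f \<in> L2 M \<Longrightarrow> g \<in> L2 M \<Longrightarrow> h \<in> L2 M \<Longrightarrow> ip M (\<lambda>x. f x + g x) h = ip M f h + ip M g h"
  by (simp add: ip_def distrib_right L2_mult_integrable)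

lemma ip_scale_left: "ip M (\<lambda>x. c * f x) h = c * ip M f h"
  by (simp add: ip_def mult.assoc)

lemma ip_diff_diff:
  assumes "f \<in> L2 M" "g \<in> L2 M"
  shows "ip M (\<lambda>x. f x - g x) (\<lambda>x. f x - g x) = ip M f f - 2 * ip M f g + ip M g g"
proof -
  have "ip M (\<lambda>x. f x - g x) (\<lambda>x. f x - g x) = (\<integral>x. (f x * f x - 2 * (f x * g x)) + g x * g x \<partial>M)"
    unfolding ip_def by (intro Bochner_Integration.integral_cong) (auto simp: algebra_simps)
  then show ?thesis using assms by (simp add: ip_def L2_mult_integrable)
qed

lemma ip_add_add:
  assumes "f \<in> L2 M" "g \<in> L2 M"
  shows "ip M (\<lambda>x. f x + g x) (\<lambda>x. f x + g x) = ip M f f + 2 * ip M f g + ip M g g"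
proof -
  have "ip M (\<lambda>x. f x + g x) (\<lambda>x. f x + g x) = (\<integral>x. (f x * f x + 2 * (f x * g x)) + g x * g x \<partial>M)"
    unfolding ip_def by (intro Bochner_Integration.integral_cong) (auto simp: algebra_simps)
  then show ?thesis using assms by (simp add: ip_def L2_mult_integrable)
qed

lemma ip_sum_left:
  "(\<And>i. i \<in> J \<Longrightarrow> f i \<in> L2 M) \<Longrightarrow> h \<in> L2 M \<Longrightarrow> ip M (\<lambda>x. \<Sum>i\<in>J. c i * f i x) h = (\<Sum>i\<in>J. c i * ip M (f i) h)"
  by (induction J rule: infinite_finite_induct)
     (auto simp: ip_add_left ip_scale_left L2_sum L2_scale, auto simp: ip_def)

lemma ip_self_nonneg: "0 \<le> ip M f f"
  by (simp add: ip_def)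

text \<open>The squared norm of \<open>f - t * g\<close> is a nonnegative quadratic polynomial in
  \<open>t\<close>. Its minimiser gives the inequality, and if \<open>g\<close> has norm 0 the
  polynomial is affine, hence constant.\<close>

lemma ip_Cauchy_Schwarz:
  assumes f: "f \<in> L2 M" and g: "g \<in> L2 M"
  shows "(ip M f g)\<^sup>2 \<le> ip M f f * ip M g g"
proof -
  have q: "0 \<le> ip M f f - 2 * t * ip M f g + t\<^sup>2 * ip M g g" for t
  proof -
    have "0 \<le> ip M (\<lambda>x. f x - t * g x) (\<lambda>x. f x - t * g x)" by (rule ip_self_nonneg)
    also have "\<dots> = ip M f f - 2 * ip M f (\<lambda>x. t * g x) + ip M (\<lambda>x. t * g x) (\<lambda>x. t * g x)"
      using f g by (intro ip_diff_diff L2_scale)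
    also have "ip M f (\<lambda>x. t * g x) = t * ip M f g" by (simp add: ip_def mult.left_commute)
    also have "ip M (\<lambda>x. t * g x) (\<lambda>x. t * g x) = t\<^sup>2 * ip M g g"
      by (simp add: ip_def power2_eq_square mult_ac flip: integral_mult_right_zero)
    also have "ip M f f - 2 * (t * ip M f g) + t\<^sup>2 * ip M g g = ip M f f - 2 * t * ip M f g + t\<^sup>2 * ip M g g" by simp
    finally show ?thesis .
  qed
  show ?thesis
  proof (cases "ip M g g = 0")
    case True
    have "ip M f g = 0"
    proof (rule ccontr)
      assume n: "ip M f g \<noteq> 0"
      \<comment> \<open>At this value of \<open>t\<close> the affine polynomial would equal
        -1.\<close>
      have "2 * ((ip M f f + 1) / (2 * ip M f g)) * ip M f g = ip M f f + 1" using n by simp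
      then show False using q[of "(ip M f f + 1) / (2 * ip M f g)"] True by simp
    qed
    then show ?thesis using True by simp
  next
    case False
    then have pos: "ip M g g > 0" using ip_self_nonneg[of M g] by linarith
    show ?thesis using q[of "ip M f g / ip M g g"] pos
      by (simp add: power2_eq_square divide_simps mult.commute split: if_splits)
  qed
qed

lemma ip_tendsto:
  assumes g: "g \<in> L2 M" and h: "\<And>m. h m \<in> L2 M"
    and lim: "(\<lambda>m. \<integral>x. (g x - h m x)\<^sup>2 \<partial>M) \<longlonglongrightarrow> 0"
  shows "(\<lambda>m. ip M (h m) (h m)) \<longlonglongrightarrow> ip M g g"
proof -
  define d where "d m x = g x - h m x" for m x
  have dL: "d m \<in> L2 M" for m unfolding d_def[abs_def] using g h by (rule L2_diff)
  have dlim: "(\<lambda>m. ip M (d m) (d m)) \<longlonglongrightarrow> 0"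
    using lim by (simp add: ip_def d_def power2_eq_square)
  have clim: "(\<lambda>m. ip M g (d m)) \<longlonglongrightarrow> 0"
  proof (rule Lim_null_comparison)
    show "(\<lambda>m. sqrt (ip M g g * ip M (d m) (d m))) \<longlonglongrightarrow> 0"
      using tendsto_real_sqrt[OF tendsto_mult[OF tendsto_const dlim]] by simp
    show "\<forall>\<^sub>F m in sequentially. norm (ip M g (d m)) \<le> sqrt (ip M g g * ip M (d m) (d m))"
      using ip_Cauchy_Schwarz[OF g dL] by (intro always_eventually allI) (auto intro: real_le_rsqrt)
  qed
  have "h m = (\<lambda>x. g x - d m x)" for m by (simp add: d_def)
  then have "ip M (h m) (h m) = ip M g g - 2 * ip M g (d m) + ip M (d m) (d m)" for m
    using ip_diff_diff[OF g dL[of m]] by simp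
  moreover have "(\<lambda>m. ip M g g - 2 * ip M g (d m) + ip M (d m) (d m)) \<longlonglongrightarrow> ip M g g - 2 * 0 + 0"
    by (intro tendsto_intros clim dlim)
  ultimately show ?thesis by simp
qed

lemma orthonormal_sum_ip:
  assumes "orthonormal M I e" "finite K" "K \<subseteq> I" "j \<in> K"
  shows "ip M (\<lambda>x. \<Sum>i\<in>K. c i * e i x) (e j) = c j"
proof -
  have "ip M (\<lambda>x. \<Sum>i\<in>K. c i * e i x) (e j) = (\<Sum>i\<in>K. c i * ip M (e i) (e j))"
    using assms by (intro ip_sum_left) (auto simp: orthonormal_def)
  also have "\<dots> = (\<Sum>i\<in>K. if i = j then c i else 0)"
    using assms by (intro sum.cong) (auto simp: orthonormal_def subset_iff)
  finally show ?thesis using assms by simp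
qed

text \<open>Completing the square separates the best approximation, attained at the Fourier
  coefficients, from the error of any other choice of \<open>c\<close>. Bessel's inequality and
  Parseval's identity both follow.\<close>

lemma orthonormal_dist_sq:
  assumes e: "orthonormal M I e" and K: "finite K" "K \<subseteq> I" and f: "f \<in> L2 M"
  shows "(\<integral>x. (f x - (\<Sum>i\<in>K. c i * e i x))\<^sup>2 \<partial>M)
    = ip M f f - (\<Sum>i\<in>K. (ip M f (e i))\<^sup>2) + (\<Sum>i\<in>K. (c i - ip M f (e i))\<^sup>2)"
proof -
  have eL: "\<And>i. i \<in> K \<Longrightarrow> e i \<in> L2 M" using e K by (auto simp: orthonormal_def)
  define p where "p x = (\<Sum>i\<in>K. c i * e i x)" for x
  have pL: "p \<in> L2 M" unfolding p_def using eL by (rule L2_sum)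
  have pf: "ip M p f = (\<Sum>i\<in>K. c i * ip M f (e i))"
    unfolding p_def using eL f by (subst ip_sum_left) (auto simp: ip_commute)
  have pp: "ip M p p = (\<Sum>i\<in>K. c i * c i)"
  proof -
    have "ip M p p = (\<Sum>i\<in>K. c i * ip M p (e i))"
      unfolding p_def[of, abs_def] using eL pL[unfolded p_def[abs_def]]
      by (subst ip_sum_left) (auto simp: ip_commute)
    also have "\<dots> = (\<Sum>i\<in>K. c i * c i)"
      unfolding p_def using orthonormal_sum_ip[OF e K] by (intro sum.cong) auto
    finally show ?thesis .
  qed
  have "(\<integral>x. (f x - p x)\<^sup>2 \<partial>M) = ip M (\<lambda>x. f x - p x) (\<lambda>x. f x - p x)"
    by (simp add: ip_def power2_eq_square)
  also have "\<dots> = ip M f f - 2 * ip M p f + ip M p p"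
    using ip_diff_diff[OF f pL] ip_commute[of M f p] by simp
  also have "\<dots> = ip M f f - (\<Sum>i\<in>K. (ip M f (e i))\<^sup>2) + (\<Sum>i\<in>K. (c i - ip M f (e i))\<^sup>2)"
    unfolding pf pp by (simp add: power2_eq_square algebra_simps sum.distrib sum_subtractf sum_distrib_left)
  finally show ?thesis by (simp add: p_def)
qed

lemma Bessel:
  assumes "orthonormal M I e" "finite K" "K \<subseteq> I" "f \<in> L2 M"
  shows "(\<Sum>i\<in>K. (ip M f (e i))\<^sup>2) \<le> ip M f f"
proof -
  have "0 \<le> (\<integral>x. (f x - (\<Sum>i\<in>K. ip M f (e i) * e i x))\<^sup>2 \<partial>M)" by simp
  then show ?thesis unfolding orthonormal_dist_sq[OF assms] by simp
qed

text \<open>A finite combination close to \<open>f\<close> can only improve when its coefficients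
  are replaced by the Fourier coefficients. Enlarging the index set increases the sum further, while
  Bessel's inequality caps it.\<close>

lemma Parseval_self:
  assumes b: "orthonormal_basis M I e" and f: "f \<in> L2 M"
  shows "((\<lambda>i. (ip M f (e i))\<^sup>2) has_sum ip M f f) I"
  unfolding has_sum_def tendsto_iff eventually_finite_subsets_at_top
proof (intro allI impI)
  fix \<epsilon> :: real assume \<epsilon>: "\<epsilon> > 0"
  have o: "orthonormal M I e" using b by (simp add: orthonormal_basis_def)
  obtain J c where J: "finite J" "J \<subseteq> I" and lt: "(\<integral>x. (f x - (\<Sum>i\<in>J. c i * e i x))\<^sup>2 \<partial>M) < \<epsilon>"
    using b f \<epsilon> unfolding orthonormal_basis_def by blast
  have J': "ip M f f - (\<Sum>i\<in>J. (ip M f (e i))\<^sup>2) < \<epsilon>"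
    using lt unfolding orthonormal_dist_sq[OF o J f] using sum_nonneg[of J "\<lambda>i. (c i - ip M f (e i))\<^sup>2"] by simp
  show "\<exists>X. finite X \<and> X \<subseteq> I \<and> (\<forall>Y. finite Y \<and> X \<subseteq> Y \<and> Y \<subseteq> I \<longrightarrow> dist (\<Sum>i\<in>Y. (ip M f (e i))\<^sup>2) (ip M f f) < \<epsilon>)"
  proof (intro exI[of _ J] conjI J allI impI)
    fix Y assume Y: "finite Y \<and> J \<subseteq> Y \<and> Y \<subseteq> I"
    have "(\<Sum>i\<in>J. (ip M f (e i))\<^sup>2) \<le> (\<Sum>i\<in>Y. (ip M f (e i))\<^sup>2)"
      using Y by (intro sum_mono2) auto
    then show "dist (\<Sum>i\<in>Y. (ip M f (e i))\<^sup>2) (ip M f f) < \<epsilon>"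
      using Bessel[OF o _ _ f, of Y] Y J' by (auto simp: dist_real_def)
  qed
qed

text \<open>Polarisation of the identity for squared norms.\<close>

lemma Parseval:
  assumes b: "orthonormal_basis M I e" and f: "f \<in> L2 M" and g: "g \<in> L2 M"
  shows "((\<lambda>i. ip M f (e i) * ip M g (e i)) has_sum ip M f g) I"
proof -
  have eL: "\<And>i. i \<in> I \<Longrightarrow> e i \<in> L2 M" using b by (auto simp: orthonormal_def orthonormal_basis_def)
  have fg: "(\<lambda>x. f x + g x) \<in> L2 M" using f g by (rule L2_add)
  have "((\<lambda>i. (1/2) * ((ip M (\<lambda>x. f x + g x) (e i))\<^sup>2 + (-1) * ((ip M f (e i))\<^sup>2 + (ip M g (e i))\<^sup>2)))
      has_sum (1/2) * (ip M (\<lambda>x. f x + g x) (\<lambda>x. f x + g x) + (-1) * (ip M f f + ip M g g))) I"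
    by (intro has_sum_cmult_right has_sum_add Parseval_self[OF b] f g fg)
  also have "(1/2) * (ip M (\<lambda>x. f x + g x) (\<lambda>x. f x + g x) + (-1) * (ip M f f + ip M g g)) = ip M f g"
    using ip_add_add[OF f g] by simp
  also have "((\<lambda>i. (1/2) * ((ip M (\<lambda>x. f x + g x) (e i))\<^sup>2 + (-1) * ((ip M f (e i))\<^sup>2 + (ip M g (e i))\<^sup>2))) has_sum ip M f g) I
     \<longleftrightarrow> ?thesis"
    using f g eL by (intro has_sum_cong) (simp add: ip_add_left power2_sum)
  finally show ?thesis .
qed

lemma L2_indicator:
  assumes "finite_measure M" "A \<in> sets M" shows "indicator A \<in> L2 M"
proof -
  have "(\<lambda>x. (indicat_real A x)\<^sup>2) = indicator A" by (auto simp: fun_eq_iff split: split_indicator)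
  then show ?thesis
    using assms by (auto simp: L2_def finite_measure.emeasure_finite less_top[symmetric] intro!: integrable_real_indicator)
qed

section \<open>Primitives of wavelets\<close>

abbreviation itg :: "real set \<Rightarrow> (real \<Rightarrow> real) \<Rightarrow> real" where
  "itg A g \<equiv> \<integral>x. indicator A x * g x \<partial>lborel"

abbreviation decay :: "real \<Rightarrow> real" where
  "decay l \<equiv> 2 powr (- (l / 2))"

abbreviation prim :: "(real \<Rightarrow> real) \<Rightarrow> real \<Rightarrow> real" where
  "prim g t \<equiv> itg {0..t} g"

text \<open>Written as an inner product, the primitive of a wavelet at \<open>t\<close> is at the
  same time the wavelet coefficient of the indicator of \<open>{0..t}\<close>.\<close>

abbreviation prim01 :: "(real \<Rightarrow> real) \<Rightarrow> real \<Rightarrow> real" where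
  "prim01 g t \<equiv> ip leb01 (indicator {0..t}) g"

lemma space_leb01 [simp]: "space leb01 = {0..1}"
  by (simp add: leb01_def)

lemma emeasure_leb01: "emeasure leb01 (space leb01) = 1"
  by (simp add: leb01_def emeasure_restrict_space)

lemma prob_space_leb01: "prob_space leb01"
  by (rule prob_spaceI) (simp only: emeasure_leb01)

lemma sets_leb01_Icc [measurable]: "t \<le> 1 \<Longrightarrow> {0..t} \<in> sets leb01"
  by (auto simp: leb01_def sets_restrict_space_iff)

lemma indicator_L2_leb01: "t \<le> 1 \<Longrightarrow> indicator {0..t} \<in> L2 leb01"
  by (intro L2_indicator prob_space.finite_measure prob_space_leb01 sets_leb01_Icc)

lemma ip_indicator:
  assumes "t \<le> 1"
  shows "prim01 g t = prim g t"
  unfolding ip_def leb01_def using assms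
  by (subst integral_restrict_space) (auto intro!: Bochner_Integration.integral_cong split: split_indicator)

lemma borel_measurable_leb01: "g \<in> borel_measurable borel \<Longrightarrow> g \<in> borel_measurable leb01"
  unfolding leb01_def by (intro measurable_restrict_space1) simp

lemma ip_indicator_AE:
  assumes t: "t \<le> 1" and f: "f \<in> borel_measurable leb01" and g: "g \<in> borel_measurable borel"
    and ae: "AE x in leb01. f x = g x"
  shows "prim01 f t = prim g t"
proof -
  have [measurable]: "f \<in> borel_measurable leb01" "g \<in> borel_measurable leb01" "{0..t} \<in> sets leb01"
    using f borel_measurable_leb01[OF g] sets_leb01_Icc[OF t] by auto
  have "prim01 f t = prim01 g t"
    unfolding ip_def using ae by (intro integral_cong_AE) auto
  then show ?thesis using ip_indicator[OF t] by simp
qed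

section \<open>Sums of primitives of translates and dilates on the line\<close>

lemma card_int_interval: "u \<le> v + 1 \<Longrightarrow> real (card {j::int. u \<le> of_int j \<and> of_int j \<le> v}) \<le> v - u + 1"
proof -
  assume uv: "u \<le> v + 1"
  have "{j::int. u \<le> of_int j \<and> of_int j \<le> v} = {\<lceil>u\<rceil>..\<lfloor>v\<rfloor>}" by (auto simp: ceiling_le_iff le_floor_iff)
  then have "real (card {j::int. u \<le> of_int j \<and> of_int j \<le> v}) = of_int (max 0 (\<lfloor>v\<rfloor> - \<lceil>u\<rceil> + 1))"
    by simp
  also have "\<dots> \<le> v - u + 1" using uv by (simp add: max_def) linarith
  finally show ?thesis .
qed

definition weighted_integral :: "(real \<Rightarrow> real) \<Rightarrow> real" where
  "weighted_integral g = (\<integral>x. (2 * \<bar>x\<bar> + 1) * \<bar>g x\<bar> \<partial>lborel)"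

text \<open>As \<open>g\<close> has mean zero, its integral over either half line ending at \<open>y\<close> is at most the
  integral of \<open>\<bar>g\<bar>\<close> over \<open>{x. \<bar>y\<bar> \<le> \<bar>x\<bar>}\<close>, and a given \<open>x\<close> is counted for at most \<open>2 * \<bar>x\<bar> + 1\<close> of the
  end points \<open>j + c\<close>.\<close>

lemma sum_integral_translates_le:
  assumes g: "integrable lborel (\<lambda>x. (2 * \<bar>x\<bar> + 1) * g x)" and gm[measurable]: "g \<in> borel_measurable borel"
    and mean: "(\<integral>x. g x \<partial>lborel) = 0" and F: "finite F" and s: "0 \<le> s"
  shows "(\<Sum>j\<in>F. \<bar>itg {of_int j..of_int j + s} g\<bar>) \<le> 2 * weighted_integral g"
proof -
  have wi: "integrable lborel (\<lambda>x. (2 * \<bar>x\<bar> + 1) * \<bar>g x\<bar>)"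
    using integrable_abs[OF g] by (simp add: abs_mult)
  have gi: "integrable lborel g"
    by (rule Bochner_Integration.integrable_bound[OF wi]) (auto simp: abs_mult mult_le_cancel_right1)
  have gI: "integrable lborel (\<lambda>x. indicator A x * f x)" if "integrable lborel f" "A \<in> sets borel" for A and f :: "real \<Rightarrow> real"
    using integrable_mult_indicator[of A lborel f] that by simp
  define h where "h y = (\<integral>x. indicator {x. \<bar>y\<bar> \<le> \<bar>x\<bar>} x * \<bar>g x\<bar> \<partial>lborel)" for y :: real
  have ag: "integrable lborel (\<lambda>x. \<bar>g x\<bar>)" using gi by simp
  have sub: "\<bar>itg A g\<bar> \<le> h y"
    if A: "A \<in> sets borel" "\<And>x. x \<in> A \<Longrightarrow> \<bar>y\<bar> \<le> \<bar>x\<bar>" for A y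
  proof -
    have "\<bar>itg A g\<bar> \<le> (\<integral>x. \<bar>indicator A x * g x\<bar> \<partial>lborel)" by (rule integral_abs_bound)
    also have "\<dots> \<le> h y" unfolding h_def
    proof (rule integral_mono)
      show "integrable lborel (\<lambda>x. \<bar>indicator A x * g x\<bar>)" using gI[OF gi A(1)] by (rule integrable_abs)
      show "integrable lborel (\<lambda>x. indicator {x. \<bar>y\<bar> \<le> \<bar>x\<bar>} x * \<bar>g x\<bar>)" by (intro gI ag) measurable
      show "\<bar>indicator A x * g x\<bar> \<le> indicator {x. \<bar>y\<bar> \<le> \<bar>x\<bar>} x * \<bar>g x\<bar>" for x
        using A(2)[of x] by (auto simp: abs_mult split: split_indicator)
    qed
    finally show ?thesis .
  qed
  have compl: "\<bar>itg A g\<bar> = \<bar>itg (- A) g\<bar>" if A: "A \<in> sets borel" for A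
  proof -
    have "(itg A g) + (itg (- A) g)
        = (\<integral>x. indicator A x * g x + indicator (- A) x * g x \<partial>lborel)"
      using gI[OF gi] A by (intro Bochner_Integration.integral_add[symmetric]) auto
    also have "\<dots> = (\<integral>x. g x \<partial>lborel)"
      by (intro Bochner_Integration.integral_cong) (auto split: split_indicator)
    finally show ?thesis using mean by linarith
  qed
  \<comment> \<open>Of the half line and its complement, the one that avoids the origin lies in
    \<open>{x. \<bar>y\<bar> \<le> \<bar>x\<bar>}\<close>; by the vanishing mean both give the same
    absolute integral.\<close>
  have le: "\<bar>itg {..y} g\<bar> \<le> h y" for y
  proof (cases "y < 0")
    case True then show ?thesis by (intro sub) auto
  next
    case False then show ?thesis by (subst compl) (auto intro!: sub)
  qed
  have less: "\<bar>itg {..<y} g\<bar> \<le> h y" for y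
  proof (cases "y \<le> 0")
    case True then show ?thesis by (intro sub) auto
  next
    case False then show ?thesis by (subst compl) (auto intro!: sub)
  qed
  \<comment> \<open>An interval is a difference of two half lines; its two end points account for
    the factor 2 in the final bound.\<close>
  have Icc: "\<bar>itg {a..b} g\<bar> \<le> h a + h b" if "a \<le> b" for a b
  proof -
    have "(itg {a..b} g) = (\<integral>x. indicator {..b} x * g x - indicator {..<a} x * g x \<partial>lborel)"
      using that by (intro Bochner_Integration.integral_cong) (auto split: split_indicator)
    also have "\<dots> = (itg {..b} g) - (itg {..<a} g)"
      using gI[OF gi] by (intro Bochner_Integration.integral_diff) auto
    finally show ?thesis using le[of b] less[of a] by linarith
  qed
  have hsum: "(\<Sum>j\<in>F. h (of_int j + c)) \<le> weighted_integral g" for c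
  proof -
    have "(\<Sum>j\<in>F. h (of_int j + c)) = (\<integral>x. (\<Sum>j\<in>F. indicator {x. \<bar>of_int j + c\<bar> \<le> \<bar>x\<bar>} x * \<bar>g x\<bar>) \<partial>lborel)"
      unfolding h_def by (intro Bochner_Integration.integral_sum[symmetric] gI ag) measurable
    also have "\<dots> \<le> weighted_integral g" unfolding weighted_integral_def
    proof (rule integral_mono[OF _ wi])
      show "integrable lborel (\<lambda>x. \<Sum>j\<in>F. indicator {x. \<bar>of_int j + c\<bar> \<le> \<bar>x\<bar>} x * \<bar>g x\<bar>)"
        by (intro Bochner_Integration.integrable_sum gI ag) measurable
      fix x :: real
      have "(\<Sum>j\<in>F. indicator {x. \<bar>of_int j + c\<bar> \<le> \<bar>x\<bar>} x :: real) = card {j \<in> F. \<bar>of_int j + c\<bar> \<le> \<bar>x\<bar>}"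
        using F by (simp add: indicator_def sum.If_cases Int_def)
      also have "\<dots> \<le> card {j::int. - \<bar>x\<bar> - c \<le> of_int j \<and> of_int j \<le> \<bar>x\<bar> - c}"
      proof (rule of_nat_mono, rule card_mono)
        have "{j::int. - \<bar>x\<bar> - c \<le> of_int j \<and> of_int j \<le> \<bar>x\<bar> - c} = {\<lceil>- \<bar>x\<bar> - c\<rceil>..\<lfloor>\<bar>x\<bar> - c\<rfloor>}"
          by (auto simp: ceiling_le_iff le_floor_iff)
        then show "finite {j::int. - \<bar>x\<bar> - c \<le> of_int j \<and> of_int j \<le> \<bar>x\<bar> - c}" by simp
      qed (auto simp: abs_le_iff)
      also have "\<dots> \<le> 2 * \<bar>x\<bar> + 1"
        using card_int_interval[of "- \<bar>x\<bar> - c" "\<bar>x\<bar> - c"] by simp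
      finally show "(\<Sum>j\<in>F. indicator {x. \<bar>of_int j + c\<bar> \<le> \<bar>x\<bar>} x * \<bar>g x\<bar>) \<le> (2 * \<bar>x\<bar> + 1) * \<bar>g x\<bar>"
        by (simp only: sum_distrib_right[symmetric]) (intro mult_right_mono, auto)
    qed
    finally show ?thesis .
  qed
  have "(\<Sum>j\<in>F. \<bar>itg {of_int j..of_int j + s} g\<bar>) \<le> (\<Sum>j\<in>F. h (of_int j + 0) + h (of_int j + s))"
    using s by (intro sum_mono order_trans[OF Icc]) auto
  also have "\<dots> \<le> 2 * weighted_integral g" using hsum[of 0] hsum[of s] by (simp add: sum.distrib)
  finally show ?thesis .
qed

lemma powr_half_div: "2 powr (real l / 2) / 2 ^ l = decay l"
  by (simp add: powr_minus divide_simps flip: powr_realpow powr_add)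

text \<open>In the substitution, the amplitude \<open>2 powr (l / 2)\<close> meets the Jacobian
  \<open>2 powr (- l)\<close>. What remains are intervals of one fixed length with integer left end
  points, as in the bound for translates.\<close>

lemma integral_dilate:
  "prim (dilate g l k) t
    = decay l * (itg {of_int (- k)..of_int (- k) + 2 ^ l * t} g)"
proof -
  have p: "\<not> (2::real) ^ l \<le> 0" by (simp add: not_le)
  have "(itg {of_int (- k)..of_int (- k) + 2 ^ l * t} g)
      = 2 ^ l * (\<integral>x. indicator {of_int (- k)..of_int (- k) + 2 ^ l * t} (of_int (- k) + 2 ^ l * x) * g (of_int (- k) + 2 ^ l * x) \<partial>lborel)"
    by (subst lborel_integral_real_affine[of "2 ^ l" _ "of_int (- k)"]) auto
  also have "(\<lambda>x. indicator {of_int (- k)..of_int (- k) + 2 ^ l * t} (of_int (- k) + 2 ^ l * x) * g (of_int (- k) + 2 ^ l * x))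
      = (\<lambda>x. indicator {0..t} x * g (2 ^ l * x - of_int k))"
    using p by (auto simp: fun_eq_iff zero_le_mult_iff split: split_indicator)
  finally have "decay l * (itg {of_int (- k)..of_int (- k) + 2 ^ l * t} g)
      = 2 powr (real l / 2) * (\<integral>x. indicator {0..t} x * g (2 ^ l * x - of_int k) \<partial>lborel)"
    by (simp flip: powr_half_div)
  also have "\<dots> = prim (dilate g l k) t"
    by (simp add: dilate_def algebra_simps flip: integral_mult_right_zero)
  finally show ?thesis by simp
qed

lemma dilate_shift: "dilate g l k (x + of_int m) = dilate g l (k - 2 ^ l * m) x"
  by (simp add: dilate_def algebra_simps)

text \<open>These are the properties of a mother wavelet on which the estimate on the line rests.
  The Haar function shares them although it is discontinuous and so falls outside
  \<open>regular_decaying\<close>.\<close>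

definition weighted_mean_zero :: "(real \<Rightarrow> real) \<Rightarrow> bool" where
  "weighted_mean_zero g \<longleftrightarrow> g \<in> borel_measurable borel \<and> integrable lborel (\<lambda>x. (2 * \<bar>x\<bar> + 1) * g x) \<and>
     (\<integral>x. g x \<partial>lborel) = 0"

lemma sum_integral_dilate_le:
  assumes g: "weighted_mean_zero g" and F: "finite F" and t: "0 \<le> t"
  shows "(\<Sum>k\<in>F. \<bar>prim (dilate g l k) t\<bar>) \<le> 2 * weighted_integral g * decay l"
proof -
  have "(\<Sum>k\<in>F. \<bar>itg {of_int (- k)..of_int (- k) + 2 ^ l * t} g\<bar>)
      = (\<Sum>j\<in>uminus ` F. \<bar>itg {of_int j..of_int j + 2 ^ l * t} g\<bar>)"
    by (subst sum.reindex) auto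
  also have "\<dots> \<le> 2 * weighted_integral g"
    using g F t by (intro sum_integral_translates_le) (auto simp: weighted_mean_zero_def)
  finally have "decay l * (\<Sum>k\<in>F. \<bar>itg {of_int (- k)..of_int (- k) + 2 ^ l * t} g\<bar>)
      \<le> decay l * (2 * weighted_integral g)"
    by (intro mult_left_mono) auto
  moreover have "(\<Sum>k\<in>F. \<bar>prim (dilate g l k) t\<bar>)
      = decay l * (\<Sum>k\<in>F. \<bar>itg {of_int (- k)..of_int (- k) + 2 ^ l * t} g\<bar>)"
    unfolding integral_dilate sum_distrib_left by (simp add: abs_mult)
  ultimately show ?thesis by (simp add: mult.commute)
qed

lemma integral_affine_le:
  fixes g :: "real \<Rightarrow> real" and b c :: real
  assumes g: "integrable lborel g" and c: "c \<noteq> 0"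
  shows "\<bar>\<integral>x. indicator A x * g (b + c * x) \<partial>lborel\<bar> \<le> (\<integral>x. \<bar>g x\<bar> \<partial>lborel) / \<bar>c\<bar>"
proof -
  have i: "integrable lborel (\<lambda>x. \<bar>g (b + c * x)\<bar>)"
    using lborel_integrable_real_affine[OF g c] by (rule integrable_abs)
  have "\<bar>\<integral>x. indicator A x * g (b + c * x) \<partial>lborel\<bar> \<le> (\<integral>x. \<bar>indicator A x * g (b + c * x)\<bar> \<partial>lborel)"
    by (rule integral_abs_bound)
  also have "\<dots> \<le> (\<integral>x. \<bar>g (b + c * x)\<bar> \<partial>lborel)"
    using i by (intro integral_mono') (auto split: split_indicator)
  also have "\<dots> = (\<integral>x. \<bar>g x\<bar> \<partial>lborel) / \<bar>c\<bar>"
    using c by (subst lborel_integral_real_affine[OF c, of "\<lambda>x. \<bar>g x\<bar>" b]) simp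
  finally show ?thesis .
qed

lemma regular_decaying_measurable_weighted:
  assumes r: "regular_decaying S g" and m[measurable]: "g \<in> borel_measurable borel"
  shows "integrable lborel (\<lambda>x. (2 * \<bar>x\<bar> + 1) * g x)"
proof -
  \<comment> \<open>Of the three orders of decay, one pays for the linear weight and two leave an
    integrable majorant.\<close>
  obtain C where C: "\<And>x. (1 + \<bar>x\<bar>) ^ 3 * \<bar>g x\<bar> \<le> C"
    using r unfolding regular_decaying_def Let_def by (metis funpow_0 le0)
  have "integrable lborel (\<lambda>x. 2 * C * inverse (1 + x\<^sup>2))"
    using integrable_inverse_1_plus_square by (simp add: set_integrable_def einterval_eq)
  then show ?thesis
  proof (rule Bochner_Integration.integrable_bound)
    show "AE x in lborel. norm ((2 * \<bar>x\<bar> + 1) * g x) \<le> norm (2 * C * inverse (1 + x\<^sup>2))"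
    proof (rule AE_I2)
      fix x :: real
      have "(2 * \<bar>x\<bar> + 1) * \<bar>g x\<bar> * (1 + x\<^sup>2) = ((2 * \<bar>x\<bar> + 1) * (1 + x\<^sup>2)) * \<bar>g x\<bar>" by simp
      also have "\<dots> \<le> (2 * (1 + \<bar>x\<bar>) ^ 3) * \<bar>g x\<bar>"
      proof (rule mult_right_mono)
        have "2 * (1 + \<bar>x\<bar>) ^ 3 - (2 * \<bar>x\<bar> + 1) * (1 + x\<^sup>2) = 1 + 4 * \<bar>x\<bar> + 5 * \<bar>x\<bar>\<^sup>2"
          by (simp add: power3_eq_cube power2_eq_square algebra_simps) (simp add: abs_mult_self_eq flip: mult.assoc)?
        then show "(2 * \<bar>x\<bar> + 1) * (1 + x\<^sup>2) \<le> 2 * (1 + \<bar>x\<bar>) ^ 3" by (smt (verit) abs_ge_zero zero_le_power2)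
      qed simp
      also have "\<dots> \<le> 2 * C" using C[of x] by simp
      finally have "(2 * \<bar>x\<bar> + 1) * \<bar>g x\<bar> \<le> 2 * C / (1 + x\<^sup>2)"
        by (simp add: pos_le_divide_eq add_pos_nonneg)
      moreover have "0 \<le> C" using C[of 0] by (smt (verit) abs_ge_zero mult_nonneg_nonneg zero_le_power)
      ultimately show "norm ((2 * \<bar>x\<bar> + 1) * g x) \<le> norm (2 * C * inverse (1 + x\<^sup>2))"
        by (simp add: abs_mult divide_inverse)
    qed
  qed simp
qed

lemma regular_wavelet_pair_measurable:
  assumes "regular_wavelet_pair S \<phi> \<eta>"
  shows "\<phi> \<in> borel_measurable borel" "\<eta> \<in> borel_measurable borel"
proof -
  have "line_wavelet \<phi> \<eta> i \<in> borel_measurable borel" for i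
    using assms by (cases i) (auto simp: regular_wavelet_pair_def orthonormal_basis_def orthonormal_def L2_def)
  from this[of "(0, 0)"] this[of "(1, 0)"]
  show "\<phi> \<in> borel_measurable borel" "\<eta> \<in> borel_measurable borel"
    by (simp_all add: line_wavelet_def dilate_def[abs_def])
qed

text \<open>For positive \<open>S\<close>, the moment of order 0 is among the vanishing
  ones.\<close>

lemma regular_wavelet_pair_weighted:
  assumes p: "regular_wavelet_pair S \<phi> \<eta>" and S: "0 < S"
  shows "weighted_mean_zero \<eta>"
proof -
  have "(\<integral>x. x ^ 0 * \<eta> x \<partial>lborel) = 0"
    using p S unfolding regular_wavelet_pair_def by (metis of_nat_0)
  then show ?thesis
    using p regular_wavelet_pair_measurable[OF p]
    by (auto simp: weighted_mean_zero_def regular_wavelet_pair_def intro: regular_decaying_measurable_weighted)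
qed

lemma regular_wavelet_pair_integrable:
  assumes p: "regular_wavelet_pair S \<phi> \<eta>"
  shows "integrable lborel \<phi>"
proof (rule Bochner_Integration.integrable_bound)
  show "integrable lborel (\<lambda>x. (2 * \<bar>x\<bar> + 1) * \<phi> x)"
    using p regular_wavelet_pair_measurable[OF p]
    by (auto simp: regular_wavelet_pair_def intro: regular_decaying_measurable_weighted)
  show "\<phi> \<in> borel_measurable lborel" using regular_wavelet_pair_measurable[OF p] by simp
  show "AE x in lborel. norm (\<phi> x) \<le> norm ((2 * \<bar>x\<bar> + 1) * \<phi> x)"
    by (auto simp: abs_mult mult_le_cancel_right1)
qed

section \<open>Haar wavelets\<close>

lemma haar_mother_weighted: "weighted_mean_zero haar_mother"
proof -
  have ico: "integrable lborel (indicat_real {a..<b})" for a b :: real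
    by (intro integrable_real_indicator; cases "a \<le> b") auto
  have hm: "haar_mother = (\<lambda>x. indicator {0..<1/2} x - indicator {1/2..<1} x)"
    by (auto simp: haar_mother_def fun_eq_iff split: split_indicator)
  have m[measurable]: "haar_mother \<in> borel_measurable borel" unfolding hm by measurable
  have "integrable lborel (\<lambda>x. 3 * indicat_real {0..1::real} x)"
    by (intro integrable_mult_right integrable_real_indicator) auto
  then have "integrable lborel (\<lambda>x. (2 * \<bar>x\<bar> + 1) * haar_mother x)"
    by (rule Bochner_Integration.integrable_bound) (auto simp: haar_mother_def split: split_indicator)
  moreover have "(\<integral>x. haar_mother x \<partial>lborel) = 0"
    unfolding hm by (subst Bochner_Integration.integral_diff) (auto intro!: ico)
  ultimately show ?thesis by (simp add: weighted_mean_zero_def)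
qed

lemma sum_nat_as_int: "(\<Sum>k<(n::nat). f (int k)) = (\<Sum>k\<in>int ` {..<n}. f k)"
  by (subst sum.reindex) auto

lemma haar_level_bound:
  assumes t: "t \<in> {0..1}" and l: "0 \<le> l"
    and m: "\<And>k. k < 2 ^ nat l \<Longrightarrow> \<psi> k \<in> borel_measurable leb01"
    and ae: "\<And>k. k < 2 ^ nat l \<Longrightarrow> AE x in leb01. \<psi> k x = haar l k x"
  shows "(\<Sum>k<2 ^ nat l. \<bar>prim01 (\<psi> k) t\<bar>)
    \<le> 2 * weighted_integral haar_mother * decay l"
proof -
  have [measurable]: "haar_mother \<in> borel_measurable borel"
    using haar_mother_weighted by (simp add: weighted_mean_zero_def)
  have "prim01 (\<psi> k) t = (prim (dilate haar_mother (nat l) (int k)) t)"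
    if "k < 2 ^ nat l" for k
    using t l ae[OF that] m[OF that] by (intro ip_indicator_AE) (auto simp: haar_def dilate_def[abs_def])
  then have "(\<Sum>k<2 ^ nat l. \<bar>prim01 (\<psi> k) t\<bar>)
      = (\<Sum>k<2 ^ nat l. \<bar>prim (dilate haar_mother (nat l) (int k)) t\<bar>)"
    by (intro sum.cong) auto
  also have "\<dots> \<le> 2 * weighted_integral haar_mother * decay (nat l)"
    unfolding sum_nat_as_int[of "\<lambda>k. \<bar>prim (dilate haar_mother (nat l) k) t\<bar>"]
    using t by (intro sum_integral_dilate_le haar_mother_weighted) auto
  finally show ?thesis using l by simp
qed

section \<open>Periodised wavelets\<close>

lemma summable_on_int_inverse_square: "(\<lambda>m::int. 1 / (1 + \<bar>of_int m\<bar>)\<^sup>2 :: real) summable_on UNIV"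
proof -
  have s: "(\<lambda>n::nat. 1 / (1 + real n)\<^sup>2) summable_on UNIV"
    using inverse_power_summable[of 2, where 'a=real]
    by (subst summable_on_UNIV_nonneg_real_iff)
       (auto simp: inverse_eq_divide summable_Suc_iff[of "\<lambda>n. 1 / (real n)\<^sup>2", symmetric] add.commute)
  have "(\<lambda>m::int. 1 / (1 + \<bar>of_int m\<bar>)\<^sup>2 :: real) summable_on (range int \<union> range (\<lambda>n. - int n))"
    using s by (intro summable_on_union) (auto simp: summable_on_reindex inj_on_def o_def)
  also have "range int \<union> range (\<lambda>n. - int n) = UNIV"
    by (auto, metis int_cases2 rangeI)
  finally show ?thesis .
qed

lemma filterlim_int_intervals: "filterlim (\<lambda>n. {- int n..int n}) (finite_subsets_at_top UNIV) sequentially"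
  unfolding filterlim_finite_subsets_at_top
proof (intro allI impI)
  fix X :: "int set" assume X: "finite X \<and> X \<subseteq> UNIV"
  define b where "b = Max (insert 0 ((\<lambda>x. nat \<bar>x\<bar>) ` X))"
  have b: "nat \<bar>x\<bar> \<le> b" if "x \<in> X" for x unfolding b_def using X that by (intro Max_ge) auto
  have "X \<subseteq> {- int n..int n}" if "b \<le> n" for n
  proof
    fix x assume "x \<in> X"
    then have "nat \<bar>x\<bar> \<le> n" using b that by force
    then show "x \<in> {- int n..int n}" by auto
  qed
  then show "\<forall>\<^sub>F n in sequentially. finite {- int n..int n} \<and> X \<subseteq> {- int n..int n} \<and> {- int n..int n} \<subseteq> UNIV"
    unfolding eventually_sequentially by (intro exI[of _ b]) auto
qed

text \<open>The sums over \<open>k < 2 ^ l\<close> and over the periods \<open>m\<close> together run once over the integers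
  \<open>k - 2 ^ l * m\<close>, so that the bound on the line applies.\<close>

lemma periodised_level_bound:
  assumes g: "weighted_mean_zero \<eta>" and r: "regular_decaying S \<eta>" and t: "t \<in> {0..1}" and l: "0 \<le> l"
    and m: "\<And>k. k < 2 ^ nat l \<Longrightarrow> \<psi> k \<in> borel_measurable leb01"
    and ae: "\<And>k. k < 2 ^ nat l \<Longrightarrow> AE x in leb01. \<psi> k x = periodised \<phi> \<eta> l k x"
  shows "(\<Sum>k<2 ^ nat l. \<bar>prim01 (\<psi> k) t\<bar>)
    \<le> 2 * weighted_integral \<eta> * decay l"
proof -
  define L where "L = nat l"
  have [measurable]: "\<eta> \<in> borel_measurable borel" using g by (simp add: weighted_mean_zero_def)
  have dm[measurable]: "(\<lambda>x. dilate \<eta> L k (x + of_int j)) \<in> borel_measurable leb01" for k j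
    by (rule borel_measurable_leb01) (simp add: dilate_def)
  have tm[measurable]: "indicat_real {0..t} \<in> borel_measurable leb01"
    using sets_leb01_Icc[of t] t by simp
  interpret leb01: prob_space leb01 by (rule prob_space_leb01)
  obtain C where C: "\<And>x. (1 + \<bar>x\<bar>) ^ 2 * \<bar>\<eta> x\<bar> \<le> C"
    using r unfolding regular_decaying_def Let_def by (metis funpow_0 le0)
  have C0: "0 \<le> C" using C[of 0] by (smt (verit) abs_ge_zero mult_nonneg_nonneg zero_le_power2)
  \<comment> \<open>Symmetric truncations of the periodisation: for them integral and sum commute
    trivially. The limit follows by dominated convergence, with a constant majorant, since the unit
    interval has finite measure.\<close>
  define s where "s k n x = (\<Sum>j\<in>{- int n..int n}. dilate \<eta> L (int k) (x + of_int j))" for k n x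
  have lim: "(\<lambda>n. prim01 (s k n) t) \<longlonglongrightarrow> prim01 (\<psi> k) t" if k: "k < 2 ^ L" for k
  proof -
    \<comment> \<open>\<open>D\<close> bounds the offset between the period \<open>j\<close> and the
      argument \<open>y\<close> of \<open>\<eta>\<close> over the unit interval:
      \<open>\<bar>j\<bar> \<le> \<bar>y\<bar> + D\<close>. Decay in \<open>y\<close> thus becomes
      decay in \<open>j\<close>.\<close>
    define D where "D = 2 ^ L + real k"
    define A where "A = 2 powr (real L / 2) * C * (1 + D)\<^sup>2"
    have dec: "\<bar>dilate \<eta> L (int k) (x + of_int j)\<bar> \<le> A * (1 / (1 + \<bar>of_int j\<bar>)\<^sup>2)" if x: "x \<in> {0..1}" for x and j :: int
    proof -
      define y where "y = 2 ^ L * (x + of_int j) - real k"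
      have "\<bar>of_int j\<bar> \<le> 2 ^ L * \<bar>real_of_int j\<bar>" by (simp add: mult_le_cancel_right1)
      also have "\<dots> = \<bar>y - 2 ^ L * x + real k\<bar>" by (simp add: y_def algebra_simps abs_mult)
      also have "\<dots> \<le> \<bar>y\<bar> + (2 ^ L + real k)"
      proof -
        have "0 \<le> 2 ^ L * x" "2 ^ L * x \<le> 2 ^ L" using x by (auto simp: mult_le_cancel_left1)
        then show ?thesis by linarith
      qed
      finally have "1 + \<bar>of_int j\<bar> \<le> (1 + \<bar>y\<bar>) + D" by (simp add: D_def)
      also have "\<dots> \<le> (1 + \<bar>y\<bar>) * (1 + D)" by (simp add: D_def algebra_simps)
      finally have "(1 + \<bar>of_int j\<bar>)\<^sup>2 \<le> (1 + \<bar>y\<bar>)\<^sup>2 * (1 + D)\<^sup>2"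
        by (simp add: power_mono flip: power_mult_distrib)
      then have "(1 + \<bar>of_int j\<bar>)\<^sup>2 * \<bar>\<eta> y\<bar> \<le> (1 + \<bar>y\<bar>)\<^sup>2 * (1 + D)\<^sup>2 * \<bar>\<eta> y\<bar>"
        by (rule mult_right_mono) simp
      also have "\<dots> = ((1 + \<bar>y\<bar>)\<^sup>2 * \<bar>\<eta> y\<bar>) * (1 + D)\<^sup>2" by simp
      also have "\<dots> \<le> C * (1 + D)\<^sup>2" by (intro mult_right_mono C) simp
      finally have "\<bar>\<eta> y\<bar> \<le> C * (1 + D)\<^sup>2 / (1 + \<bar>of_int j\<bar>)\<^sup>2"
        by (simp add: pos_le_divide_eq mult.commute)
      then have "2 powr (real L / 2) * \<bar>\<eta> y\<bar> \<le> 2 powr (real L / 2) * (C * (1 + D)\<^sup>2 / (1 + \<bar>of_int j\<bar>)\<^sup>2)"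
        by (rule mult_left_mono) simp
      then show ?thesis by (simp add: dilate_def y_def A_def abs_mult mult.assoc)
    qed
    have A0: "0 \<le> A" using C0 by (simp add: A_def)
    have Asum: "(\<lambda>j::int. A * (1 / (1 + \<bar>of_int j\<bar>)\<^sup>2)) summable_on UNIV"
      by (intro summable_on_cmult_right summable_on_int_inverse_square)
    define B where "B = (\<Sum>\<^sub>\<infinity>j::int. A * (1 / (1 + \<bar>of_int j\<bar>)\<^sup>2))"
    have sB: "\<bar>s k n x\<bar> \<le> B" if x: "x \<in> {0..1}" for n x
    proof -
      have "\<bar>s k n x\<bar> \<le> (\<Sum>j\<in>{- int n..int n}. A * (1 / (1 + \<bar>of_int j\<bar>)\<^sup>2))"
        unfolding s_def by (intro order_trans[OF sum_abs] sum_mono dec x)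
      also have "\<dots> \<le> B" unfolding B_def using A0 by (intro finite_sum_le_infsum Asum) auto
      finally show ?thesis .
    qed
    have conv: "(\<lambda>n. s k n x) \<longlonglongrightarrow> periodised \<phi> \<eta> l k x" if x: "x \<in> {0..1}" for x
    proof -
      have "(\<lambda>j::int. norm (A * (1 / (1 + \<bar>of_int j\<bar>)\<^sup>2))) summable_on UNIV" using Asum A0 by simp
      then have "(\<lambda>j::int. norm (dilate \<eta> L (int k) (x + of_int j))) summable_on UNIV"
      proof (rule Infinite_Sum.abs_summable_on_comparison_test)
        show "norm (dilate \<eta> L (int k) (x + of_int j)) \<le> norm (A * (1 / (1 + \<bar>of_int j\<bar>)\<^sup>2))" for j :: int
          using dec[OF x, of j] A0 by simp
      qed
      then have "(\<lambda>j::int. dilate \<eta> L (int k) (x + of_int j)) summable_on UNIV"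
        by (rule Infinite_Sum.abs_summable_summable)
      then have "((\<lambda>j::int. dilate \<eta> L (int k) (x + of_int j)) has_sum periodised \<phi> \<eta> l k x) UNIV"
        using l has_sum_infsum by (simp add: periodised_def L_def)
      then show ?thesis
        unfolding has_sum_def s_def by (rule filterlim_compose[OF _ filterlim_int_intervals])
    qed
    show ?thesis unfolding ip_def
    proof (rule integral_dominated_convergence[where w="\<lambda>_. B"])
      show "(\<lambda>x. indicator {0..t} x * \<psi> k x) \<in> borel_measurable leb01"
        using m[of k] k by (intro borel_measurable_times tm) (simp add: L_def)
      show "(\<lambda>x. indicator {0..t} x * s k n x) \<in> borel_measurable leb01" for n
        unfolding s_def by (intro borel_measurable_times tm borel_measurable_sum dm)
      show "AE x in leb01. (\<lambda>n. indicator {0..t} x * s k n x) \<longlonglongrightarrow> indicator {0..t} x * \<psi> k x"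
        using ae[OF k[unfolded L_def]] AE_space
      proof eventually_elim
        case (elim x)
        then show ?case using conv[of x] by (auto intro!: tendsto_mult simp: L_def)
      qed
      show "AE x in leb01. norm (indicator {0..t} x * s k n x) \<le> B" for n
        using sB[of _ n] by (intro AE_I2) (auto simp: abs_mult split: split_indicator intro: order_trans[OF abs_ge_zero])
    qed simp
  qed
  have "(\<Sum>k<2 ^ L. \<bar>prim01 (s k n) t\<bar>) \<le> 2 * weighted_integral \<eta> * decay L" for n
  proof -
    have "(\<Sum>k<2 ^ L. \<bar>prim01 (s k n) t\<bar>)
      \<le> (\<Sum>k<2 ^ L. \<Sum>j\<in>{- int n..int n}. \<bar>prim (dilate \<eta> L (int k - 2 ^ L * j)) t\<bar>)"
    proof (rule sum_mono)
      fix k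
      have L2: "(\<lambda>x. dilate \<eta> L (int k) (x + of_int j)) \<in> L2 leb01" for j :: int
      proof -
        have c: "\<bar>\<eta> x\<bar> \<le> C" for x
        proof -
          have "1 * \<bar>\<eta> x\<bar> \<le> (1 + \<bar>x\<bar>)\<^sup>2 * \<bar>\<eta> x\<bar>" by (intro mult_right_mono one_le_power) auto
          then show ?thesis using C[of x] by simp
        qed
        have "\<bar>dilate \<eta> L (int k) y\<bar> \<le> 2 powr (real L / 2) * C" for y by (simp add: dilate_def abs_mult c)
        then have "(dilate \<eta> L (int k) y)\<^sup>2 \<le> (2 powr (real L / 2) * C)\<^sup>2" for y using power_mono[OF _ abs_ge_zero, of "dilate \<eta> L (int k) y" _ 2] by simp
        then show ?thesis unfolding L2_def by (auto intro!: leb01.integrable_const_bound[where B="(2 powr (real L / 2) * C)\<^sup>2"])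
      qed
      have "prim01 (s k n) t = ip leb01 (s k n) (indicator {0..t})" by (rule ip_commute)
      also have "\<dots> = (\<Sum>j\<in>{- int n..int n}. 1 * ip leb01 (\<lambda>x. dilate \<eta> L (int k) (x + of_int j)) (indicator {0..t}))"
        unfolding s_def[abs_def] using ip_sum_left[of "{- int n..int n}" "\<lambda>j x. dilate \<eta> L (int k) (x + of_int j)" leb01 "indicator {0..t}" "\<lambda>_. 1"]
          L2 indicator_L2_leb01 t by simp
      also have "\<dots> = (\<Sum>j\<in>{- int n..int n}. prim (dilate \<eta> L (int k - 2 ^ L * j)) t)"
        using t by (intro sum.cong) (simp_all add: ip_commute[of leb01 _ "indicator {0..t}"] ip_indicator dilate_shift)
      finally show "\<bar>prim01 (s k n) t\<bar>
        \<le> (\<Sum>j\<in>{- int n..int n}. \<bar>prim (dilate \<eta> L (int k - 2 ^ L * j)) t\<bar>)"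
        by simp
    qed
    also have "\<dots> = (\<Sum>(k, j)\<in>{..<2 ^ L} \<times> {- int n..int n}. \<bar>prim (dilate \<eta> L (int k - 2 ^ L * j)) t\<bar>)"
      by (rule sum.cartesian_product)
    also have "\<dots> = (\<Sum>i\<in>(\<lambda>(k, j). int k - 2 ^ L * j) ` ({..<2 ^ L} \<times> {- int n..int n}). \<bar>prim (dilate \<eta> L i) t\<bar>)"
    proof (subst sum.reindex)
      show "inj_on (\<lambda>(k, j). int k - 2 ^ L * j) ({..<2 ^ L} \<times> {- int n..int n})"
      proof (rule inj_onI, clarsimp)
        fix k j k' j' assume k: "k < 2 ^ L" "k' < 2 ^ L" and eq: "int k - 2 ^ L * j = int k' - 2 ^ L * j'"
        \<comment> \<open>The residue modulo \<open>2 ^ L\<close> recovers \<open>k\<close>, and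
          then \<open>j\<close> is determined as well.\<close>
        have md: "(int k - 2 ^ L * j) mod 2 ^ L = int k" if "k < 2 ^ L" for k j
        proof -
          have "int k < 2 ^ L" using that by (metis of_nat_less_iff of_nat_numeral of_nat_power)
          moreover have "(int k - 2 ^ L * j) mod 2 ^ L = int k mod 2 ^ L"
            using mod_mult_self1[of "int k" "- j" "2 ^ L"] by (simp add: mult.commute)
          ultimately show ?thesis by simp
        qed
        have "int k = int k'" using md[OF k(1), of j] md[OF k(2), of j'] eq by metis
        then have "k = k'" using eq by simp
        then show "k = k' \<and> j = j'" using eq by simp
      qed
    qed (simp add: case_prod_beta)
    also have "\<dots> \<le> 2 * weighted_integral \<eta> * decay L"
      using t by (intro sum_integral_dilate_le g) auto
    finally show ?thesis .
  qed
  moreover have "(\<lambda>n. \<Sum>k<2 ^ L. \<bar>prim01 (s k n) t\<bar>) \<longlonglongrightarrow> (\<Sum>k<2 ^ L. \<bar>prim01 (\<psi> k) t\<bar>)"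
    by (intro tendsto_sum tendsto_rabs lim) simp
  ultimately have "(\<Sum>k<2 ^ L. \<bar>prim01 (\<psi> k) t\<bar>) \<le> 2 * weighted_integral \<eta> * decay L"
    by (intro LIMSEQ_le_const2) auto
  then show ?thesis using l by (simp add: L_def)
qed

section \<open>Boundary-corrected wavelets\<close>

lemma integrable_dilate:
  assumes "integrable lborel g" shows "integrable lborel (dilate g l k)"
proof -
  have "integrable lborel (\<lambda>x. g (- of_int k + 2 ^ l * x))"
    using assms by (intro lborel_integrable_real_affine) auto
  then show ?thesis unfolding dilate_def[abs_def] by (simp add: algebra_simps)
qed

lemma integrable_cdv_raw:
  assumes "integrable lborel \<phi>" shows "integrable lborel (cdv_raw N \<phi> i)"
proof -
  have "integrable lborel (\<lambda>x. \<phi> (x + real n - real N + 1))" for n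
    using lborel_integrable_real_affine[OF assms, of 1 "real n - real N + 1"] by (simp add: algebra_simps)
  then show ?thesis unfolding cdv_raw_def[abs_def] by simp
qed

text \<open>Edge functions are prescribed only on the half line. Reading their expansions on the
  whole line gives integrable representatives, to which the affine change of variables applies;
  \<open>A\<close> is a common bound for finitely many norms.\<close>

lemma cdv_edge_wavelet_integrable:
  assumes \<phi>: "integrable lborel \<phi>" and s: "cdv_edge_scaling N \<phi> \<phi>e"
    and w: "cdv_edge_wavelet N \<phi> \<eta> \<phi>e \<eta>e"
  obtains g A where "0 \<le> A" "\<And>k. k < N \<Longrightarrow> integrable lborel (g k)"
    "\<And>k. k < N \<Longrightarrow> (\<integral>x. \<bar>g k x\<bar> \<partial>lborel) \<le> A" "\<And>k x. k < N \<Longrightarrow> 0 \<le> x \<Longrightarrow> \<eta>e k x = g k x"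
proof -
  have "\<exists>p. integrable lborel p \<and> (\<forall>x\<ge>0. \<phi>e k x = p x)" if k: "k < N" for k
  proof -
    obtain c where c: "\<And>x. x \<ge> 0 \<Longrightarrow> \<phi>e k x = (\<Sum>i = N - 1 - k..<N. c i * cdv_raw N \<phi> i x)"
      using s k unfolding cdv_edge_scaling_def by blast
    have "integrable lborel (\<lambda>x. \<Sum>i = N - 1 - k..<N. c i * cdv_raw N \<phi> i x)"
      by (intro Bochner_Integration.integrable_sum integrable_mult_right integrable_cdv_raw \<phi>)
    then show ?thesis using c by blast
  qed
  then obtain p where p: "\<And>k. k < N \<Longrightarrow> integrable lborel (p k)" "\<And>k x. k < N \<Longrightarrow> 0 \<le> x \<Longrightarrow> \<phi>e k x = p k x"
    by metis
  have "\<exists>g. integrable lborel g \<and> (\<forall>x\<ge>0. \<eta>e k x = g x)" if k: "k < N" for k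
  proof -
    obtain a b where ab: "\<And>x. x \<ge> 0 \<Longrightarrow> \<eta>e k x = (\<Sum>i<N. a i * dilate (\<phi>e i) 1 0 x) +
        (\<Sum>m = N..N + 2 * k. b m * dilate \<phi> 1 (int m) x)"
      using w k unfolding cdv_edge_wavelet_def by blast
    define g where "g x = (\<Sum>i<N. a i * dilate (p i) 1 0 x) + (\<Sum>m = N..N + 2 * k. b m * dilate \<phi> 1 (int m) x)" for x
    have "integrable lborel g" unfolding g_def[abs_def]
      by (intro Bochner_Integration.integrable_add Bochner_Integration.integrable_sum integrable_mult_right integrable_dilate p \<phi>) auto
    moreover have "\<eta>e k x = g x" if "x \<ge> 0" for x
      unfolding ab[OF that] g_def using that by (auto simp: dilate_def p(2) intro!: sum.cong)
    ultimately show ?thesis by blast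
  qed
  then obtain g where g: "\<And>k. k < N \<Longrightarrow> integrable lborel (g k)" "\<And>k x. k < N \<Longrightarrow> 0 \<le> x \<Longrightarrow> \<eta>e k x = g k x"
    by metis
  show ?thesis
  proof (rule that[of "\<Sum>k<N. \<integral>x. \<bar>g k x\<bar> \<partial>lborel" g])
    show "(\<integral>x. \<bar>g k x\<bar> \<partial>lborel) \<le> (\<Sum>k<N. \<integral>x. \<bar>g k x\<bar> \<partial>lborel)" if "k < N" for k
      using that by (intro member_le_sum) auto
  qed (auto intro!: sum_nonneg simp: g)
qed

text \<open>Interior terms are controlled only through their sum, edge terms one by one; there are
  at most \<open>N\<close> of the latter at either end.\<close>

lemma sum_three_parts_le:
  fixes u f :: "nat \<Rightarrow> real" and N n :: nat and a b :: real
  assumes left: "\<And>k. k < N \<Longrightarrow> u k \<le> a" and mid: "\<And>k. N \<le> k \<Longrightarrow> k + N < n \<Longrightarrow> u k \<le> f k"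
    and right: "\<And>k. k < n \<Longrightarrow> N \<le> k \<Longrightarrow> n \<le> k + N \<Longrightarrow> u k \<le> b"
    and f: "\<And>k. 0 \<le> f k" and a: "0 \<le> a" and b: "0 \<le> b"
  shows "(\<Sum>k<n. u k) \<le> N * a + (\<Sum>k<n. f k) + N * b"
proof -
  have "(\<Sum>k<n. u k) \<le> (\<Sum>k<n. (if k < N then a else 0) + f k + (if n \<le> k + N then b else 0))"
  proof (rule sum_mono)
    fix k assume "k \<in> {..<n}"
    then show "u k \<le> (if k < N then a else 0) + f k + (if n \<le> k + N then b else 0)"
      using left[of k] mid[of k] right[of k] f[of k] a b by (cases "k < N"; cases "n \<le> k + N") auto
  qed
  also have "\<dots> = card {k. k < n \<and> k < N} * a + (\<Sum>k<n. f k) + card {k. k < n \<and> n \<le> k + N} * b"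
    by (simp add: sum.distrib flip: sum.inter_filter)
  also have "\<dots> \<le> N * a + (\<Sum>k<n. f k) + N * b"
  proof -
    have "card {k. k < n \<and> k < N} \<le> card {..<N}" by (intro card_mono) auto
    moreover have "card {k. k < n \<and> n \<le> k + N} \<le> card {n - N..<n}" by (intro card_mono) auto
    moreover have "card {n - N..<n} \<le> N" by simp
    ultimately show ?thesis using a b by (intro add_mono mult_right_mono) auto
  qed
  finally show ?thesis .
qed

text \<open>No cancellation is used: the number of edge functions does not grow with the level, so
  amplitude against Jacobian already gives the rate. The negative choice of \<open>c\<close> serves
  the functions reflected at 1.\<close>

lemma edge_integral_le:
  assumes g: "integrable lborel g" and c: "c = 2 ^ l \<or> c = - (2 ^ l)"
    and t: "t \<in> {0..1}" and f: "f \<in> borel_measurable leb01"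
    and ae: "AE x in leb01. f x = 2 powr (real l / 2) * g (b + c * x)"
  shows "\<bar>prim01 f t\<bar> \<le> decay l * (\<integral>x. \<bar>g x\<bar> \<partial>lborel)"
proof -
  have c0: "c \<noteq> 0" "\<bar>c\<bar> = 2 ^ l" using c by auto
  have [measurable]: "g \<in> borel_measurable borel" using borel_measurable_integrable[OF g] by simp
  have "prim01 f t = (\<integral>x. indicator {0..t} x * (2 powr (real l / 2) * g (b + c * x)) \<partial>lborel)"
    using t ae f by (intro ip_indicator_AE) auto
  also have "\<dots> = 2 powr (real l / 2) * (\<integral>x. indicator {0..t} x * g (b + c * x) \<partial>lborel)"
    by (simp add: mult.left_commute flip: integral_mult_right_zero)
  also have "\<bar>\<dots>\<bar> = 2 powr (real l / 2) * \<bar>\<integral>x. indicator {0..t} x * g (b + c * x) \<partial>lborel\<bar>"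
    by (simp add: abs_mult)
  also have "\<dots> \<le> 2 powr (real l / 2) * ((\<integral>x. \<bar>g x\<bar> \<partial>lborel) / 2 ^ l)"
    using integral_affine_le[OF g c0(1), of "{0..t}" b] c0(2) by (intro mult_left_mono) auto
  also have "\<dots> = decay l * (\<integral>x. \<bar>g x\<bar> \<partial>lborel)"
    by (simp flip: powr_half_div)
  finally show ?thesis .
qed

lemma cdv_level_bound:
  assumes S: "0 < S" and b: "cdv_basis S J0 \<psi>"
    and m: "\<And>l k. (l, k) \<in> index_set J0 \<Longrightarrow> \<psi> l k \<in> borel_measurable leb01"
  shows "\<exists>C. \<forall>l\<ge>int J0. \<forall>t\<in>{0..1}. (\<Sum>k<level_size J0 l. \<bar>prim01 (\<psi> l k) t\<bar>)
    \<le> C * decay l"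
proof -
  obtain N \<phi> \<eta> \<phi>L \<eta>L \<phi>R \<eta>R where p: "regular_wavelet_pair S \<phi> \<eta>"
    and L: "cdv_edge_scaling N \<phi> \<phi>L" "cdv_edge_wavelet N \<phi> \<eta> \<phi>L \<eta>L"
    and R: "cdv_edge_scaling N (\<lambda>x. \<phi> (1 - x)) \<phi>R"
      "cdv_edge_wavelet N (\<lambda>x. \<phi> (1 - x)) (\<lambda>x. \<eta> (1 - x)) \<phi>R \<eta>R"
    and ae0: "\<forall>(l, k)\<in>index_set J0. AE x in leb01.
           \<psi> l k x = (if l < int J0 then interval_family N \<phi>L \<phi> \<phi>R J0 k x
                      else interval_family N \<eta>L \<eta> \<eta>R (nat l) k x)"
    using b unfolding cdv_basis_def by blast
  have \<eta>: "weighted_mean_zero \<eta>" by (rule regular_wavelet_pair_weighted[OF p S])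
  have \<phi>: "integrable lborel \<phi>" by (rule regular_wavelet_pair_integrable[OF p])
  have \<phi>': "integrable lborel (\<lambda>x. \<phi> (1 - x))"
    using lborel_integrable_real_affine[OF \<phi>, of "-1" 1] by simp
  have [measurable]: "\<eta> \<in> borel_measurable borel" using \<eta> by (simp add: weighted_mean_zero_def)
  obtain gL A where A0: "0 \<le> A" and gL: "\<And>k. k < N \<Longrightarrow> integrable lborel (gL k)" "\<And>k x. k < N \<Longrightarrow> 0 \<le> x \<Longrightarrow> \<eta>L k x = gL k x"
    and A: "\<And>k. k < N \<Longrightarrow> (\<integral>x. \<bar>gL k x\<bar> \<partial>lborel) \<le> A"
    by (rule cdv_edge_wavelet_integrable[OF \<phi> L]) blast
  obtain gR B where B0: "0 \<le> B" and gR: "\<And>k. k < N \<Longrightarrow> integrable lborel (gR k)" "\<And>k x. k < N \<Longrightarrow> 0 \<le> x \<Longrightarrow> \<eta>R k x = gR k x"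
    and B: "\<And>k. k < N \<Longrightarrow> (\<integral>x. \<bar>gR k x\<bar> \<partial>lborel) \<le> B"
    by (rule cdv_edge_wavelet_integrable[OF \<phi>' R]) blast
  show ?thesis
  proof (intro exI[of _ "N * A + 2 * weighted_integral \<eta> + N * B"] allI impI ballI)
    fix l :: int and t :: real assume l: "int J0 \<le> l" and t: "t \<in> {0..1}"
    define n where "n = nat l"
    have nl: "real n = real_of_int l" using l by (simp add: n_def)
    have ls: "level_size J0 l = 2 ^ n" using l by (simp add: level_size_def n_def)
    have ae: "AE x in leb01. \<psi> l k x = interval_family N \<eta>L \<eta> \<eta>R n k x" and mk: "\<psi> l k \<in> borel_measurable leb01" if "k < 2 ^ n" for k
    proof -
      have "(l, k) \<in> index_set J0" using that l ls by (simp add: index_set_def)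
      then show "\<psi> l k \<in> borel_measurable leb01" "AE x in leb01. \<psi> l k x = interval_family N \<eta>L \<eta> \<eta>R n k x"
        using m ae0 l by (auto simp: n_def)
    qed
    let ?P = "decay n"
    have mid: "\<bar>prim01 (\<psi> l k) t\<bar> \<le> \<bar>prim (dilate \<eta> n (int k)) t\<bar>"
      if k: "N \<le> k" "k + N < 2 ^ n" for k
    proof -
      have "prim01 (\<psi> l k) t = (prim (dilate \<eta> n (int k)) t)"
        using t k ae[of k] mk[of k] by (intro ip_indicator_AE) (auto simp: interval_family_def dilate_def[abs_def])
      then show ?thesis by simp
    qed
    have left: "\<bar>prim01 (\<psi> l k) t\<bar> \<le> ?P * A" if k: "k < N" "k < 2 ^ n" for k
    proof (rule order_trans[OF edge_integral_le[OF gL(1)[OF k(1)], where l=n and c="2 ^ n" and b=0]])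
      show "AE x in leb01. \<psi> l k x = 2 powr (real n / 2) * gL k (0 + 2 ^ n * x)"
        using ae[OF k(2)] AE_space
      proof eventually_elim
        case (elim x)
        then show ?case using k gL(2)[OF k(1), of "2 ^ n * x"] by (simp add: interval_family_def dilate_def)
      qed
      show "?P * (\<integral>x. \<bar>gL k x\<bar> \<partial>lborel) \<le> ?P * A" by (intro mult_left_mono A k) simp
    qed (use t mk[OF k(2)] in auto)
    have right: "\<bar>prim01 (\<psi> l k) t\<bar> \<le> ?P * B" if k: "k < 2 ^ n" "N \<le> k" "2 ^ n \<le> k + N" for k
    proof -
      \<comment> \<open>The index counted from the right end point.\<close>
      define j where "j = 2 ^ n - 1 - k"
      have j: "j < N" using k by (simp add: j_def)
      show ?thesis
      proof (rule order_trans[OF edge_integral_le[OF gR(1)[OF j], where l=n and c="- (2 ^ n)" and b="2 ^ n"]])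
        show "AE x in leb01. \<psi> l k x = 2 powr (real n / 2) * gR j (2 ^ n + - (2 ^ n) * x)"
          using ae[OF k(1)] AE_space
        proof eventually_elim
          case (elim x)
          then show ?case using k gR(2)[OF j, of "2 ^ n * (1 - x)"]
            by (simp add: interval_family_def dilate_def j_def algebra_simps)
        qed
        show "?P * (\<integral>x. \<bar>gR j x\<bar> \<partial>lborel) \<le> ?P * B" by (intro mult_left_mono B j) simp
      qed (use t mk[OF k(1)] in auto)
    qed
    \<comment> \<open>The left-edge hypothesis of \<open>sum_three_parts_le\<close> ranges over all
      \<open>k < N\<close>; extension by 0 covers indices beyond the level.\<close>
    define u where "u k = (if k < 2 ^ n then \<bar>prim01 (\<psi> l k) t\<bar> else 0)" for k
    have "(\<Sum>k<2 ^ n. u k) \<le> N * (?P * A)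
        + (\<Sum>k<2 ^ n. \<bar>prim (dilate \<eta> n (int k)) t\<bar>) + N * (?P * B)"
      by (rule sum_three_parts_le) (use left mid right A0 B0 in \<open>auto simp: u_def\<close>)
    also have "(\<Sum>k<2 ^ n. \<bar>prim (dilate \<eta> n (int k)) t\<bar>) \<le> 2 * weighted_integral \<eta> * ?P"
      unfolding sum_nat_as_int[of "\<lambda>k. \<bar>prim (dilate \<eta> n k) t\<bar>"]
      using t by (intro sum_integral_dilate_le \<eta>) auto
    finally have "(\<Sum>k<2 ^ n. u k) \<le> (N * A + 2 * weighted_integral \<eta> + N * B) * ?P"
      by (simp add: algebra_simps)
    also have "(\<Sum>k<2 ^ n. u k) = (\<Sum>k<2 ^ n. \<bar>prim01 (\<psi> l k) t\<bar>)"
      by (intro sum.cong) (auto simp: u_def)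
    finally show "(\<Sum>k<level_size J0 l. \<bar>prim01 (\<psi> l k) t\<bar>)
        \<le> (N * A + 2 * weighted_integral \<eta> + N * B) * decay l"
      by (simp add: ls nl)
  qed
qed

section \<open>The level bound for all three kinds of basis\<close>

lemma wavelet_basis_L2:
  assumes "wavelet_basis S J0 \<psi>" "(l, k) \<in> index_set J0" shows "\<psi> l k \<in> L2 leb01"
  using assms unfolding wavelet_basis_def orthonormal_basis_def orthonormal_def by fastforce

text \<open>Bessel's inequality for a single basis function, the indicator having norm at most
  1.\<close>

lemma ip_indicator_orthonormal_le_1:
  assumes o: "orthonormal leb01 I e" and i: "i \<in> I" and t: "t \<in> {0..1}"
  shows "\<bar>prim01 (e i) t\<bar> \<le> 1"
proof -
  have "(\<Sum>j\<in>{i}. (ip leb01 (indicator {0..t}) (e j))\<^sup>2) \<le> ip leb01 (indicator {0..t}) (indicator {0..t})"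
    using i t by (intro Bessel[OF o] indicator_L2_leb01) auto
  also have "\<dots> \<le> 1"
    using t by (subst ip_indicator) (auto simp flip: indicator_inter_arith)
  finally show ?thesis by (simp add: abs_le_square_iff[of _ 1, simplified])
qed

text \<open>The wavelets of level \<open>l\<close> have size \<open>2\<^sup>l\<^sup>/\<^sup>2\<close>, live at scale \<open>2\<^sup>-\<^sup>l\<close> and integrate to zero, so only
  boundedly many of their primitives matter at any \<open>t\<close>.\<close>

theorem wavelet_level_bound:
  assumes b: "wavelet_basis S J0 \<psi>"
  shows "\<exists>C. \<forall>l\<ge>int J0 - 1. \<forall>t\<in>{0..1}.
    (\<Sum>k<level_size J0 l. \<bar>prim01 (\<psi> l k) t\<bar>) \<le> C * decay l"
proof -
  have m: "\<psi> l k \<in> borel_measurable leb01" if "(l, k) \<in> index_set J0" for l k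
    using wavelet_basis_L2[OF b that] by (simp add: L2_def)
  have o: "orthonormal leb01 (index_set J0) (\<lambda>(l, k). \<psi> l k)"
    using b by (simp add: wavelet_basis_def orthonormal_basis_def)
  have "\<exists>C. \<forall>l\<ge>int J0. \<forall>t\<in>{0..1}. (\<Sum>k<level_size J0 l. \<bar>prim01 (\<psi> l k) t\<bar>)
    \<le> C * decay l"
  proof -
    have m': "\<psi> l k \<in> borel_measurable leb01" "(l, k) \<in> index_set J0" if "J0 = 0" "0 \<le> l" "k < 2 ^ nat l" for l k
      using that m[of l k] by (auto simp: index_set_def level_size_def)
    consider (haar) "J0 = 0" "\<forall>(l, k)\<in>index_set J0. AE x in leb01. \<psi> l k x = haar l k x"
      | (per) \<phi> \<eta> where "S > 0" "J0 = 0" "regular_wavelet_pair S \<phi> \<eta>"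
          "\<forall>(l, k)\<in>index_set J0. AE x in leb01. \<psi> l k x = periodised \<phi> \<eta> l k x"
      | (cdv) "S > 0" "cdv_basis S J0 \<psi>"
      using b unfolding wavelet_basis_def by blast
    then show ?thesis
    proof cases
      case haar
      have "(\<Sum>k<2 ^ nat l. \<bar>prim01 (\<psi> l k) t\<bar>) \<le> 2 * weighted_integral haar_mother * decay l"
        if "0 \<le> l" "t \<in> {0..1}" for l t
      proof (rule haar_level_bound[OF that(2,1)])
        fix k :: nat assume "k < 2 ^ nat l"
        from m'[OF haar(1) that(1) this] haar(2)
        show "\<psi> l k \<in> borel_measurable leb01" "AE x in leb01. \<psi> l k x = haar l k x" by auto
      qed
      then show ?thesis using haar(1)
        by (intro exI[of _ "2 * weighted_integral haar_mother"]) (auto simp: level_size_def)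
    next
      case per
      have "(\<Sum>k<2 ^ nat l. \<bar>prim01 (\<psi> l k) t\<bar>) \<le> 2 * weighted_integral \<eta> * decay l"
        if "0 \<le> l" "t \<in> {0..1}" for l t
      proof (rule periodised_level_bound[OF regular_wavelet_pair_weighted[OF per(3,1)] _ that(2,1)])
        show "regular_decaying S \<eta>" using per(3) by (simp add: regular_wavelet_pair_def)
        fix k :: nat assume "k < 2 ^ nat l"
        from m'[OF per(2) that(1) this] per(4)
        show "\<psi> l k \<in> borel_measurable leb01" "AE x in leb01. \<psi> l k x = periodised \<phi> \<eta> l k x" by auto
      qed
      then show ?thesis using per(2)
        by (intro exI[of _ "2 * weighted_integral \<eta>"]) (auto simp: level_size_def)
    next
      case cdv
      then show ?thesis using m by (intro cdv_level_bound)
    qed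
  qed
  then obtain C where C: "\<And>l t. l \<ge> int J0 \<Longrightarrow> t \<in> {0..1} \<Longrightarrow>
      (\<Sum>k<level_size J0 l. \<bar>prim01 (\<psi> l k) t\<bar>) \<le> C * decay l"
    by blast
  define l0 where "l0 = int J0 - 1"
  \<comment> \<open>The scaling functions at the bottom level have no vanishing mean to exploit.
    Their primitives are at most 1, and \<open>K\<close> is chosen so that
    \<open>K * decay l0\<close> is their number.\<close>
  define K where "K = real (level_size J0 l0) / decay l0"
  show ?thesis
  proof (intro exI[of _ "max C K"] allI impI ballI)
    fix l :: int and t :: real assume l: "int J0 - 1 \<le> l" and t: "t \<in> {0..1}"
    have "(\<Sum>k<level_size J0 l. \<bar>prim01 (\<psi> l k) t\<bar>) \<le> C * decay l \<or>
        (\<Sum>k<level_size J0 l. \<bar>prim01 (\<psi> l k) t\<bar>) \<le> K * decay l"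
    proof (cases "int J0 \<le> l")
      case False
      then have l: "l = l0" using l by (simp add: l0_def)
      have "(\<Sum>k<level_size J0 l0. \<bar>prim01 (\<psi> l0 k) t\<bar>) \<le> (\<Sum>k<level_size J0 l0. 1)"
      proof (rule sum_mono)
        fix k assume "k \<in> {..<level_size J0 l0}"
        then have "(l0, k) \<in> index_set J0" by (simp add: index_set_def l0_def)
        from ip_indicator_orthonormal_le_1[OF o this t] show "\<bar>prim01 (\<psi> l0 k) t\<bar> \<le> 1" by simp
      qed
      then show ?thesis using l by (simp add: K_def)
    qed (use C t in blast)
    moreover have "C * decay l \<le> max C K * decay l"
      "K * decay l \<le> max C K * decay l"
      by (intro mult_right_mono; simp)+
    ultimately show "(\<Sum>k<level_size J0 l. \<bar>prim01 (\<psi> l k) t\<bar>) \<le> max C K * decay l"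
      by linarith
  qed
qed

section \<open>Distribution functions of multiscale sequences\<close>

lemma level_block_mono: "m \<le> m' \<Longrightarrow> level_block J0 m \<subseteq> level_block J0 m'"
  by (auto simp: level_block_def)

lemma M0_lincomb:
  assumes w: "weight J0 w" and x: "x \<in> mspace (M0_space J0 w)" and y: "y \<in> mspace (M0_space J0 w)"
  shows "(\<lambda>i\<in>index_set J0. p * x i + q * y i) \<in> mspace (M0_space J0 w)"
proof (rule M0_I[OF w])
  fix e :: real assume e: "e > 0"
  \<comment> \<open>The summand 1 keeps the denominator positive when both scalars vanish.\<close>
  define d where "d = e / (\<bar>p\<bar> + \<bar>q\<bar> + 1)"
  have d: "d > 0" and de: "(\<bar>p\<bar> + \<bar>q\<bar>) * d \<le> e" using e by (auto simp: d_def field_simps)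
  obtain m where m: "\<And>l k. (l, k) \<in> index_set J0 - level_block J0 m \<Longrightarrow> \<bar>x (l, k)\<bar> \<le> d * w l"
    using M0_small_tail[OF w x d] by auto
  obtain m' where m': "\<And>l k. (l, k) \<in> index_set J0 - level_block J0 m' \<Longrightarrow> \<bar>y (l, k)\<bar> \<le> d * w l"
    using M0_small_tail[OF w y d] by auto
  have "\<bar>p * x (l, k) + q * y (l, k)\<bar> \<le> e * w l" if i: "(l, k) \<in> index_set J0 - level_block J0 (max m m')" for l k
  proof -
    have "(l, k) \<in> index_set J0 - level_block J0 m" "(l, k) \<in> index_set J0 - level_block J0 m'"
      using i level_block_mono[of m "max m m'" J0] level_block_mono[of m' "max m m'" J0] by auto
    note xy = m[OF this(1)] m'[OF this(2)]
    have "\<bar>p * x (l, k) + q * y (l, k)\<bar> \<le> \<bar>p\<bar> * \<bar>x (l, k)\<bar> + \<bar>q\<bar> * \<bar>y (l, k)\<bar>"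
      by (metis abs_mult abs_triangle_ineq)
    also have "\<dots> \<le> \<bar>p\<bar> * (d * w l) + \<bar>q\<bar> * (d * w l)" using xy by (intro add_mono mult_left_mono) auto
    also have "\<dots> = ((\<bar>p\<bar> + \<bar>q\<bar>) * d) * w l" by (simp add: algebra_simps)
    also have "\<dots> \<le> e * w l" using de weight_ge_1[OF w, of l] i by (intro mult_right_mono) (auto simp: index_set_def)
    finally show ?thesis .
  qed
  then show "\<exists>m. \<forall>(l, k)\<in>index_set J0 - level_block J0 m. \<bar>(\<lambda>i\<in>index_set J0. p * x i + q * y i) (l, k)\<bar> \<le> e * w l"
    by (intro exI[of _ "max m m'"]) auto
qed simp

lemma M0_zero: "weight J0 w \<Longrightarrow> (\<lambda>i\<in>index_set J0. 0) \<in> mspace (M0_space J0 w)"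
  using weight_ge_1 by (intro M0_I) (force simp: index_set_def)+

lemma M0_coordinate_measurable:
  assumes w: "weight J0 w" and i: "i \<in> index_set J0"
  shows "(\<lambda>x. x i) \<in> borel_measurable (metric_borel (M0_space J0 w))"
  unfolding metric_borel_euclidean[symmetric]
proof (intro measurable_metric_borel_continuous Lipschitz_continuous_map_intro[where K="w (fst i)"])
  fix x y assume "x \<in> mspace (M0_space J0 w)" "y \<in> mspace (M0_space J0 w)"
  then show "mdist euclidean_metric (x i) (y i) \<le> w (fst i) * mdist (M0_space J0 w) x y"
    using mdist_M0_le[OF w, of x y "mdist (M0_space J0 w) x y"] i by (cases i) (auto simp: dist_real_def mult.commute)
qed simp

lemma continuous_on_ip_indicator:
  assumes e: "e \<in> L2 leb01" shows "continuous_on {0..1} (\<lambda>t. prim01 e t)"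
proof -
  have "integrable leb01 e"
    using L2_mult_integrable[OF e indicator_L2_leb01[of 1]]
    by (rule Bochner_Integration.integrable_cong[THEN iffD1, rotated 2]) auto
  then have "set_integrable lborel {0..1} e"
    unfolding leb01_def set_integrable_def by (subst (asm) integrable_restrict_space) auto
  then have i: "set_integrable lborel {0..t} e" if "t \<le> 1" for t
    by (rule set_integrable_subset) (use that in auto)
  have "continuous_on {0..1} (\<lambda>t. integral {0..t} e)"
    by (intro indefinite_integral_continuous_1 set_borel_integral_eq_integral(1) i) simp
  then show ?thesis
    by (rule continuous_on_eq)
       (simp add: set_borel_integral_eq_integral(2)[OF i, symmetric] ip_indicator set_lebesgue_integral_def)
qed

lemma wavelet_coeffs_apply: "(l, k) \<in> index_set J0 \<Longrightarrow> wavelet_coeffs \<psi> J0 f (l, k) = ip leb01 f (\<psi> l k)"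
  by (simp add: wavelet_coeffs_def)

lemma wavelet_coeffs_extensional [simp]: "wavelet_coeffs \<psi> J0 f \<in> extensional (index_set J0)"
  by (simp add: wavelet_coeffs_def)

text \<open>Built from \<open>wn_integral\<close>, so that it makes sense for sequences outside the
  coefficients of square-integrable functions, and so that centring at the observation gives its
  value at the data by definition.\<close>

definition cdf_map :: "(int \<Rightarrow> nat \<Rightarrow> real \<Rightarrow> real) \<Rightarrow> nat \<Rightarrow> (int \<times> nat \<Rightarrow> real) \<Rightarrow> real \<Rightarrow> real" where
  "cdf_map \<psi> J0 x = (\<lambda>t\<in>{0..1}. wn_integral \<psi> J0 x (indicat_real {0..t}))"

text \<open>This isolates what the remaining argument uses of the wavelets, whatever their
  construction. Levels are counted from 0 in \<open>b\<close>, the shift by \<open>J0 - 1\<close>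
  being made explicit.\<close>

locale summable_primitives =
  fixes \<psi> :: "int \<Rightarrow> nat \<Rightarrow> real \<Rightarrow> real" and J0 :: nat and w :: "int \<Rightarrow> real" and b :: "nat \<Rightarrow> real"
  assumes basis: "orthonormal_basis leb01 (index_set J0) (\<lambda>(l, k). \<psi> l k)"
    and w: "weight J0 w"
    and b: "\<And>j t. t \<in> {0..1} \<Longrightarrow> (\<Sum>k<level_size J0 (int J0 - 1 + int j).
      \<bar>prim01 (\<psi> (int J0 - 1 + int j) k) t\<bar>) \<le> b j"
    and summable_wb: "summable (\<lambda>j. w (int J0 - 1 + int j) * b j)"
begin

abbreviation "lev j \<equiv> int J0 - 1 + int j"
abbreviation "M0 \<equiv> M0_space J0 w"
abbreviation "coef \<equiv> wavelet_coeffs \<psi> J0"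

definition level_term :: "(int \<times> nat \<Rightarrow> real) \<Rightarrow> real \<Rightarrow> nat \<Rightarrow> real" where
  "level_term x t j = (\<Sum>k<level_size J0 (lev j). coef (indicator {0..t}) (lev j, k) * x (lev j, k))"

text \<open>The maximum with 1 meets the condition on the Lipschitz constant in
  \<open>bl_dist_pushforward\<close>.\<close>

definition K where "K = max 1 (\<Sum>j. w (lev j) * b j)"

lemma K_ge_1: "1 \<le> K" by (simp add: K_def)

lemma psi_L2: "(l, k) \<in> index_set J0 \<Longrightarrow> \<psi> l k \<in> L2 leb01"
  using basis unfolding orthonormal_basis_def orthonormal_def by fastforce

lemma lev_in: "k < level_size J0 (lev j) \<Longrightarrow> (lev j, k) \<in> index_set J0"
  by (simp add: index_set_def)

lemma wn_integral_term: "wn_integral \<psi> J0 x (indicat_real {0..t}) = (\<Sum>j. level_term x t j)"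
  by (simp add: wn_integral_def level_term_def Let_def)

text \<open>Within a level, the absolute sum of the primitives is paired with the maximum of the
  coefficients.\<close>

lemma level_term_le:
  assumes t: "t \<in> {0..1}" and x: "\<And>k. k < level_size J0 (lev j) \<Longrightarrow> \<bar>x (lev j, k)\<bar> \<le> r * w (lev j)"
  shows "\<bar>level_term x t j\<bar> \<le> r * (w (lev j) * b j)"
proof -
  have r: "0 \<le> r * w (lev j)" using x[OF level_size_pos] abs_ge_zero order_trans by blast
  have "\<bar>level_term x t j\<bar> \<le> (\<Sum>k<level_size J0 (lev j). \<bar>prim01 (\<psi> (lev j) k) t\<bar> * (r * w (lev j)))"
    unfolding level_term_def using x
    by (intro order_trans[OF sum_abs] sum_mono) (auto simp: abs_mult wavelet_coeffs_apply lev_in intro!: mult_left_mono)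
  also have "\<dots> \<le> b j * (r * w (lev j))"
    using b[OF t, of j] r by (simp add: sum_distrib_right[symmetric] mult_right_mono)
  finally show ?thesis by (simp add: mult_ac)
qed

lemma M0_bound:
  assumes x: "x \<in> mspace M0"
  obtains r where "\<And>l k. (l, k) \<in> index_set J0 \<Longrightarrow> \<bar>x (l, k)\<bar> \<le> r * w l"
  using mdist_M0_le[OF w x M0_zero[OF w], of "mdist M0 x (\<lambda>i\<in>index_set J0. 0)"] that by force

lemma summable_term:
  assumes x: "x \<in> mspace M0" and t: "t \<in> {0..1}" shows "summable (level_term x t)"
proof -
  obtain r where r: "\<And>l k. (l, k) \<in> index_set J0 \<Longrightarrow> \<bar>x (l, k)\<bar> \<le> r * w l" using M0_bound[OF x] by blast
  then have "\<bar>level_term x t j\<bar> \<le> r * (w (lev j) * b j)" for j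
    using lev_in by (intro level_term_le[OF t]) blast
  then show ?thesis
    by (intro summable_comparison_test'[OF summable_mult[OF summable_wb, of r], of 0]) auto
qed

lemma level_term_lincomb: "level_term (\<lambda>i\<in>index_set J0. p * x i + q * y i) t j = p * level_term x t j + q * level_term y t j"
proof -
  have "level_term (\<lambda>i\<in>index_set J0. p * x i + q * y i) t j
      = (\<Sum>k<level_size J0 (lev j). coef (indicator {0..t}) (lev j, k) * (p * x (lev j, k) + q * y (lev j, k)))"
    unfolding level_term_def by (intro sum.cong refl, subst restrict_apply'[OF lev_in]) auto
  then show ?thesis by (simp add: level_term_def distrib_left mult.left_commute sum.distrib sum_distrib_left)
qed

lemma cdf_map_lincomb:
  assumes x: "x \<in> mspace M0" and y: "y \<in> mspace M0" and t: "t \<in> {0..1}"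
  shows "cdf_map \<psi> J0 (\<lambda>i\<in>index_set J0. p * x i + q * y i) t = p * cdf_map \<psi> J0 x t + q * cdf_map \<psi> J0 y t"
  using t summable_term[OF x t] summable_term[OF y t]
  by (simp add: cdf_map_def wn_integral_term level_term_lincomb suminf_add[symmetric] suminf_mult summable_mult)

lemma cdf_map_diff_le:
  assumes x: "x \<in> mspace M0" and y: "y \<in> mspace M0" and t: "t \<in> {0..1}"
  shows "\<bar>cdf_map \<psi> J0 x t - cdf_map \<psi> J0 y t\<bar> \<le> K * mdist M0 x y"
proof -
  let ?d = "mdist M0 x y"
  have d: "\<And>l k. (l, k) \<in> index_set J0 \<Longrightarrow> \<bar>x (l, k) - y (l, k)\<bar> \<le> ?d * w l"
    using mdist_M0_le[OF w x y, of ?d] by auto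
  have tl: "\<bar>level_term x t j - level_term y t j\<bar> \<le> ?d * (w (lev j) * b j)" for j
  proof -
    have "level_term x t j - level_term y t j = level_term (\<lambda>i. x i - y i) t j"
      by (simp add: level_term_def sum_subtractf algebra_simps)
    then show ?thesis using level_term_le[OF t, of j "\<lambda>i. x i - y i" ?d] d lev_in by auto
  qed
  have sum: "summable (\<lambda>j. ?d * (w (lev j) * b j))" by (intro summable_mult summable_wb)
  have "cdf_map \<psi> J0 x t - cdf_map \<psi> J0 y t = (\<Sum>j. level_term x t j - level_term y t j)"
    using t by (simp add: cdf_map_def wn_integral_term suminf_diff summable_term x y)
  also have "\<bar>\<dots>\<bar> \<le> (\<Sum>j. \<bar>level_term x t j - level_term y t j\<bar>)"
    by (intro summable_rabs summable_comparison_test'[OF sum, of 0]) (use tl in auto)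
  also have "\<dots> \<le> (\<Sum>j. ?d * (w (lev j) * b j))"
    by (intro suminf_le tl sum summable_comparison_test'[OF sum, of 0]) (use tl in auto)
  also have "\<dots> = ?d * (\<Sum>j. w (lev j) * b j)" by (rule suminf_mult[OF summable_wb])
  also have "\<dots> \<le> ?d * K" by (intro mult_left_mono) (auto simp: K_def)
  finally show ?thesis by (simp add: mult.commute)
qed

text \<open>The level bounds dominate the series uniformly in \<open>t\<close>, so by Weierstrass'
  test continuity passes from the partial sums to the limit.\<close>

lemma cdf_map_C01:
  assumes x: "x \<in> mspace M0" shows "cdf_map \<psi> J0 x \<in> mspace C01"
proof -
  obtain r where r: "\<And>l k. (l, k) \<in> index_set J0 \<Longrightarrow> \<bar>x (l, k)\<bar> \<le> r * w l" using M0_bound[OF x] by blast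
  then have le: "\<bar>level_term x t j\<bar> \<le> r * (w (lev j) * b j)" if "t \<in> {0..1}" for t j
    using lev_in by (intro level_term_le[OF that]) blast
  have "uniform_limit {0..1} (\<lambda>n t. \<Sum>j<n. level_term x t j) (\<lambda>t. \<Sum>j. level_term x t j) sequentially"
    by (rule Weierstrass_m_test[where M="\<lambda>j. r * (w (lev j) * b j)"])
       (use le in \<open>auto intro!: summable_mult summable_wb\<close>)
  moreover have "continuous_on {0..1} (\<lambda>t. \<Sum>j<n. level_term x t j)" for n
    unfolding level_term_def
    by (intro continuous_intros, simp add: wavelet_coeffs_apply lev_in)
       (intro continuous_on_ip_indicator psi_L2 lev_in, simp)
  ultimately have "continuous_on {0..1} (\<lambda>t. \<Sum>j. level_term x t j)"
    by (intro uniform_limit_theorem[where F=sequentially]) auto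
  then have "continuous_on {0..1} (cdf_map \<psi> J0 x)"
    by (rule continuous_on_eq) (simp add: cdf_map_def wn_integral_term)
  then show ?thesis unfolding mspace_C01 by (simp add: cdf_map_def)
qed

lemma cdf_map_Lipschitz:
  assumes x: "x \<in> mspace M0" and y: "y \<in> mspace M0"
  shows "mdist C01 (cdf_map \<psi> J0 x) (cdf_map \<psi> J0 y) \<le> K * mdist M0 x y"
  using mdist_C01_le[OF cdf_map_C01[OF x] cdf_map_C01[OF y]] cdf_map_diff_le[OF x y] by blast

lemma cdf_map_measurable: "cdf_map \<psi> J0 \<in> measurable (metric_borel M0) (metric_borel C01)"
  by (intro measurable_metric_borel_continuous Lipschitz_continuous_map_intro[where K=K] cdf_map_C01 cdf_map_Lipschitz)

lemma sum_coef_tendsto: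
  assumes f: "f \<in> L2 leb01" and g: "g \<in> L2 leb01"
  shows "(\<lambda>m. \<Sum>i\<in>level_block J0 m. coef g i * coef f i) \<longlonglongrightarrow> ip leb01 g f"
proof -
  have "((\<lambda>i. coef g i * coef f i) has_sum ip leb01 g f) (index_set J0)"
    using Parseval[OF basis g f] by (rule has_sum_cong[THEN iffD1, rotated]) (auto simp: wavelet_coeffs_apply)
  then show ?thesis unfolding has_sum_def by (rule filterlim_compose[OF _ filterlim_level_block])
qed

text \<open>Once a block carries all but \<open>e\<^sup>2\<close> of the squared norm, Bessel's
  inequality for the block enlarged by one index bounds that further coefficient by
  \<open>e\<close>; the weight is at least 1.\<close>

lemma coef_M0:
  assumes f: "f \<in> L2 leb01" shows "coef f \<in> mspace M0"
proof (rule M0_I[OF w])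
  fix e :: real assume e: "e > 0"
  have o: "orthonormal leb01 (index_set J0) (case_prod \<psi>)" using basis by (simp add: orthonormal_basis_def)
  have c: "coef f i = ip leb01 f (case_prod \<psi> i)" if "i \<in> index_set J0" for i
    using that by (cases i) (simp add: wavelet_coeffs_apply)
  have "\<forall>\<^sub>F m in sequentially. ip leb01 f f - e\<^sup>2 < (\<Sum>i\<in>level_block J0 m. coef f i * coef f i)"
    using sum_coef_tendsto[OF f f] e by (intro order_tendstoD(1)) auto
  then obtain m where m: "ip leb01 f f - e\<^sup>2 < (\<Sum>i\<in>level_block J0 m. coef f i * coef f i)"
    by (auto simp: eventually_sequentially)
  have "\<bar>coef f (l, k)\<bar> \<le> e * w l" if i: "(l, k) \<in> index_set J0 - level_block J0 m" for l k
  proof -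
    have B: "insert (l, k) (level_block J0 m) \<subseteq> index_set J0" using i level_block_subset[of J0 m] by auto
    have "(\<Sum>i\<in>insert (l, k) (level_block J0 m). (coef f i)\<^sup>2)
        = (\<Sum>i\<in>insert (l, k) (level_block J0 m). (ip leb01 f (case_prod \<psi> i))\<^sup>2)"
      by (intro sum.cong refl) (simp add: c[OF subsetD[OF B]])
    also have "\<dots> \<le> ip leb01 f f" using finite_level_block by (intro Bessel[OF o _ B f]) simp
    finally have "(coef f (l, k))\<^sup>2 < e\<^sup>2"
      using m i finite_level_block[of J0 m] by (simp add: power2_eq_square)
    then have "\<bar>coef f (l, k)\<bar> < e" using e abs_le_square_iff[of e "coef f (l, k)"] by (auto simp: not_le[symmetric])
    also have "e \<le> e * w l" using e weight_ge_1[OF w, of l] i by (simp add: index_set_def)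
    finally show ?thesis by simp
  qed
  then show "\<exists>m. \<forall>(l, k)\<in>index_set J0 - level_block J0 m. \<bar>coef f (l, k)\<bar> \<le> e * w l" by blast
qed simp

lemma wn_integral_coef:
  assumes f: "f \<in> L2 leb01" and g: "g \<in> L2 leb01"
  shows "wn_integral \<psi> J0 (coef f) g = ip leb01 g f"
  using sum_coef_tendsto[OF f g] unfolding wn_integral_def sum_level_block
  by (intro sums_unique[symmetric]) (simp add: sums_def)

lemma distr_fun_eq:
  assumes f: "f \<in> L2 leb01" and t: "t \<in> {0..1}"
  shows "distr_fun f t = wn_integral \<psi> J0 (coef f) (indicat_real {0..t})"
  using t wn_integral_coef[OF f indicator_L2_leb01[of t]]
  by (simp add: distr_fun_def set_lebesgue_integral_def ip_indicator)

text \<open>The sequence \<open>c\<close> is only required to lie in the multiscale space, so that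
  an observation can serve as centring as well as an estimator.\<close>

lemma cdf_map_rescaled:
  assumes f: "f \<in> L2 leb01" and c: "c \<in> mspace M0" and t: "t \<in> {0..1}"
  shows "cdf_map \<psi> J0 (\<lambda>i\<in>index_set J0. s * (coef f i - c i)) t
    = s * (distr_fun f t - wn_integral \<psi> J0 c (indicat_real {0..t}))"
  using cdf_map_lincomb[OF coef_M0[OF f] c t, of s "- s"] t
  by (simp add: distr_fun_eq[OF f t] cdf_map_def algebra_simps)

end

section \<open>Identification of the limit law\<close>

abbreviation path :: "(real \<Rightarrow> 'q \<Rightarrow> real) \<Rightarrow> 'q \<Rightarrow> real \<Rightarrow> real" where
  "path G \<equiv> \<lambda>\<omega>. \<lambda>t\<in>{0..1}. G t \<omega>"

section \<open>Characteristic functions of the limits\<close>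

lemma iexp_normal_law:
  assumes v: "0 \<le> v" shows "(CLINT x|normal_law 0 v. iexp x) = exp (- v / 2)"
proof (cases "v = 0")
  case True
  then show ?thesis by (simp add: normal_law_def integral_return)
next
  case False
  define \<sigma> where "\<sigma> = sqrt v"
  have \<sigma>: "\<sigma> > 0" and \<sigma>2: "\<sigma>\<^sup>2 = v" using v False by (auto simp: \<sigma>_def)
  have scale: "\<sigma> * normal_density 0 \<sigma> (\<sigma> * x) = std_normal_density x" for x
    using \<sigma> by (simp add: normal_density_def real_sqrt_mult power_mult_distrib)
  have "(CLINT x|normal_law 0 v. iexp x) = (CLBINT x. normal_density 0 \<sigma> x *\<^sub>R iexp x)"
    using False by (simp add: normal_law_def \<sigma>_def[symmetric] integral_density)
  also have "\<dots> = \<bar>\<sigma>\<bar> *\<^sub>R (CLBINT x. normal_density 0 \<sigma> (0 + \<sigma> * x) *\<^sub>R iexp (0 + \<sigma> * x))"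
    using \<sigma> by (intro lborel_integral_real_affine) auto
  also have "\<dots> = (CLBINT x. \<bar>\<sigma>\<bar> *\<^sub>R (normal_density 0 \<sigma> (0 + \<sigma> * x) *\<^sub>R iexp (0 + \<sigma> * x)))"
    by (rule integral_scaleR_right[symmetric])
  also have "\<dots> = (CLBINT x. std_normal_density x *\<^sub>R iexp (\<sigma> * x))"
    using \<sigma> by (simp add: scale[symmetric] scaleR_scaleR[symmetric] del: scaleR_scaleR)
  also have "\<dots> = char std_normal_distribution \<sigma>"
    by (simp add: char_def integral_density)
  also have "\<dots> = exp (- v / 2)" using \<sigma>2 by (simp add: char_std_normal_distribution)
  finally show ?thesis .
qed

text \<open>Frequency 1 suffices, as scalars can be absorbed in \<open>a\<close>. The kernel
  \<open>k\<close> is an arbitrary function here, so the sign of the quadratic form has to be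
  supplied.\<close>

lemma gaussian_process_iexp:
  assumes G: "centred_gaussian_process Q T G k" and J: "finite J" "J \<subseteq> T"
    and v: "0 \<le> (\<Sum>s\<in>J. \<Sum>t\<in>J. a s * a t * k s t)"
  shows "(CLINT \<omega>|Q. iexp (\<Sum>t\<in>J. a t * G t \<omega>)) = exp (- (\<Sum>s\<in>J. \<Sum>t\<in>J. a s * a t * k s t) / 2)"
proof -
  have m: "(\<lambda>\<omega>. \<Sum>t\<in>J. a t * G t \<omega>) \<in> borel_measurable Q"
    using G J unfolding centred_gaussian_process_def by (intro borel_measurable_sum borel_measurable_times) auto
  have "(CLINT \<omega>|Q. iexp (\<Sum>t\<in>J. a t * G t \<omega>)) = (CLINT x|distr Q borel (\<lambda>\<omega>. \<Sum>t\<in>J. a t * G t \<omega>). iexp x)"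
    by (rule integral_distr[OF m, symmetric]) measurable
  also have "distr Q borel (\<lambda>\<omega>. \<Sum>t\<in>J. a t * G t \<omega>) = normal_law 0 (\<Sum>s\<in>J. \<Sum>t\<in>J. a s * a t * k s t)"
    using G J unfolding centred_gaussian_process_def by blast
  finally show ?thesis using iexp_normal_law[OF v] by simp
qed

lemma ip_sum_sum:
  assumes "\<And>i. i \<in> J \<Longrightarrow> f i \<in> L2 M"
  shows "ip M (\<lambda>x. \<Sum>i\<in>J. c i * f i x) (\<lambda>x. \<Sum>i\<in>J. c i * f i x) = (\<Sum>i\<in>J. \<Sum>j\<in>J. c i * c j * ip M (f i) (f j))"
proof -
  let ?g = "\<lambda>x. \<Sum>i\<in>J. c i * f i x"
  have "ip M ?g ?g = (\<Sum>i\<in>J. c i * ip M (f i) ?g)"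
    using assms by (intro ip_sum_left L2_sum)
  also have "\<dots> = (\<Sum>i\<in>J. c i * (\<Sum>j\<in>J. c j * ip M (f j) (f i)))"
    using assms by (subst ip_commute) (intro sum.cong refl arg_cong2[where f="(*)"] ip_sum_left, auto)
  also have "\<dots> = (\<Sum>i\<in>J. \<Sum>j\<in>J. c i * c j * ip M (f i) (f j))"
    by (simp add: sum_distrib_left mult.assoc ip_commute[of M "f _" "f _"])
  finally show ?thesis .
qed

text \<open>Independence factorises the characteristic function into one-dimensional normal ones,
  whose exponents add up.\<close>

lemma white_noise_iexp:
  assumes N: "white_noise_limit J0 w N" and K: "finite K" "K \<subseteq> index_set J0"
  shows "(CLINT x|N. iexp (\<Sum>i\<in>K. c i * x i)) = exp (- (\<Sum>i\<in>K. (c i)\<^sup>2) / 2)"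
proof -
  interpret N: prob_space N using N by (simp add: white_noise_limit_def)
  have ind: "N.indep_vars (\<lambda>_. borel) (\<lambda>i x. x i) (index_set J0)"
    and d: "\<And>i. i \<in> index_set J0 \<Longrightarrow> distributed N lborel (\<lambda>x. x i) (\<lambda>u. ennreal (std_normal_density u))"
    using N by (auto simp: white_noise_limit_def)
  have indK: "N.indep_vars (\<lambda>_. borel) (\<lambda>i x. c i * x i) K"
    using N.indep_vars_compose2[OF N.indep_vars_subset[OF ind K(2)], of "\<lambda>i y. c i * y" "\<lambda>_. borel"] by simp
  have m: "(\<lambda>x. x i) \<in> borel_measurable N" if "i \<in> K" for i
    using N.indep_vars_def K(2) ind that by (auto simp: N.indep_vars_def)
  have ch: "char (distr N borel (\<lambda>x. c i * x i)) 1 = exp (- (c i)\<^sup>2 / 2)" if i: "i \<in> K" for i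
  proof -
    have "char (distr N borel (\<lambda>x. c i * x i)) 1 = (CLINT x|N. iexp (c i * x i))"
      unfolding char_def using m[OF i] by (subst integral_distr) auto
    also have "\<dots> = (CLINT u|distr N lborel (\<lambda>x. x i). iexp (c i * u))"
      using m[OF i] by (subst integral_distr) auto
    also have "distr N lborel (\<lambda>x. x i) = density lborel (\<lambda>u. ennreal (std_normal_density u))"
      using d[of i] i K(2) by (auto simp: distributed_def)
    also have "(CLINT u|density lborel (\<lambda>u. ennreal (std_normal_density u)). iexp (c i * u)) = char std_normal_distribution (c i)"
      by (simp add: char_def)
    finally show ?thesis by (simp add: char_std_normal_distribution)
  qed
  have "(CLINT x|N. iexp (\<Sum>i\<in>K. c i * x i)) = char (distr N borel (\<lambda>x. \<Sum>i\<in>K. c i * x i)) 1"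
    unfolding char_def using m by (subst integral_distr) auto
  also have "\<dots> = (\<Prod>i\<in>K. char (distr N borel (\<lambda>x. c i * x i)) 1)"
    by (rule N.char_distr_sum[OF indK])
  also have "\<dots> = (\<Prod>i\<in>K. complex_of_real (exp (- (c i)\<^sup>2 / 2)))" using ch by (intro prod.cong) auto
  also have "\<dots> = exp (- (\<Sum>i\<in>K. (c i)\<^sup>2) / 2)"
    using K by (simp add: exp_sum[symmetric] sum_negf sum_divide_distrib flip: of_real_prod)
  finally show ?thesis .
qed

context summable_primitives
begin

abbreviation synth :: "(int \<times> nat) set \<Rightarrow> (int \<times> nat \<Rightarrow> real) \<Rightarrow> real \<Rightarrow> real" where
  "synth F c \<equiv> \<lambda>y. \<Sum>i\<in>F. c i * case_prod \<psi> i y"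

abbreviation step :: "real set \<Rightarrow> (real \<Rightarrow> real) \<Rightarrow> real \<Rightarrow> real" where
  "step J a \<equiv> \<lambda>y. \<Sum>t\<in>J. a t * indicator {0..t} y"

abbreviation law_agrees :: "(int \<times> nat \<Rightarrow> real) measure \<Rightarrow> 'q measure \<Rightarrow> (real \<Rightarrow> 'q \<Rightarrow> real) \<Rightarrow> bool" where
  "law_agrees N Q G \<equiv> path G \<in> measurable Q (metric_borel C01) \<and>
     distr N (metric_borel C01) (cdf_map \<psi> J0) = distr Q (metric_borel C01) (path G)"

text \<open>\<open>V g\<close> stands for the variance that the limit assigns to the integral of
  \<open>g\<close>. Combinations of path values are limits of finite combinations of coordinates,
  whose variances converge by \<open>V\<close>. This identifies all characteristic functions, hence
  the distributions at finitely many rational times and the law of the path.\<close>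

lemma cdf_map_law:
  fixes V :: "(real \<Rightarrow> real) \<Rightarrow> real"
  assumes N: "prob_space N" "sets N = sets (metric_borel M0)"
    and G: "centred_gaussian_process Q {0..1} G k"
    and Gc: "\<And>\<omega>. \<omega> \<in> space Q \<Longrightarrow> continuous_on {0..1} (\<lambda>t. G t \<omega>)"
    and NV: "\<And>F c. finite F \<Longrightarrow> F \<subseteq> index_set J0 \<Longrightarrow>
      (CLINT x|N. iexp (\<Sum>i\<in>F. c i * x i)) = exp (- V (synth F c) / 2)"
    and V0: "\<And>g. 0 \<le> V g"
    and Vk: "\<And>J a. finite J \<Longrightarrow> J \<subseteq> {0..1} \<Longrightarrow> V (step J a) = (\<Sum>s\<in>J. \<Sum>t\<in>J. a s * a t * k s t)"
    and V: "\<And>g. g \<in> L2 leb01 \<Longrightarrow>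
      (\<lambda>m. V (synth (level_block J0 m) (coef g))) \<longlonglongrightarrow> V g"
  shows "law_agrees N Q G"
proof -
  interpret N: prob_space N by fact
  interpret Q: prob_space Q using G by (simp add: centred_gaussian_process_def)
  have Gm: "\<And>t. t \<in> {0..1} \<Longrightarrow> G t \<in> borel_measurable Q"
    using G by (simp add: centred_gaussian_process_def)
  have GV: "(CLINT \<omega>|Q. iexp (\<Sum>t\<in>J. a t * G t \<omega>)) = exp (- V (step J a) / 2)" if "finite J" "J \<subseteq> {0..1}" for J a
    using gaussian_process_iexp[OF G that, of a] V0[of "step J a"] by (simp only: Vk[OF that])
  have Gm': "path G \<in> measurable Q (metric_borel C01)"
  proof (rule C01.measurable_coordinates)
    show "(\<lambda>t\<in>{0..1}. G t \<omega>) \<in> mspace C01" if "\<omega> \<in> space Q" for \<omega>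
      unfolding mspace_C01 using continuous_on_eq[OF Gc[OF that]] by auto
  qed (use Gm in auto)
  have Lm: "cdf_map \<psi> J0 \<in> measurable N (metric_borel C01)"
    using cdf_map_measurable N(2) by (simp cong: measurable_cong_sets)
  have spN: "space N = mspace M0" using sets_eq_imp_space_eq[OF N(2)] by simp
  have xm: "(\<lambda>x. x i) \<in> borel_measurable N" if "i \<in> index_set J0" for i
    using M0_coordinate_measurable[OF w that] N(2) by (simp cong: measurable_cong_sets)
  have key: "(CLINT x|N. iexp (\<Sum>t\<in>J. a t * cdf_map \<psi> J0 x t)) = (CLINT \<omega>|Q. iexp (\<Sum>t\<in>J. a t * G t \<omega>))"
    if J: "finite J" "J \<subseteq> {0..1}" for J a
  proof -
    \<comment> \<open>Combining path values at the times in \<open>J\<close> amounts to integrating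
      this step function; its wavelet coefficients are the weights of the coordinates.\<close>
    define g where "g y = (\<Sum>t\<in>J. a t * indicat_real {0..t} y)" for y
    have gL: "g \<in> L2 leb01" unfolding g_def[abs_def] using J by (intro L2_sum indicator_L2_leb01) auto
    have cg: "coef g i = (\<Sum>t\<in>J. a t * coef (indicator {0..t}) i)" if i: "i \<in> index_set J0" for i
    proof -
      obtain l k where lk: "i = (l, k)" by (cases i)
      have "ip leb01 g (\<psi> l k) = (\<Sum>t\<in>J. a t * ip leb01 (indicator {0..t}) (\<psi> l k))"
        unfolding g_def[abs_def] using i lk J by (intro ip_sum_left psi_L2 indicator_L2_leb01) auto
      then show ?thesis using i lk by (simp add: wavelet_coeffs_apply)
    qed
    have Lsum: "(\<lambda>m. \<Sum>i\<in>level_block J0 m. coef g i * x i) \<longlonglongrightarrow> (\<Sum>t\<in>J. a t * cdf_map \<psi> J0 x t)" if x: "x \<in> mspace M0" for x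
    proof -
      have "(\<lambda>m. \<Sum>t\<in>J. a t * (\<Sum>j<m. level_term x t j)) \<longlonglongrightarrow> (\<Sum>t\<in>J. a t * cdf_map \<psi> J0 x t)"
      proof (intro tendsto_sum tendsto_mult tendsto_const)
        fix t assume "t \<in> J"
        then have t: "t \<in> {0..1}" using J by auto
        show "(\<lambda>m. \<Sum>j<m. level_term x t j) \<longlonglongrightarrow> cdf_map \<psi> J0 x t"
          using summable_LIMSEQ[OF summable_term[OF x t]] t by (simp add: cdf_map_def wn_integral_term)
      qed
      moreover have "(\<Sum>t\<in>J. a t * (\<Sum>j<m. level_term x t j)) = (\<Sum>i\<in>level_block J0 m. coef g i * x i)" for m
      proof -
        have "(\<Sum>i\<in>level_block J0 m. coef g i * x i) = (\<Sum>i\<in>level_block J0 m. \<Sum>t\<in>J. a t * (coef (indicator {0..t}) i * x i))"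
          using level_block_subset by (intro sum.cong) (auto simp: cg sum_distrib_right mult.assoc subset_iff)
        also have "\<dots> = (\<Sum>t\<in>J. a t * (\<Sum>i\<in>level_block J0 m. coef (indicator {0..t}) i * x i))"
          by (subst sum.swap) (simp add: sum_distrib_left)
        also have "(\<lambda>t. \<Sum>i\<in>level_block J0 m. coef (indicator {0..t}) i * x i) = (\<lambda>t. \<Sum>j<m. level_term x t j)"
          by (simp add: sum_level_block level_term_def Let_def)
        finally show ?thesis by simp
      qed
      ultimately show ?thesis by (simp only:)
    qed
    \<comment> \<open>Pointwise convergence suffices, the exponentials having modulus 1.\<close>
    have "(\<lambda>m. CLINT x|N. iexp (\<Sum>i\<in>level_block J0 m. coef g i * x i)) \<longlonglongrightarrow> (CLINT x|N. iexp (\<Sum>t\<in>J. a t * cdf_map \<psi> J0 x t))"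
    proof (rule integral_dominated_convergence[where w="\<lambda>_. 1"])
      have "(\<lambda>x. cdf_map \<psi> J0 x t) \<in> borel_measurable N" if "t \<in> J" for t
        using measurable_compose[OF Lm borel_measurable_C01_eval, of t] J that by auto
      then have "(\<lambda>x. \<Sum>t\<in>J. a t * cdf_map \<psi> J0 x t) \<in> borel_measurable N" by (intro borel_measurable_sum borel_measurable_times) auto
      then show "(\<lambda>x. iexp (\<Sum>t\<in>J. a t * cdf_map \<psi> J0 x t)) \<in> borel_measurable N" by measurable
      have "(\<lambda>x. \<Sum>i\<in>level_block J0 m. coef g i * x i) \<in> borel_measurable N" for m
        using level_block_subset by (intro borel_measurable_sum borel_measurable_times xm) auto
      then show "(\<lambda>x. iexp (\<Sum>i\<in>level_block J0 m. coef g i * x i)) \<in> borel_measurable N" for m by measurable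
      show "AE x in N. (\<lambda>m. iexp (\<Sum>i\<in>level_block J0 m. coef g i * x i)) \<longlonglongrightarrow> iexp (\<Sum>t\<in>J. a t * cdf_map \<psi> J0 x t)"
        using Lsum spN by (intro AE_I2 isCont_tendsto_compose[OF isCont_iexp]) auto
    qed (simp_all del: of_real_sum)
    moreover have "(\<lambda>m. CLINT x|N. iexp (\<Sum>i\<in>level_block J0 m. coef g i * x i)) \<longlonglongrightarrow> exp (- V g / 2)"
    proof -
      have "(\<lambda>m. complex_of_real (exp (- V (synth (level_block J0 m) (coef g)) / 2))) \<longlonglongrightarrow> complex_of_real (exp (- V g / 2))"
        by (intro tendsto_intros V gL) auto
      then show ?thesis by (simp only: NV[OF finite_level_block level_block_subset])
    qed
    ultimately have "(CLINT x|N. iexp (\<Sum>t\<in>J. a t * cdf_map \<psi> J0 x t)) = exp (- V g / 2)"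
      by (rule LIMSEQ_unique)
    then show ?thesis unfolding GV[OF J] g_def[abs_def] .
  qed
  let ?\<mu> = "distr N (metric_borel C01) (cdf_map \<psi> J0)"
  let ?\<nu> = "distr Q (metric_borel C01) (path G)"
  have p\<mu>: "prob_space ?\<mu>" by (rule N.prob_space_distr[OF Lm])
  have p\<nu>: "prob_space ?\<nu>" by (rule Q.prob_space_distr[OF Gm'])
  have "?\<mu> = ?\<nu>"
  proof (rule C01.measure_eqI_coordinates)
    show "(\<lambda>f. f t) \<in> borel_measurable (metric_borel C01)" if "t \<in> \<rat> \<inter> {0..1}" for t
      using that by (intro borel_measurable_C01_eval) auto
    fix J :: "real set" and B :: "real \<Rightarrow> real set" assume J: "finite J" "J \<subseteq> \<rat> \<inter> {0..1}" and B: "\<And>t. t \<in> J \<Longrightarrow> B t \<in> sets borel"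
    have ev: "(\<lambda>f. f t) \<in> borel_measurable (metric_borel C01)" if "t \<in> J" for t
      using that J by (intro borel_measurable_C01_eval) auto
    have lin: "(\<lambda>f. iexp (\<Sum>t\<in>J. a t * f t)) \<in> borel_measurable (metric_borel C01)" for a
    proof -
      have "(\<lambda>f. \<Sum>t\<in>J. a t * f t) \<in> borel_measurable (metric_borel C01)"
        by (intro borel_measurable_sum borel_measurable_times ev) auto
      then show ?thesis by measurable
    qed
    have "measure ?\<mu> {f \<in> space ?\<mu>. \<forall>t\<in>J. f t \<in> B t} = measure ?\<nu> {f \<in> space ?\<nu>. \<forall>t\<in>J. f t \<in> B t}"
    proof (rule char_unique_rectangles[OF J(1)])
      fix a
      have "(CLINT f|?\<mu>. iexp (\<Sum>t\<in>J. a t * f t)) = (CLINT x|N. iexp (\<Sum>t\<in>J. a t * cdf_map \<psi> J0 x t))"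
        by (rule integral_distr[OF Lm lin])
      also have "\<dots> = (CLINT \<omega>|Q. iexp (\<Sum>t\<in>J. a t * G t \<omega>))" using J by (intro key) auto
      also have "\<dots> = (CLINT \<omega>|Q. iexp (\<Sum>t\<in>J. a t * (\<lambda>t\<in>{0..1}. G t \<omega>) t))"
      proof -
        have "(\<Sum>t\<in>J. a t * (\<lambda>t\<in>{0..1}. G t \<omega>) t) = (\<Sum>t\<in>J. a t * G t \<omega>)" for \<omega>
          using J by (intro sum.cong) auto
        then show ?thesis by simp
      qed
      also have "\<dots> = (CLINT f|?\<nu>. iexp (\<Sum>t\<in>J. a t * f t))"
        by (rule integral_distr[OF Gm' lin, symmetric])
      finally show "(CLINT f|?\<mu>. iexp (\<Sum>t\<in>J. a t * f t)) = (CLINT f|?\<nu>. iexp (\<Sum>t\<in>J. a t * f t))" .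
    qed (use ev B p\<mu> p\<nu> in \<open>auto intro: prob_space.finite_measure\<close>)
    then show "measure ?\<mu> {f \<in> mspace C01. \<forall>t\<in>J. f t \<in> B t} = measure ?\<nu> {f \<in> mspace C01. \<forall>t\<in>J. f t \<in> B t}"
      by simp
  qed (use p\<mu> p\<nu> in \<open>auto intro: prob_space.finite_measure\<close>)
  then show ?thesis using Gm' by simp
qed

lemma residual_norm:
  assumes g: "g \<in> L2 leb01"
  defines "h \<equiv> \<lambda>m y. \<Sum>i\<in>level_block J0 m. coef g i * case_prod \<psi> i y"
  shows "(\<lambda>m. \<integral>y. (g y - h m y)\<^sup>2 \<partial>leb01) \<longlonglongrightarrow> 0"
    and "(\<lambda>m. ip leb01 (h m) (h m)) \<longlonglongrightarrow> ip leb01 g g"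
    and "h m \<in> L2 leb01"
proof -
  have o: "orthonormal leb01 (index_set J0) (case_prod \<psi>)" using basis by (simp add: orthonormal_basis_def)
  have c: "coef g i = ip leb01 g (case_prod \<psi> i)" if "i \<in> index_set J0" for i
    using that by (cases i) (simp add: wavelet_coeffs_apply)
  have cl: "coef g i = ip leb01 g (case_prod \<psi> i)" if "i \<in> level_block J0 m" for i m
    using c[OF subsetD[OF level_block_subset that]] .
  have L: "case_prod \<psi> i \<in> L2 leb01" if "i \<in> level_block J0 m" for i m
    using level_block_subset[of J0 m] that o by (auto simp: orthonormal_def)
  have hL: "h m \<in> L2 leb01" for m unfolding h_def using L by (rule L2_sum)
  then show "h m \<in> L2 leb01" .
  have s: "(\<lambda>m. \<Sum>i\<in>level_block J0 m. (ip leb01 g (case_prod \<psi> i))\<^sup>2) \<longlonglongrightarrow> ip leb01 g g"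
    using Parseval_self[OF basis g] unfolding has_sum_def by (rule filterlim_compose[OF _ filterlim_level_block])
  have "(\<integral>y. (g y - h m y)\<^sup>2 \<partial>leb01) = ip leb01 g g - (\<Sum>i\<in>level_block J0 m. (ip leb01 g (case_prod \<psi> i))\<^sup>2)" for m
    unfolding h_def orthonormal_dist_sq[OF o finite_level_block level_block_subset g]
    using cl[of _ m] by (simp cong: sum.cong)
  then show lim: "(\<lambda>m. \<integral>y. (g y - h m y)\<^sup>2 \<partial>leb01) \<longlonglongrightarrow> 0"
    using tendsto_diff[OF tendsto_const s, of "ip leb01 g g"] by simp
  show "(\<lambda>m. ip leb01 (h m) (h m)) \<longlonglongrightarrow> ip leb01 g g" by (rule ip_tendsto[OF g hL lim])
qed

text \<open>Here \<open>V\<close> is the squared norm. Orthonormality yields the variances of white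
  noise, and the inner products of the indicators yield the kernel \<open>min s t\<close>.\<close>

lemma cdf_map_white_noise:
  assumes N: "white_noise_limit J0 w N" and G: "brownian_motion Q G"
  shows "law_agrees N Q G"
proof -
  have gp: "centred_gaussian_process Q {0..1} G (\<lambda>s t. min s t)" and Gc: "\<And>\<omega>. \<omega> \<in> space Q \<Longrightarrow> continuous_on {0..1} (\<lambda>t. G t \<omega>)"
    using G by (auto simp: brownian_motion_def)
  have pN: "prob_space N" and sN: "sets N = sets (metric_borel M0)" using N by (auto simp: white_noise_limit_def)
  have o: "orthonormal leb01 (index_set J0) (case_prod \<psi>)" using basis by (simp add: orthonormal_basis_def)
  have NV: "(CLINT x|N. iexp (\<Sum>i\<in>F. c i * x i))
      = exp (- ip leb01 (synth F c) (synth F c) / 2)"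
    if F: "finite F" "F \<subseteq> index_set J0" for F c
  proof -
    have "ip leb01 (synth F c) (synth F c)
        = (\<Sum>i\<in>F. \<Sum>j\<in>F. c i * c j * ip leb01 (case_prod \<psi> i) (case_prod \<psi> j))"
      using F o by (intro ip_sum_sum) (auto simp: orthonormal_def)
    also have "\<dots> = (\<Sum>i\<in>F. \<Sum>j\<in>F. if i = j then (c i)\<^sup>2 else 0)"
    proof (intro sum.cong refl)
      fix i j assume "i \<in> F" "j \<in> F"
      then have "ip leb01 (case_prod \<psi> i) (case_prod \<psi> j) = (if i = j then 1 else 0)"
        using o F unfolding orthonormal_def by blast
      then show "c i * c j * ip leb01 (case_prod \<psi> i) (case_prod \<psi> j) = (if i = j then (c i)\<^sup>2 else 0)"
        by (simp add: power2_eq_square)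
    qed
    also have "\<dots> = (\<Sum>i\<in>F. (c i)\<^sup>2)" using F by simp
    finally show ?thesis using white_noise_iexp[OF N F] by simp
  qed
  have Vk: "ip leb01 (step J a) (step J a) = (\<Sum>s\<in>J. \<Sum>t\<in>J. a s * a t * min s t)" if J: "J \<subseteq> {0..1}" for J a
  proof -
    have "ip leb01 (step J a) (step J a)
      = (\<Sum>s\<in>J. \<Sum>t\<in>J. a s * a t * ip leb01 (indicator {0..s}) (indicator {0..t}))"
      using J by (intro ip_sum_sum indicator_L2_leb01) auto
    also have "\<dots> = (\<Sum>s\<in>J. \<Sum>t\<in>J. a s * a t * min s t)"
    proof (intro sum.cong refl arg_cong2[where f="(*)"])
      fix s t assume "s \<in> J" "t \<in> J"
      then have st: "0 \<le> s" "s \<le> 1" "0 \<le> t" "t \<le> 1" using J by auto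
      have "(\<lambda>x. indicat_real {0..s} x * indicator {0..t} x) = indicator {0..min s t}"
        by (auto simp: fun_eq_iff split: split_indicator)
      then show "ip leb01 (indicator {0..s}) (indicator {0..t}) = min s t"
        using st by (simp add: ip_indicator)
    qed
    finally show ?thesis .
  qed
  show ?thesis
    by (rule cdf_map_law[where V="\<lambda>g. ip leb01 g g", OF pN sN gp Gc NV ip_self_nonneg Vk residual_norm(2)])
qed

end

section \<open>Variances under a sampling density\<close>

lemma covariance_tendsto:
  assumes ps: "prob_space M" and g: "g \<in> L2 M" and h: "\<And>m. h m \<in> L2 M"
    and lim: "(\<lambda>m. \<integral>x. (g x - h m x)\<^sup>2 \<partial>M) \<longlonglongrightarrow> 0"
  shows "(\<lambda>m. covariance M (h m) (h m)) \<longlonglongrightarrow> covariance M g g"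
proof -
  interpret prob_space M by (rule ps)
  define ce where "ce f x = f x - expectation f" for f :: "real \<Rightarrow> real" and x
  have cL: "(\<lambda>x. c) \<in> L2 M" for c :: real by (simp add: L2_def)
  have ceL: "ce f \<in> L2 M" if "f \<in> L2 M" for f
    unfolding ce_def[abs_def] using that cL by (rule L2_diff)
  have int: "integrable M f" if "f \<in> L2 M" for f
    using L2_mult_integrable[OF that cL[of 1]] by simp
  \<comment> \<open>Subtracting the mean is an orthogonal projection and does not increase
    distances.\<close>
  have le: "(\<integral>x. (ce g x - ce (h m) x)\<^sup>2 \<partial>M) \<le> (\<integral>x. (g x - h m x)\<^sup>2 \<partial>M)" for m
  proof -
    define d where "d x = g x - h m x" for x
    have dL: "d \<in> L2 M" unfolding d_def[abs_def] using g h by (rule L2_diff)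
    have "expectation d = expectation g - expectation (h m)"
      unfolding d_def[abs_def] using int[OF g] int[OF h] by simp
    then have "ce g x - ce (h m) x = d x - expectation d" for x by (simp add: ce_def d_def)
    then have "(\<integral>x. (ce g x - ce (h m) x)\<^sup>2 \<partial>M) = ip M (\<lambda>x. d x - expectation d) (\<lambda>x. d x - expectation d)"
      by (simp add: ip_def power2_eq_square)
    also have "\<dots> = ip M d d - (expectation d)\<^sup>2"
      unfolding ip_diff_diff[OF dL cL] by (simp add: ip_def power2_eq_square prob_space)
    finally show ?thesis by (simp add: ip_def d_def power2_eq_square)
  qed
  have "(\<lambda>m. ip M (ce (h m)) (ce (h m))) \<longlonglongrightarrow> ip M (ce g) (ce g)"
    by (intro ip_tendsto ceL g h tendsto_sandwich[OF _ _ tendsto_const lim]) (auto simp: le)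
  then show ?thesis by (simp add: covariance_def ip_def ce_def)
qed

lemma covariance_sum_sum:
  assumes ps: "prob_space M" and f: "\<And>i. i \<in> J \<Longrightarrow> f i \<in> L2 M"
  shows "covariance M (\<lambda>x. \<Sum>i\<in>J. c i * f i x) (\<lambda>x. \<Sum>i\<in>J. c i * f i x) = (\<Sum>i\<in>J. \<Sum>j\<in>J. c i * c j * covariance M (f i) (f j))"
proof -
  interpret prob_space M by (rule ps)
  have cL: "(\<lambda>x. c) \<in> L2 M" for c :: real by (simp add: L2_def)
  have int: "integrable M (f i)" if "i \<in> J" for i
    using L2_mult_integrable[OF f[OF that] cL[of 1]] by simp
  have "(\<Sum>i\<in>J. c i * f i x) - expectation (\<lambda>x. \<Sum>i\<in>J. c i * f i x) = (\<Sum>i\<in>J. c i * (f i x - expectation (f i)))" for x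
    using int by (simp add: right_diff_distrib sum_subtractf)
  then have "covariance M (\<lambda>x. \<Sum>i\<in>J. c i * f i x) (\<lambda>x. \<Sum>i\<in>J. c i * f i x)
      = ip M (\<lambda>x. \<Sum>i\<in>J. c i * (f i x - expectation (f i))) (\<lambda>x. \<Sum>i\<in>J. c i * (f i x - expectation (f i)))"
    by (simp add: covariance_def ip_def)
  also have "\<dots> = (\<Sum>i\<in>J. \<Sum>j\<in>J. c i * c j * ip M (\<lambda>x. f i x - expectation (f i)) (\<lambda>x. f j x - expectation (f j)))"
    using f cL by (intro ip_sum_sum L2_diff)
  finally show ?thesis by (simp add: covariance_def ip_def)
qed

lemma covariance_self_nonneg: "0 \<le> covariance M g g"
  by (simp add: covariance_def)

lemma covariance_eq:
  assumes ps: "prob_space M" and gh: "g \<in> L2 M" "h \<in> L2 M"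
  shows "covariance M g h = ip M g h - (\<integral>x. g x \<partial>M) * (\<integral>x. h x \<partial>M)"
proof -
  interpret prob_space M by (rule ps)
  have cL: "(\<lambda>x. c) \<in> L2 M" for c :: real by (simp add: L2_def)
  have int: "integrable M f" if "f \<in> L2 M" for f
    using L2_mult_integrable[OF that cL[of 1]] by simp
  have "covariance M g h = (\<integral>x. g x * h x - expectation h * g x - expectation g * h x + expectation g * expectation h \<partial>M)"
    unfolding covariance_def by (intro Bochner_Integration.integral_cong) (auto simp: algebra_simps)
  then show ?thesis using L2_mult_integrable[OF gh] int[OF gh(1)] int[OF gh(2)]
    by (simp add: ip_def prob_space)
qed

context
  fixes f0 :: "real \<Rightarrow> real"
  assumes f0: "bounded_density f0"
begin

lemma f0_measurable: "f0 \<in> borel_measurable leb01" and f0_nonneg: "AE x in leb01. 0 \<le> f0 x"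
  using f0 by (auto simp: bounded_density_def probability_density_def)

lemma integral_density_measure:
  "g \<in> borel_measurable leb01 \<Longrightarrow> (\<integral>x. g x \<partial>density_measure f0) = (\<integral>x. f0 x * (g x :: real) \<partial>leb01)"
  unfolding density_measure_def using f0_measurable f0_nonneg by (subst integral_density) auto

lemma integrable_density_measure:
  "g \<in> borel_measurable leb01 \<Longrightarrow> integrable (density_measure f0) g \<longleftrightarrow> integrable leb01 (\<lambda>x. f0 x * (g x :: real))"
  unfolding density_measure_def using f0_measurable f0_nonneg by (subst integrable_density) auto

lemma prob_space_density_measure: "prob_space (density_measure f0)"
proof (rule prob_spaceI)
  have [measurable]: "f0 \<in> borel_measurable leb01" by (rule f0_measurable)
  have "emeasure (density_measure f0) (space (density_measure f0)) = (\<integral>\<^sup>+x. ennreal (f0 x) \<partial>leb01)"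
    unfolding density_measure_def by (subst emeasure_density) (auto intro!: nn_integral_cong)
  also have "\<dots> = ennreal (\<integral>x. f0 x \<partial>leb01)"
    using f0 by (intro nn_integral_eq_integral) (auto simp: bounded_density_def probability_density_def)
  finally show "emeasure (density_measure f0) (space (density_measure f0)) = 1"
    using f0 by (simp add: bounded_density_def probability_density_def)
qed

text \<open>Boundedness of the density enters here: wavelet expansions converging in mean square for
  Lebesgue measure then converge for the sampling distribution too.\<close>

lemma density_measure_L2:
  "\<exists>C. \<forall>g\<in>L2 leb01. g \<in> L2 (density_measure f0) \<and> (\<integral>x. (g x)\<^sup>2 \<partial>density_measure f0) \<le> C * (\<integral>x. (g x)\<^sup>2 \<partial>leb01)"
proof -
  obtain C where C: "AE x in leb01. f0 x \<le> C" using f0 by (auto simp: bounded_density_def)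
  show ?thesis
  proof (intro exI[of _ C] ballI)
    fix g assume g: "g \<in> L2 leb01"
    then have gm[measurable]: "g \<in> borel_measurable leb01" and gi: "integrable leb01 (\<lambda>x. (g x)\<^sup>2)" by (auto simp: L2_def)
    have [measurable]: "f0 \<in> borel_measurable leb01" by (rule f0_measurable)
    have le: "AE x in leb01. f0 x * (g x)\<^sup>2 \<le> C * (g x)\<^sup>2 \<and> 0 \<le> f0 x * (g x)\<^sup>2"
      using C f0_nonneg by eventually_elim (auto intro: mult_right_mono)
    have Ci: "integrable leb01 (\<lambda>x. C * (g x)\<^sup>2)" using gi by simp
    have "AE x in leb01. norm (f0 x * (g x)\<^sup>2) \<le> norm (C * (g x)\<^sup>2)" "AE x in leb01. f0 x * (g x)\<^sup>2 \<le> C * (g x)\<^sup>2"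
      using le by (eventually_elim, simp)+
    note le = this
    have i: "integrable leb01 (\<lambda>x. f0 x * (g x)\<^sup>2)"
      by (rule Bochner_Integration.integrable_bound[OF Ci _ le(1)]) simp
    have "g \<in> L2 (density_measure f0)"
      using i by (auto simp: L2_def integrable_density_measure) (simp add: density_measure_def)
    moreover have "(\<integral>x. f0 x * (g x)\<^sup>2 \<partial>leb01) \<le> (\<integral>x. C * (g x)\<^sup>2 \<partial>leb01)"
      using i Ci le(2) by (rule integral_mono_AE)
    ultimately show "g \<in> L2 (density_measure f0) \<and> (\<integral>x. (g x)\<^sup>2 \<partial>density_measure f0) \<le> C * (\<integral>x. (g x)\<^sup>2 \<partial>leb01)"
      by (simp add: integral_density_measure)
  qed
qed

lemma covariance_indicators:
  assumes s: "s \<in> {0..1}" and t: "t \<in> {0..1}"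
  shows "covariance (density_measure f0) (indicator {0..s}) (indicator {0..t})
    = distr_fun f0 (min s t) - distr_fun f0 s * distr_fun f0 t"
proof -
  interpret P: prob_space "density_measure f0" by (rule prob_space_density_measure)
  have E: "(\<integral>x. indicat_real {0..r} x \<partial>density_measure f0) = distr_fun f0 r" if "r \<in> {0..1}" for r
  proof -
    have m: "indicat_real {0..r} \<in> borel_measurable leb01" using sets_leb01_Icc[of r] that by simp
    have "(\<integral>x. indicat_real {0..r} x \<partial>density_measure f0) = ip leb01 (indicator {0..r}) f0"
      unfolding integral_density_measure[OF m] ip_def by (simp add: mult.commute)
    then show ?thesis using that by (simp add: ip_indicator distr_fun_def set_lebesgue_integral_def)
  qed
  have L: "indicat_real {0..r} \<in> L2 (density_measure f0)" if "r \<in> {0..1}" for r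
    using density_measure_L2 indicator_L2_leb01[of r] that by auto
  have "(\<lambda>x. indicat_real {0..s} x * indicator {0..t} x) = indicator {0..min s t}"
    by (auto simp: fun_eq_iff split: split_indicator)
  then have "ip (density_measure f0) (indicator {0..s}) (indicator {0..t}) = distr_fun f0 (min s t)"
    using E[of "min s t"] s t by (simp add: ip_def min_def)
  then show ?thesis using covariance_eq[OF P.prob_space_axioms L[OF s] L[OF t]] E[OF s] E[OF t] by simp
qed

end

context summable_primitives
begin

text \<open>Here \<open>V\<close> is the variance under the sampling distribution. The basis need
  not be orthonormal for that measure, so convergence of \<open>V\<close> along blocks is
  transferred from Lebesgue measure by the constant \<open>C\<close>.\<close>

lemma cdf_map_bridge:
  assumes f0: "bounded_density f0" and N: "P_bridge_limit \<psi> J0 w (density_measure f0) N" and G: "brownian_bridge f0 Q G"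
  shows "law_agrees N Q G"
proof -
  define P where "P = density_measure f0"
  interpret P: prob_space P unfolding P_def by (rule prob_space_density_measure[OF f0])
  obtain C where C: "\<And>g. g \<in> L2 leb01 \<Longrightarrow> g \<in> L2 P" "\<And>g. g \<in> L2 leb01 \<Longrightarrow> (\<integral>x. (g x)\<^sup>2 \<partial>P) \<le> C * (\<integral>x. (g x)\<^sup>2 \<partial>leb01)"
    using density_measure_L2[OF f0] unfolding P_def by blast
  have gp: "centred_gaussian_process Q {0..1} G (\<lambda>s t. distr_fun f0 (min s t) - distr_fun f0 s * distr_fun f0 t)"
    and Gc: "\<And>\<omega>. \<omega> \<in> space Q \<Longrightarrow> continuous_on {0..1} (\<lambda>t. G t \<omega>)"
    using G by (auto simp: brownian_bridge_def)
  have Ngp: "centred_gaussian_process N (index_set J0) (\<lambda>i x. x i) (\<lambda>(l, k) (l', k'). covariance P (\<psi> l k) (\<psi> l' k'))"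
    and sN: "sets N = sets (metric_borel M0)" using N by (auto simp: P_bridge_limit_def P_def)
  have pN: "prob_space N" using Ngp by (simp add: centred_gaussian_process_def)
  have NV: "(CLINT x|N. iexp (\<Sum>i\<in>F. c i * x i))
      = exp (- covariance P (synth F c) (synth F c) / 2)"
    if F: "finite F" "F \<subseteq> index_set J0" for F c
  proof -
    have L: "case_prod \<psi> i \<in> L2 P" if "i \<in> F" for i
      using that F(2) psi_L2 C(1) by (cases i) auto
    have eq: "covariance P (synth F c) (synth F c)
        = (\<Sum>i\<in>F. \<Sum>j\<in>F. c i * c j * (\<lambda>(l, k) (l', k'). covariance P (\<psi> l k) (\<psi> l' k')) i j)"
    proof -
      have "covariance P (synth F c) (synth F c)
          = (\<Sum>i\<in>F. \<Sum>j\<in>F. c i * c j * covariance P (case_prod \<psi> i) (case_prod \<psi> j))"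
        by (rule covariance_sum_sum[OF P.prob_space_axioms L])
      then show ?thesis by (simp add: case_prod_beta)
    qed
    have "0 \<le> (\<Sum>i\<in>F. \<Sum>j\<in>F. c i * c j * (\<lambda>(l, k) (l', k'). covariance P (\<psi> l k) (\<psi> l' k')) i j)"
      unfolding eq[symmetric] by (rule covariance_self_nonneg)
    from gaussian_process_iexp[OF Ngp F this] show ?thesis unfolding eq .
  qed
  have Vk: "covariance P (step J a) (step J a)
      = (\<Sum>s\<in>J. \<Sum>t\<in>J. a s * a t * (distr_fun f0 (min s t) - distr_fun f0 s * distr_fun f0 t))"
    if J: "J \<subseteq> {0..1}" for J a
  proof -
    have L: "indicat_real {0..t} \<in> L2 P" if "t \<in> J" for t
      using that J by (intro C(1) indicator_L2_leb01) auto
    show ?thesis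
    proof (subst covariance_sum_sum[OF P.prob_space_axioms L], assumption, intro sum.cong refl arg_cong2[where f="(*)"])
      fix s t assume "s \<in> J" "t \<in> J"
      then show "covariance P (indicator {0..s}) (indicator {0..t}) = distr_fun f0 (min s t) - distr_fun f0 s * distr_fun f0 t"
        unfolding P_def using J by (intro covariance_indicators[OF f0]) auto
    qed
  qed
  have V: "(\<lambda>m. covariance P (synth (level_block J0 m) (coef g)) (synth (level_block J0 m) (coef g)))
      \<longlonglongrightarrow> covariance P g g" if g: "g \<in> L2 leb01" for g
  proof (rule covariance_tendsto[OF P.prob_space_axioms])
    let ?h = "\<lambda>m y. \<Sum>i\<in>level_block J0 m. coef g i * case_prod \<psi> i y"
    note r = residual_norm[OF g]
    show "g \<in> L2 P" "?h m \<in> L2 P" for m using C(1) g r(3) by auto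
    show "(\<lambda>m. \<integral>x. (g x - ?h m x)\<^sup>2 \<partial>P) \<longlonglongrightarrow> 0"
    proof (rule tendsto_sandwich[OF _ _ tendsto_const])
      show "(\<lambda>m. C * (\<integral>x. (g x - ?h m x)\<^sup>2 \<partial>leb01)) \<longlonglongrightarrow> 0"
        using tendsto_mult[OF tendsto_const r(1), of C] by simp
      show "\<forall>\<^sub>F m in sequentially. (\<integral>x. (g x - ?h m x)\<^sup>2 \<partial>P) \<le> C * (\<integral>x. (g x - ?h m x)\<^sup>2 \<partial>leb01)"
        using C(2)[OF L2_diff[OF g r(3)]] by (intro always_eventually allI)
    qed simp
  qed
  show ?thesis
    by (rule cdf_map_law[where V="\<lambda>g. covariance P g g", OF pN sN gp Gc NV covariance_self_nonneg Vk V])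
qed

end

section \<open>Transfer of the Bernstein--von Mises phenomenon\<close>

text \<open>The mass is the evidence divided by itself: 1 in the regular case, and 0 by the
  conventions of extended division if the evidence is 0 or infinite.\<close>

lemma posterior_mass:
  assumes m: "(\<lambda>f. ennreal (lik f)) \<in> borel_measurable prior"
  shows "emeasure (posterior prior lik) (space (posterior prior lik)) \<le> 1"
proof -
  let ?E = "\<integral>\<^sup>+ f. ennreal (lik f) \<partial>prior"
  have "emeasure (posterior prior lik) (space (posterior prior lik)) = (\<integral>\<^sup>+ f. ennreal (lik f) / ?E \<partial>prior)"
    unfolding posterior_def using m by (subst emeasure_density) (auto intro!: nn_integral_cong)
  also have "\<dots> = ?E / ?E" using m by (rule nn_integral_divide)
  also have "\<dots> \<le> 1"
    by (cases "?E = 0 \<or> ?E = top") (auto simp: ennreal_divide_self less_top)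
  finally show ?thesis .
qed

text \<open>If \<open>h\<close> never takes values in \<open>space N\<close>, then \<open>distr M N h\<close> is the null measure; this is what
  the laws in the hypothesis are for data at which the centring leaves the multiscale space.\<close>

lemma integral_distr_outside:
  assumes "\<And>x. x \<in> space M \<Longrightarrow> h x \<notin> space N"
  shows "(\<integral>x. F x \<partial>distr M N h) = (0 :: real)"
proof -
  have "emeasure M (h -` A \<inter> space M) = 0" if "A \<in> sets N" for A
  proof -
    have "h -` A \<inter> space M = {}" using assms sets.sets_into_space[OF that] by auto
    then show ?thesis by simp
  qed
  then have "emeasure (distr M N h) (space N) = 0"
    unfolding distr_def by (simp add: emeasure_measure_of_conv)
  then have "space (distr M N h) \<in> null_sets (distr M N h)" by (simp add: null_sets_def)
  then have "AE x in distr M N h. x \<notin> space (distr M N h)" by (rule AE_not_in)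
  then have "AE x in distr M N h. F x = 0" by (rule AE_mp) (auto intro!: AE_I2)
  then show ?thesis by (rule integral_eq_zero_AE)
qed

lemma emeasure_distr_le:
  assumes "h \<in> measurable M N" "emeasure M (space M) \<le> 1"
  shows "emeasure (distr M N h) (space (distr M N h)) \<le> 1"
proof -
  have "h -` space N \<inter> space M = space M" using measurable_space[OF assms(1)] by auto
  then show ?thesis using assms by (simp add: emeasure_distr)
qed

lemma bl_dist_nonneg:
  assumes "emeasure \<mu> (space \<mu>) \<le> 1" "space \<mu> = mspace m" "emeasure \<nu> (space \<nu>) \<le> 1" "space \<nu> = mspace m"
  shows "0 \<le> bl_dist m \<mu> \<nu>"
  using bl_dist_upper[OF assms bl_norm_zero] by simp

text \<open>Only \<open>n > 0\<close> is compared, since rescaling by \<open>sqrt 0\<close> destroys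
  information. At \<open>n = 0\<close> the whole space serves as cover, which leaves the limit
  unchanged.\<close>

lemma tendsto_0_in_prob_mono:
  assumes Z: "tendsto_0_in_prob P Z"
    and le: "\<And>\<epsilon>. \<epsilon> > 0 \<Longrightarrow> \<exists>\<delta>>0. \<forall>n>0. \<forall>x\<in>space (P n). \<bar>Z n x\<bar> \<le> \<delta> \<longrightarrow> \<bar>Z' n x\<bar> \<le> \<epsilon>"
  shows "tendsto_0_in_prob P Z'"
  unfolding tendsto_0_in_prob_def
proof (intro allI impI)
  fix \<epsilon> :: real assume "\<epsilon> > 0"
  from le[OF this] obtain \<delta> where \<delta>: "\<delta> > 0"
    and imp: "\<forall>n>0. \<forall>x\<in>space (P n). \<bar>Z n x\<bar> \<le> \<delta> \<longrightarrow> \<bar>Z' n x\<bar> \<le> \<epsilon>" by (elim exE conjE)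
  from Z[unfolded tendsto_0_in_prob_def, rule_format, OF \<delta>]
  obtain A where A: "\<forall>n. A n \<in> sets (P n) \<and> {x \<in> space (P n). \<bar>Z n x\<bar> > \<delta>} \<subseteq> A n"
    and lim: "(\<lambda>n. measure (P n) (A n)) \<longlonglongrightarrow> 0" by (elim exE conjE)
  let ?A = "\<lambda>n. if n = 0 then space (P n) else A n"
  have "{x \<in> space (P n). \<bar>Z' n x\<bar> > \<epsilon>} \<subseteq> ?A n" for n
  proof (cases "n = 0")
    case False
    have "{x \<in> space (P n). \<bar>Z' n x\<bar> > \<epsilon>} \<subseteq> {x \<in> space (P n). \<bar>Z n x\<bar> > \<delta>}"
    proof (intro subsetI CollectI conjI)
      fix x assume x: "x \<in> {x \<in> space (P n). \<bar>Z' n x\<bar> > \<epsilon>}"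
      then show "x \<in> space (P n)" by simp
      then have "\<bar>Z n x\<bar> \<le> \<delta> \<Longrightarrow> \<bar>Z' n x\<bar> \<le> \<epsilon>" using imp False by blast
      then show "\<bar>Z n x\<bar> > \<delta>" using x by force
    qed
    also have "\<dots> \<subseteq> ?A n" using A False by simp
    finally show ?thesis .
  qed simp
  moreover have "(\<lambda>n. measure (P n) (?A n)) \<longlonglongrightarrow> 0"
    by (rule Lim_transform_eventually[OF lim]) (auto simp: eventually_sequentially intro!: exI[of _ 1])
  ultimately show "\<exists>A. (\<forall>n. A n \<in> sets (P n) \<and> {x \<in> space (P n). \<bar>Z' n x\<bar> > \<epsilon>} \<subseteq> A n) \<and> (\<lambda>n. measure (P n) (A n)) \<longlonglongrightarrow> 0"
    using A by (intro exI[of _ ?A]) auto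
qed

text \<open>Joint measurability of evaluation makes an integral over \<open>x\<close> measurable in
  the function, by the measurability half of Fubini's theorem.\<close>

lemma ip_prior_measurable:
  assumes p: "prior_on_L2 prior" and g: "g \<in> borel_measurable leb01"
  shows "(\<lambda>f. ip leb01 f g) \<in> borel_measurable prior" "(\<lambda>f. ip leb01 f f) \<in> borel_measurable prior"
proof -
  interpret leb01: prob_space leb01 by (rule prob_space_leb01)
  have ev[measurable]: "(\<lambda>p. fst p (snd p)) \<in> borel_measurable (prior \<Otimes>\<^sub>M leb01)"
  proof -
    have eq: "(\<lambda>p. fst p (snd p)) = (\<lambda>(f, x). f x :: real)" by (simp add: fun_eq_iff split_beta)
    show ?thesis using p unfolding prior_on_L2_def eq by (elim conjE)
  qed
  have g'[measurable]: "g \<in> borel_measurable leb01" by (rule g)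
  have "(\<lambda>(f, x). f x * g x) \<in> borel_measurable (prior \<Otimes>\<^sub>M leb01)" unfolding case_prod_beta by measurable
  then show "(\<lambda>f. ip leb01 f g) \<in> borel_measurable prior"
    unfolding ip_def by (rule leb01.borel_measurable_lebesgue_integral)
  have "(\<lambda>(f, x). f x * f x) \<in> borel_measurable (prior \<Otimes>\<^sub>M leb01)" unfolding case_prod_beta by measurable
  then show "(\<lambda>f. ip leb01 f f) \<in> borel_measurable prior"
    unfolding ip_def by (rule leb01.borel_measurable_lebesgue_integral)
qed

lemma sampling_likelihood_measurable:
  assumes p: "prior_on_L2 prior" and X: "\<And>i. i < n \<Longrightarrow> X i \<in> {0..1}"
  shows "sampling_likelihood n X \<in> borel_measurable prior"
proof -
  have ev: "(\<lambda>(f, x). f x) \<in> borel_measurable (prior \<Otimes>\<^sub>M leb01)" using p by (simp add: prior_on_L2_def)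
  have "(\<lambda>f. f (X i)) \<in> borel_measurable prior" if "i < n" for i
    using measurable_compose[OF measurable_Pair2'[of "X i" leb01 prior] ev] X[OF that] by simp
  then show ?thesis unfolding sampling_likelihood_def[abs_def] by (intro borel_measurable_prod) auto
qed

context summable_primitives
begin

lemma coef_measurable:
  assumes p: "prior_on_L2 prior" and i: "i \<in> index_set J0"
  shows "(\<lambda>f. coef f i) \<in> borel_measurable prior"
proof -
  obtain l k where lk: "i = (l, k)" by (cases i)
  then have "\<psi> l k \<in> borel_measurable leb01" using psi_L2 i by (simp add: L2_def)
  from ip_prior_measurable(1)[OF p this] show ?thesis using i lk by (simp add: wavelet_coeffs_apply)
qed

lemma wn_likelihood_measurable:
  assumes p: "prior_on_L2 prior"
  shows "wn_likelihood \<psi> J0 n X \<in> borel_measurable prior"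
proof -
  have "(\<lambda>f. \<Sum>k<level_size J0 (lev j). coef f (lev j, k) * X (lev j, k)) \<in> borel_measurable prior" for j
    using lev_in by (intro borel_measurable_sum borel_measurable_times coef_measurable[OF p]) auto
  then have "(\<lambda>f. wn_integral \<psi> J0 X f) \<in> borel_measurable prior"
    unfolding wn_integral_def Let_def by (rule borel_measurable_suminf)
  moreover have "(\<lambda>f. ip leb01 f f) \<in> borel_measurable prior"
    by (rule ip_prior_measurable(2)[OF p]) (rule borel_measurable_const[of 0])
  ultimately show ?thesis unfolding wn_likelihood_def[abs_def] by measurable
qed

text \<open>The pushforward under \<open>cdf_map\<close> increases bounded-Lipschitz distances at most by the factor \<open>K\<close>.
  Where the distance in the hypothesis is below 1, the centring lies in the multiscale space.\<close>

theorem BvM_transfer: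
  assumes p: "prior_on_L2 prior"
    and post: "\<And>n X. X \<in> space (P n) \<Longrightarrow> sets (post n X) = sets prior"
      "\<And>n X. X \<in> space (P n) \<Longrightarrow> emeasure (post n X) (space (post n X)) \<le> 1"
    and c: "\<And>n X. X \<in> space (P n) \<Longrightarrow> c n X \<in> extensional (index_set J0)"
    and C: "\<And>n X t. X \<in> space (P n) \<Longrightarrow> c n X \<in> mspace M0 \<Longrightarrow> t \<in> {0..1} \<Longrightarrow>
      C n X t = wn_integral \<psi> J0 (c n X) (indicat_real {0..t})"
    and N: "prob_space N" "sets N = sets (metric_borel M0)"
    and Q: "prob_space Q" and law_agrees: "law_agrees N Q G"
    and BvM: "weak_BvM \<psi> J0 w P post c N"
  shows "BvM_cdf P post C Q G \<and> BvM_cdf_norm P post C Q G"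
proof -
  interpret N: prob_space N by (rule N(1))
  interpret Q: prob_space Q by (rule Q)
  note Gm = law_agrees[THEN conjunct1] and law = law_agrees[THEN conjunct2]
  define Z where "Z n X = bl_dist M0 (distr (post n X) (metric_borel M0)
          (\<lambda>f. \<lambda>i\<in>index_set J0. sqrt (real n) * (coef f i - c n X i))) N" for n X
  define Y where "Y n X = bl_dist C01
       (distr (post n X) (metric_borel C01) (\<lambda>f. \<lambda>t\<in>{0..1}. sqrt (real n) * (distr_fun f t - C n X t)))
       (distr Q (metric_borel C01) (path G))" for n X
  define U where "U n X = bl_dist euclidean_metric
       (distr (post n X) borel (\<lambda>f. sqrt (real n) * sup_norm01 (\<lambda>t. distr_fun f t - C n X t)))
       (distr Q borel (\<lambda>\<omega>. sup_norm01 (\<lambda>t. G t \<omega>)))" for n X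
  have Z: "tendsto_0_in_prob P Z" using BvM unfolding weak_BvM_def Z_def .
  have spN: "space N = mspace M0" using sets_eq_imp_space_eq[OF N(2)] by simp
  have main: "0 \<le> Y n X \<and> 0 \<le> U n X \<and> Y n X \<le> K * Z n X \<and> U n X \<le> K * Z n X"
    if n: "n > 0" and X: "X \<in> space (P n)" and small: "Z n X \<le> 1 / 2" for n X
  proof -
    let ?s = "sqrt (real n)"
    let ?\<Phi> = "\<lambda>f. \<lambda>i\<in>index_set J0. ?s * (coef f i - c n X i)"
    let ?H = "\<lambda>f. \<lambda>t\<in>{0..1}. ?s * (distr_fun f t - C n X t)"
    have s: "?s > 0" using n by simp
    have sp: "space (post n X) = space prior" using post(1)[OF X] by (rule sets_eq_imp_space_eq)
    have L2: "f \<in> L2 leb01" if "f \<in> space (post n X)" for f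
      using p that sp by (auto simp: prior_on_L2_def)
    have cM: "c n X \<in> mspace M0"
    \<comment> \<open>As \<open>coef f\<close> lies in the multiscale space, which is linear, and
      \<open>sqrt n\<close> is nonzero, a centring outside puts \<open>?\<Phi> f\<close> outside for
      every \<open>f\<close>. The image law is then null, and the test function 1 separates it from
      \<open>N\<close> by 1, against the bound \<open>1 / 2\<close>.\<close>
    proof (rule ccontr)
      assume nc: "c n X \<notin> mspace M0"
      have out: "?\<Phi> f \<notin> space (metric_borel M0)" if f: "f \<in> space (post n X)" for f
      proof
        assume "?\<Phi> f \<in> space (metric_borel M0)"
        then have "?\<Phi> f \<in> mspace M0" by (simp only: space_metric_borel)
        then have "(\<lambda>i\<in>index_set J0. 1 * coef f i + (- (1 / ?s)) * ?\<Phi> f i) \<in> mspace M0"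
          by (rule M0_lincomb[OF w coef_M0[OF L2[OF f]]])
        also have "(\<lambda>i\<in>index_set J0. 1 * coef f i + (- (1 / ?s)) * ?\<Phi> f i) = c n X"
          using s c[OF X] by (intro extensionalityI[of _ "index_set J0"]) (auto simp: field_simps)
        finally show False using nc by simp
      qed
      let ?\<mu> = "distr (post n X) (metric_borel M0) ?\<Phi>"
      have z: "(\<integral>x. F x \<partial>?\<mu>) = 0" for F :: "_ \<Rightarrow> real" by (rule integral_distr_outside[OF out])
      have "\<bar>(\<integral>x. 1 \<partial>?\<mu>) - (\<integral>x. 1 \<partial>N)\<bar> \<le> Z n X"
        unfolding Z_def bl_dist_def
      proof (rule cSUP_upper)
        show "(\<lambda>_. 1) \<in> {F. bl_norm M0 F \<le> 1}" by (simp add: bl_norm_one)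
        show "bdd_above ((\<lambda>F. \<bar>(\<integral>x. F x \<partial>?\<mu>) - (\<integral>x. F x \<partial>N)\<bar>) ` {F. bl_norm M0 F \<le> 1})"
        proof (rule bdd_aboveI2)
          fix F assume "F \<in> {F. bl_norm M0 F \<le> 1}"
          then have "\<bar>\<integral>x. F x \<partial>N\<bar> \<le> 1"
            using bl_norm_leD(1)[of M0 F] spN N.emeasure_space_1 by (intro abs_integral_le_1) auto
          then show "\<bar>(\<integral>x. F x \<partial>?\<mu>) - (\<integral>x. F x \<partial>N)\<bar> \<le> 1" by (simp only: z diff_0 abs_minus_cancel)
        qed
      qed
      then have "\<bar>0 - (\<integral>x. 1 \<partial>N)\<bar> \<le> Z n X" by (simp only: z)
      then have "1 \<le> Z n X" by (simp add: N.prob_space)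
      then show False using small by simp
    qed
    have \<Phi>M: "?\<Phi> f \<in> mspace M0" if "f \<in> space (post n X)" for f
    proof -
      have "?\<Phi> f = (\<lambda>i\<in>index_set J0. ?s * coef f i + (- ?s) * c n X i)"
        by (auto simp: fun_eq_iff algebra_simps)
      then show ?thesis using M0_lincomb[OF w coef_M0[OF L2[OF that]] cM, of ?s "- ?s"] by simp
    qed
    have \<Phi>m: "?\<Phi> \<in> measurable (post n X) (metric_borel M0)"
    proof (rule coordinate_metric.measurable_coordinates[OF coordinate_metric_M0[OF w] \<Phi>M])
      fix i assume i: "i \<in> index_set J0"
      have "(\<lambda>f. coef f i) \<in> borel_measurable (post n X)"
        using coef_measurable[OF p i] post(1)[OF X] by (simp cong: measurable_cong_sets)
      then show "(\<lambda>f. ?\<Phi> f i) \<in> borel_measurable (post n X)" using i by simp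
    qed
    let ?\<mu> = "distr (post n X) (metric_borel M0) ?\<Phi>"
    have H: "cdf_map \<psi> J0 (?\<Phi> f) = ?H f" if f: "f \<in> space (post n X)" for f
    proof (rule extensionalityI[of _ "{0..1}"])
      fix t :: real assume t: "t \<in> {0..1}"
      show "cdf_map \<psi> J0 (?\<Phi> f) t = ?H f t"
        using cdf_map_rescaled[OF L2[OF f] cM t, of ?s] C[OF X cM t] t by simp
    qed (auto simp: cdf_map_def)
    have push: "distr ?\<mu> (metric_borel C01) (cdf_map \<psi> J0) = distr (post n X) (metric_borel C01) ?H"
      using H by (subst distr_distr[OF cdf_map_measurable \<Phi>m]) (auto intro!: distr_cong)
    have Y: "Y n X \<le> K * Z n X"
      unfolding Y_def Z_def push[symmetric] law[symmetric]
      by (intro bl_dist_pushforward emeasure_distr_le[OF \<Phi>m] post X N cdf_map_C01 K_ge_1 cdf_map_Lipschitz)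
        (simp_all add: N.emeasure_space_1)
    have Hm: "?H \<in> measurable (post n X) (metric_borel C01)"
      using measurable_compose[OF \<Phi>m cdf_map_measurable] H by (simp cong: measurable_cong)
    have sm: "sup_norm01 \<in> borel_measurable (metric_borel C01)"
      unfolding metric_borel_euclidean[symmetric]
      by (intro measurable_metric_borel_continuous Lipschitz_continuous_map_intro[where K=1])
        (auto simp: dist_real_def sup_norm01_Lipschitz)
    have p1: "distr (distr (post n X) (metric_borel C01) ?H) borel sup_norm01
        = distr (post n X) borel (\<lambda>f. ?s * sup_norm01 (\<lambda>t. distr_fun f t - C n X t))"
    proof (subst distr_distr[OF sm Hm], rule distr_cong)
      fix f assume f: "f \<in> space (post n X)"
      have "continuous_on {0..1} (?H f)"
        using cdf_map_C01[OF \<Phi>M[OF f]] unfolding H[OF f] mspace_C01 by simp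
      \<comment> \<open>Dividing the scaling out again shows that the unscaled difference is
        continuous; the supremum of its modulus is then finite and commutes with the factor.\<close>
      then have "continuous_on {0..1} (\<lambda>t. (1 / ?s) * ?H f t)" by (intro continuous_intros)
      then have cont: "continuous_on {0..1} (\<lambda>t. distr_fun f t - C n X t)"
        by (rule continuous_on_eq) (use s in simp)
      have "sup_norm01 (?H f) = sup_norm01 (\<lambda>t. ?s * (distr_fun f t - C n X t))"
        by (rule sup_norm01_cong) simp
      also have "\<dots> = ?s * sup_norm01 (\<lambda>t. distr_fun f t - C n X t)"
        by (rule sup_norm01_scale[OF _ cont]) simp
      finally show "(sup_norm01 \<circ> ?H) f = ?s * sup_norm01 (\<lambda>t. distr_fun f t - C n X t)" by simp
    qed simp_all
    have p2: "distr (distr Q (metric_borel C01) (path G)) borel sup_norm01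
        = distr Q borel (\<lambda>\<omega>. sup_norm01 (\<lambda>t. G t \<omega>))"
    proof (subst distr_distr[OF sm Gm], rule distr_cong)
      fix \<omega>
      have "sup_norm01 (\<lambda>t\<in>{0..1}. G t \<omega>) = sup_norm01 (\<lambda>t. G t \<omega>)" by (rule sup_norm01_cong) simp
      then show "(sup_norm01 \<circ> path G) \<omega> = sup_norm01 (\<lambda>t. G t \<omega>)" by simp
    qed simp_all
    have "U n X \<le> 1 * Y n X"
      unfolding U_def Y_def p1[symmetric] p2[symmetric] unfolding metric_borel_euclidean[symmetric]
      by (intro bl_dist_pushforward emeasure_distr_le[OF Hm] emeasure_distr_le[OF Gm] post X)
        (simp_all add: Q.emeasure_space_1 dist_real_def sup_norm01_Lipschitz)
    moreover have "0 \<le> Y n X"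
      unfolding Y_def
      by (rule bl_dist_nonneg[OF emeasure_distr_le[OF Hm post(2)[OF X]] _ emeasure_distr_le[OF Gm]])
        (simp_all add: Q.emeasure_space_1)
    moreover have "0 \<le> U n X"
    proof -
      have sm': "sup_norm01 \<in> borel_measurable (distr M (metric_borel C01) h)" for M :: "'z measure" and h
        using sm by simp
      show ?thesis
        unfolding U_def p1[symmetric] p2[symmetric]
        by (rule bl_dist_nonneg[OF emeasure_distr_le[OF sm' emeasure_distr_le[OF Hm post(2)[OF X]]] _
              emeasure_distr_le[OF sm' emeasure_distr_le[OF Gm]]])
          (simp_all add: Q.emeasure_space_1)
    qed
    ultimately show ?thesis using Y by simp
  qed
  have le: "\<exists>\<delta>>0. \<forall>n>0. \<forall>X\<in>space (P n). \<bar>Z n X\<bar> \<le> \<delta> \<longrightarrow> \<bar>Y n X\<bar> \<le> \<epsilon> \<and> \<bar>U n X\<bar> \<le> \<epsilon>" if \<epsilon>: "\<epsilon> > 0" for \<epsilon>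
  \<comment> \<open>The first bound forces the centring into the multiscale space, the second pays
    for the Lipschitz factor \<open>K\<close>.\<close>
  proof (intro exI[of _ "min (1 / 2) (\<epsilon> / K)"] conjI allI impI ballI)
    show "0 < min (1 / 2) (\<epsilon> / K)" using \<epsilon> K_ge_1 by simp
    fix n X assume n: "n > 0" and X: "X \<in> space (P n)" and small: "\<bar>Z n X\<bar> \<le> min (1 / 2) (\<epsilon> / K)"
    then have "Z n X \<le> \<epsilon> / K" "Z n X \<le> 1 / 2" by auto
    moreover from this have "K * Z n X \<le> \<epsilon>" using K_ge_1 by (simp add: pos_le_divide_eq mult.commute)
    ultimately show "\<bar>Y n X\<bar> \<le> \<epsilon>" "\<bar>U n X\<bar> \<le> \<epsilon>" using main[OF n X] by auto
  qed
  have "tendsto_0_in_prob P Y"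
  proof (rule tendsto_0_in_prob_mono[OF Z])
    fix \<epsilon> :: real assume "\<epsilon> > 0"
    from le[OF this] obtain \<delta> where \<delta>: "\<delta> > 0"
      "\<forall>n>0. \<forall>X\<in>space (P n). \<bar>Z n X\<bar> \<le> \<delta> \<longrightarrow> \<bar>Y n X\<bar> \<le> \<epsilon> \<and> \<bar>U n X\<bar> \<le> \<epsilon>"
      by (elim exE conjE)
    show "\<exists>\<delta>>0. \<forall>n>0. \<forall>X\<in>space (P n). \<bar>Z n X\<bar> \<le> \<delta> \<longrightarrow> \<bar>Y n X\<bar> \<le> \<epsilon>"
      by (intro exI[of _ \<delta>] conjI \<delta>(1) allI impI ballI) (use \<delta>(2) in simp)
  qed
  then have "BvM_cdf P post C Q G" unfolding BvM_cdf_def Y_def .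
  moreover have "tendsto_0_in_prob P U"
  proof (rule tendsto_0_in_prob_mono[OF Z])
    fix \<epsilon> :: real assume "\<epsilon> > 0"
    from le[OF this] obtain \<delta> where \<delta>: "\<delta> > 0"
      "\<forall>n>0. \<forall>X\<in>space (P n). \<bar>Z n X\<bar> \<le> \<delta> \<longrightarrow> \<bar>Y n X\<bar> \<le> \<epsilon> \<and> \<bar>U n X\<bar> \<le> \<epsilon>"
      by (elim exE conjE)
    show "\<exists>\<delta>>0. \<forall>n>0. \<forall>X\<in>space (P n). \<bar>Z n X\<bar> \<le> \<delta> \<longrightarrow> \<bar>U n X\<bar> \<le> \<epsilon>"
      by (intro exI[of _ \<delta>] conjI \<delta>(1) allI impI ballI) (use \<delta>(2) in simp)
  qed
  then have "BvM_cdf_norm P post C Q G" unfolding BvM_cdf_norm_def U_def .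
  ultimately show ?thesis ..
qed

end

text \<open>The unconditional sum over integer levels is reindexed as a series over natural numbers,
  counted from the bottom level.\<close>

lemma summable_weights:
  assumes s: "(\<lambda>l. w l * 2 powr (- of_int l / 2)) summable_on {int J0 - 1..}"
  shows "summable (\<lambda>j. w (int J0 - 1 + int j) * (C * decay (int J0 - 1 + int j)))"
proof -
  have im: "(\<lambda>j. int J0 - 1 + int j) ` UNIV = {int J0 - 1..}"
  proof (intro equalityI subsetI)
    fix l assume "l \<in> {int J0 - 1..}"
    then have "l = int J0 - 1 + int (nat (l - (int J0 - 1)))" by simp
    then show "l \<in> range (\<lambda>j. int J0 - 1 + int j)" by blast
  qed auto
  have "inj (\<lambda>j. int J0 - 1 + int j)" by (auto simp: inj_def)
  then have "((\<lambda>l. w l * 2 powr (- of_int l / 2)) \<circ> (\<lambda>j. int J0 - 1 + int j)) summable_on UNIV"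
    using summable_on_reindex[of "\<lambda>j. int J0 - 1 + int j" UNIV "\<lambda>l. w l * 2 powr (- of_int l / 2)"] s im by simp
  then have "summable ((\<lambda>l. w l * 2 powr (- of_int l / 2)) \<circ> (\<lambda>j. int J0 - 1 + int j))"
    by (rule summable_on_imp_summable)
  from summable_mult[OF this, of C] show ?thesis by (simp add: o_def mult.left_commute)
qed

theorem theorem4:
  fixes S :: real and J0 :: nat and \<psi> :: "int \<Rightarrow> nat \<Rightarrow> real \<Rightarrow> real"
    and w :: "int \<Rightarrow> real"
    and prior :: "(real \<Rightarrow> real) measure" and f0 :: "real \<Rightarrow> real"
    and N :: "(int \<times> nat \<Rightarrow> real) measure"
    and Q :: "'q measure" and G :: "real \<Rightarrow> 'q \<Rightarrow> real"
  assumes "wavelet_basis S J0 \<psi>"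
    and "admissible J0 w"
    and "(\<lambda>l. w l * 2 powr (- of_int l / 2)) summable_on {int J0 - 1..}"
    and "prior_on_L2 prior"
  shows
    "(\<forall>T.
        f0 \<in> L2 leb01 \<and> wn_centring_ok \<psi> J0 T \<and>
        white_noise_limit J0 w N \<and> brownian_motion Q G \<and>
        weak_BvM \<psi> J0 w (white_noise_law \<psi> J0 f0)
          (\<lambda>n X. posterior prior (wn_likelihood \<psi> J0 n X)) (wn_centring_coeffs \<psi> J0 T) N
        \<longrightarrow>
        BvM_cdf (white_noise_law \<psi> J0 f0)
          (\<lambda>n X. posterior prior (wn_likelihood \<psi> J0 n X)) (wn_centring_cdf \<psi> J0 T) Q G \<and>
        BvM_cdf_norm (white_noise_law \<psi> J0 f0)
          (\<lambda>n X. posterior prior (wn_likelihood \<psi> J0 n X)) (wn_centring_cdf \<psi> J0 T) Q G)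
     \<and>
     (\<forall>T.
        (\<forall>f\<in>space prior. probability_density f) \<and> bounded_density f0 \<and> sampling_estimator \<psi> J0 T \<and>
        P_bridge_limit \<psi> J0 w (density_measure f0) N \<and> brownian_bridge f0 Q G \<and>
        weak_BvM \<psi> J0 w (\<lambda>n. sampling_law f0)
          (\<lambda>n X. posterior prior (sampling_likelihood n X))
          (\<lambda>n X. wavelet_coeffs \<psi> J0 (T n (restrict X {..<n}))) N
        \<longrightarrow>
        BvM_cdf (\<lambda>n. sampling_law f0)
          (\<lambda>n X. posterior prior (sampling_likelihood n X))
          (\<lambda>n X. distr_fun (T n (restrict X {..<n}))) Q G \<and>
        BvM_cdf_norm (\<lambda>n. sampling_law f0)
          (\<lambda>n X. posterior prior (sampling_likelihood n X))
          (\<lambda>n X. distr_fun (T n (restrict X {..<n}))) Q G)"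
proof -
  note p = assms(4)
  obtain C where C: "\<And>l t. int J0 - 1 \<le> l \<Longrightarrow> t \<in> {0..1} \<Longrightarrow>
      (\<Sum>k<level_size J0 l. \<bar>ip leb01 (indicator {0..t}) (\<psi> l k)\<bar>) \<le> C * decay l"
    using wavelet_level_bound[OF assms(1)] by blast
  interpret summable_primitives \<psi> J0 w "\<lambda>j. C * decay (int J0 - 1 + int j)"
  proof
    show "orthonormal_basis leb01 (index_set J0) (\<lambda>(l, k). \<psi> l k)" using assms(1) by (simp add: wavelet_basis_def)
    show "weight J0 w" using assms(2) by (simp add: admissible_def)
    show "summable (\<lambda>j. w (int J0 - 1 + int j) * (C * decay (int J0 - 1 + int j)))"
      by (rule summable_weights[OF assms(3)])
  qed (rule C, simp_all)
  have post: "sets (posterior prior lik) = sets prior" for lik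
    by (simp add: posterior_def)
  have mass: "emeasure (posterior prior lik) (space (posterior prior lik)) \<le> 1"
    if "lik \<in> borel_measurable prior" for lik
    using that by (intro posterior_mass) simp
  show ?thesis
  proof (rule conjI; intro allI impI; elim conjE)
    fix T
    let ?P = "white_noise_law \<psi> J0 f0"
    assume T: "wn_centring_ok \<psi> J0 T" and N: "white_noise_limit J0 w N" and G: "brownian_motion Q G"
      and BvM: "weak_BvM \<psi> J0 w ?P (\<lambda>n X. posterior prior (wn_likelihood \<psi> J0 n X)) (wn_centring_coeffs \<psi> J0 T) N"
    have c: "wn_centring_coeffs \<psi> J0 T n X \<in> extensional (index_set J0)" if "X \<in> space (?P n)" for n X
      using that by (cases T) (auto simp: white_noise_law_def space_PiM PiE_def)
    \<comment> \<open>For the observation this is the definition of its distribution function; for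
      an estimator it is Parseval's identity.\<close>
    have C: "wn_centring_cdf \<psi> J0 T n X t = wn_integral \<psi> J0 (wn_centring_coeffs \<psi> J0 T n X) (indicat_real {0..t})"
      if X: "X \<in> space (?P n)" and t: "t \<in> {0..1}" for n X t
    proof (cases T)
      case (Estimator T')
      have "X \<in> space (\<Pi>\<^sub>M i\<in>index_set J0. (borel::real measure))"
        using X by (simp add: white_noise_law_def)
      then have "T' n X \<in> L2 leb01" using T Estimator by auto
      then show ?thesis using distr_fun_eq t Estimator by simp
    qed simp
    have NQ: "prob_space N" "sets N = sets (metric_borel M0)" "prob_space Q"
      using N G by (auto simp: white_noise_limit_def brownian_motion_def centred_gaussian_process_def)
    show "BvM_cdf ?P (\<lambda>n X. posterior prior (wn_likelihood \<psi> J0 n X)) (wn_centring_cdf \<psi> J0 T) Q G \<and>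
        BvM_cdf_norm ?P (\<lambda>n X. posterior prior (wn_likelihood \<psi> J0 n X)) (wn_centring_cdf \<psi> J0 T) Q G"
      by (rule BvM_transfer[OF p post mass[OF wn_likelihood_measurable[OF p]] c C NQ cdf_map_white_noise[OF N G] BvM])
  next
    fix T :: "nat \<Rightarrow> (nat \<Rightarrow> real) \<Rightarrow> real \<Rightarrow> real"
    let ?P = "\<lambda>n. sampling_law f0" and ?T = "\<lambda>n X. T n (restrict X {..<n})"
    assume T: "sampling_estimator \<psi> J0 T" and f0: "bounded_density f0"
      and N: "P_bridge_limit \<psi> J0 w (density_measure f0) N" and G: "brownian_bridge f0 Q G"
      and BvM: "weak_BvM \<psi> J0 w ?P (\<lambda>n X. posterior prior (sampling_likelihood n X)) (\<lambda>n X. coef (?T n X)) N"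
    have range: "X i \<in> {0..1}" if "X \<in> space (sampling_law f0)" for X i
      using that by (auto simp: sampling_law_def space_PiM density_measure_def PiE_def Pi_def)
    have C: "distr_fun (?T n X) t = wn_integral \<psi> J0 (coef (?T n X)) (indicat_real {0..t})"
      if X: "X \<in> space (sampling_law f0)" and t: "t \<in> {0..1}" for n X t
    proof -
      \<comment> \<open>Square-integrability of the estimator is given only at samples from the unit
        interval, and the product space contains no others.\<close>
      have "restrict X {..<n} \<in> space (\<Pi>\<^sub>M i\<in>{..<n}. leb01)" using range[OF X] by (auto simp: space_PiM)
      then have "?T n X \<in> L2 leb01" using T by (auto simp: sampling_estimator_def)
      then show ?thesis by (rule distr_fun_eq[OF _ t])
    qed
    have m: "emeasure (posterior prior (sampling_likelihood n X)) (space (posterior prior (sampling_likelihood n X))) \<le> 1"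
      if "X \<in> space (sampling_law f0)" for n X
      by (rule mass[OF sampling_likelihood_measurable[OF p range[OF that]]])
    have NQ: "prob_space N" "sets N = sets (metric_borel M0)" "prob_space Q"
      using N G by (auto simp: P_bridge_limit_def brownian_bridge_def centred_gaussian_process_def)
    show "BvM_cdf ?P (\<lambda>n X. posterior prior (sampling_likelihood n X)) (\<lambda>n X. distr_fun (?T n X)) Q G \<and>
        BvM_cdf_norm ?P (\<lambda>n X. posterior prior (sampling_likelihood n X)) (\<lambda>n X. distr_fun (?T n X)) Q G"
      by (rule BvM_transfer[OF p post m
            wavelet_coeffs_extensional C NQ cdf_map_bridge[OF f0 N G] BvM])
  qed
qed

end
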